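(* Let $(F,R_\bullet)$ be an IMCGD. Then there exists an ACGD $\widetilde{F}$ such that $\widetilde{F}\circ\alpha=\alpha\circ F$. Moreover, if $(F,R_\bullet)$ is invertible, then this $\widetilde{F}$ is invertible.
   Context: Fix finite sets $\pi$ (ports), $\Sigma$, $\Delta$ (labels). A graph has an at most countable vertex set and edges $\{u:a,v:b\}$ (unordered, $a,b$ ports), each vertex–port pair in at most one edge, partial vertex labels in $\Sigma$ and edge labels in $\Delta$, and is connected. A pointed graph modulo is an isomorphism class of pointed graphs (renamings of vertices preserving edges, ports, labels and pointer); $\mathcal{X}_{\Sigma,\Delta,\pi}$ is their set. An anonymous graph is an isomorphism class of unpointed graphs; $\widetilde{\mathcal{X}}_{\Sigma,\Delta,\pi}$ is their set. In a pointed graph modulo $X$, vertices are designated by paths (words of port pairs $ab$, "leave by $a$, arrive by $b$", from the pointer, identified when they reach the same vertex); $V(X)$ is the vertex set, $\varepsilon$ the pointer, "." concatenation; $X_u$ is $X$ re-pointed at $u$; the disk $X^r$ is the pointed graph modulo of the subgraph induced by vertices at distance $\le r+1$ from the pointer, with labels kept only on vertices at distance $\le r$ and edges between them. A dynamics $(F,R_\bullet)$ over a set $\mathcal{S}$ of pointed graphs modulo is $F:\mathcal{S}\to\mathcal{S}$ with maps $R_X:V(X)\to V(F(X))$. Continuous: for all $X,m$ there is $n$ with $F(X)^m=F(X^n)^m$, $\mathrm{dom}\,R_X^m\subseteq V(X^n)$, $R_X^m=R_{X^n}^m$ ($R_X^m$ = restriction of $R_X$ to vertices mapped into $F(X)^m$).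 Shift-invariant: $F(X_u)=F(X)_{R_X(u)}$ and $R_X(u.v)=R_X(u).R_{X_u}(v)$. Bounded: there is $b$ such that for all $X$ and $w'\in V(F(X))$ there are $u'\in\mathrm{Im}R_X$, $v'\in V(F(X)_{u'}^b)$ with $w'=u'.v'$. A CGD is a continuous, shift-invariant, bounded dynamics. An ACGD is a map $\widetilde{F}$ on $\widetilde{\mathcal{X}}_{\Sigma,\Delta,\pi}$ for which some CGD $(F,R_\bullet)$ over $\mathcal{X}_{\Sigma,\Delta,\pi}$ satisfies: for every $X$, $\widetilde{F}$ sends the anonymous graph of $X$ to the anonymous graph of $F(X)$. An ACGD is invertible if it is bijective. Invisible matter: assume $m\notin\Sigma$, $m,l,r\notin\pi$, $\mathcal{X}'=\mathcal{X}_{\Sigma\cup\{m\},\Delta,\pi\cup\{m,l,r\}}$. $T$ is the infinite rooted binary tree, all vertices labelled $m$, each vertex connected via port $l$ (resp. $r$) to port $m$ of its left (resp. right) child. Each $X\in\mathcal{X}_{\Sigma,\Delta,\pi}$ is identified with the graph of $\mathcal{X}'$ obtained by attaching to each vertex $v$ a copy of $T$ whose root's port $m$ is linked to port $m$ of $v$. $\mathcal{Y}$ is the set of all such graphs with the pointer at any vertex; tree vertices are invisible, the others visible. $X_{\bullet s}=X_{mm.s}$ for $s\in\{lm,rm\}^*$. A dynamics over $\mathcal{Y}$ is invisible matter quiescent if there is $b$ with $R_{X_{\bullet s}}(t)=t$ for all $X\in\mathcal{X}_{\Sigma,\Delta,\pi}$, $s,t\in\{lm,rm\}^*$, $|s|\ge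 b$; vertex-preserving if every $R_Y$ is bijective. An IMCGD is a vertex-preserving, invisible matter quiescent CGD over $\mathcal{Y}$; it is invertible if $F$ is a bijection of $\mathcal{Y}$. $\alpha:\mathcal{Y}\to\widetilde{\mathcal{X}}_{\Sigma,\Delta,\pi}$ is the surjective map that forgets the pointer and removes all invisible vertices.
   Formalization: Over 𝒴 the disk Xⁿ is finite, so never in 𝒴, and F(Xⁿ), R_{Xⁿ} in the definition of continuity are undefined; there continuity of the IMCGD is read as comparing X with every Z in 𝒴 having Zⁿ = Xⁿ. *)

theory Defs
  imports "HOL-Library.Countable_Set" "HOL-Library.FuncSet"
begin

section \<open>Graphs with ports and labels\<close>

text \<open>A pair \<open>(u, a)\<close> is the port \<open>u:a\<close> of vertex \<open>u\<close>; an edge is a two-element set of such pairs.\<close>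

record ('v, 's, 'd, 'p) graph =
  verts :: "'v set"
  edges :: "('v \<times> 'p) set set"
  vlab  :: "'v \<rightharpoonup> 's"
  elab  :: "('v \<times> 'p) set \<rightharpoonup> 'd"

type_synonym ('v, 's, 'd, 'p) pgraph = "('v, 's, 'd, 'p) graph \<times> 'v"

type_synonym 'p word = "('p \<times> 'p) list"

text \<open>\<open>walk G u w v\<close>: the word \<open>w\<close> leads from \<open>u\<close> to \<open>v\<close>, where the letter \<open>(a, b)\<close>
  means ``leave by port \<open>a\<close>, arrive by port \<open>b\<close>''.\<close>

fun walk :: "('v, 's, 'd, 'p) graph \<Rightarrow> 'v \<Rightarrow> 'p word \<Rightarrow> 'v \<Rightarrow> bool" where
  "walk G u [] v \<longleftrightarrow> u \<in> verts G \<and> v = u"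
| "walk G u ((a, b) # w) v \<longleftrightarrow> (\<exists>x. {(u, a), (x, b)} \<in> edges G \<and> walk G x w v)"

text \<open>Graphs are nonempty: each one can be given a pointer.\<close>

definition is_graph :: "('v, 's, 'd, 'p) graph \<Rightarrow> bool" where
  "is_graph G \<longleftrightarrow>
     verts G \<noteq> {} \<and> countable (verts G) \<and>
     (\<forall>e\<in>edges G. card e = 2 \<and> fst ` e \<subseteq> verts G) \<and>
     (\<forall>e\<in>edges G. \<forall>e'\<in>edges G. e \<inter> e' \<noteq> {} \<longrightarrow> e = e') \<and>
     dom (vlab G) \<subseteq> verts G \<and> dom (elab G) \<subseteq> edges G \<and>
     (\<forall>u\<in>verts G. \<forall>v\<in>verts G. \<exists>w. walk G u w v)"

definition graph_over :: "'s set \<Rightarrow> 'd set \<Rightarrow> 'p set \<Rightarrow> ('v, 's, 'd, 'p) graph \<Rightarrow> bool" where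
  "graph_over \<Sigma> \<Delta> \<pi> G \<longleftrightarrow>
     is_graph G \<and> (\<forall>e\<in>edges G. snd ` e \<subseteq> \<pi>) \<and> ran (vlab G) \<subseteq> \<Sigma> \<and> ran (elab G) \<subseteq> \<Delta>"

text \<open>Renaming of the vertices of an edge.\<close>

definition ren :: "('v \<Rightarrow> 'w) \<Rightarrow> ('v \<times> 'p) set \<Rightarrow> ('w \<times> 'p) set" where
  "ren f e = map_prod f id ` e"

definition is_iso :: "('v \<Rightarrow> 'w) \<Rightarrow> ('v, 's, 'd, 'p) graph \<Rightarrow> ('w, 's, 'd, 'p) graph \<Rightarrow> bool" where
  "is_iso f G H \<longleftrightarrow>
     bij_betw f (verts G) (verts H) \<and> edges H = ren f ` edges G \<and>
     (\<forall>v\<in>verts G. vlab H (f v) = vlab G v) \<and>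
     (\<forall>e\<in>edges G. elab H (ren f e) = elab G e)"

section \<open>Graphs modulo isomorphism\<close>

text \<open>Every countable graph has an isomorphic copy with vertices in \<open>nat\<close>, so an isomorphism
  class is represented by the set of all its members with vertices in \<open>nat\<close>.\<close>

type_synonym ('s, 'd, 'p) pgm = "(nat, 's, 'd, 'p) pgraph set"
type_synonym ('s, 'd, 'p) anon = "(nat, 's, 'd, 'p) graph set"

definition pgm_of :: "('v, 's, 'd, 'p) pgraph \<Rightarrow> ('s, 'd, 'p) pgm" where
  "pgm_of = (\<lambda>(G, p). {(H, q). is_graph H \<and> (\<exists>f. is_iso f G H \<and> q = f p)})"

definition anon_of :: "('v, 's, 'd, 'p) graph \<Rightarrow> ('s, 'd, 'p) anon" where
  "anon_of G = {H. is_graph H \<and> (\<exists>f. is_iso f G H)}"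

definition pgms :: "'s set \<Rightarrow> 'd set \<Rightarrow> 'p set \<Rightarrow> ('s, 'd, 'p) pgm set" where
  "pgms \<Sigma> \<Delta> \<pi> = {pgm_of (G, p) | (G :: (nat, 's, 'd, 'p) graph) p. graph_over \<Sigma> \<Delta> \<pi> G \<and> p \<in> verts G}"

definition anons :: "'s set \<Rightarrow> 'd set \<Rightarrow> 'p set \<Rightarrow> ('s, 'd, 'p) anon set" where
  "anons \<Sigma> \<Delta> \<pi> = {anon_of G | G :: (nat, 's, 'd, 'p) graph. graph_over \<Sigma> \<Delta> \<pi> G}"

definition forget_pointer :: "('s, 'd, 'p) pgm \<Rightarrow> ('s, 'd, 'p) anon" where
  "forget_pointer X = fst ` X"

section \<open>Vertices as classes of paths\<close>

definition paths :: "('s, 'd, 'p) pgm \<Rightarrow> 'p word set" where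
  "paths X = {w. \<exists>(G, p)\<in>X. \<exists>v. walk G p w v}"

text \<open>The vertex designated by the path \<open>w\<close> is the set of all paths reaching the same vertex.\<close>

definition vertex :: "('s, 'd, 'p) pgm \<Rightarrow> 'p word \<Rightarrow> 'p word set" where
  "vertex X w = {w'. \<exists>(G, p)\<in>X. \<exists>v. walk G p w v \<and> walk G p w' v}"

definition V :: "('s, 'd, 'p) pgm \<Rightarrow> 'p word set set" where
  "V X = vertex X ` paths X"

text \<open>\<open>vcat X u v\<close> is \<open>u.v\<close>, for \<open>u\<close> a vertex of \<open>X\<close> and \<open>v\<close> a vertex of \<open>X\<^sub>u\<close>
  (or of a disk of \<open>X\<^sub>u\<close>).\<close>

definition vcat :: "('s, 'd, 'p) pgm \<Rightarrow> 'p word set \<Rightarrow> 'p word set \<Rightarrow> 'p word set" where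
  "vcat X u v = (\<Union>w\<in>u. \<Union>w'\<in>v. vertex X (w @ w'))"

definition repoint :: "('s, 'd, 'p) pgm \<Rightarrow> 'p word set \<Rightarrow> ('s, 'd, 'p) pgm" where
  "repoint X u = {(G, v) | G p v. (G, p) \<in> X \<and> (\<exists>w\<in>u. walk G p w v)}"

section \<open>Disks\<close>

definition ball :: "('v, 's, 'd, 'p) graph \<Rightarrow> 'v \<Rightarrow> nat \<Rightarrow> 'v set" where
  "ball G p n = {v. \<exists>w. length w \<le> n \<and> walk G p w v}"

definition edges_in :: "('v, 's, 'd, 'p) graph \<Rightarrow> 'v set \<Rightarrow> ('v \<times> 'p) set set" where
  "edges_in G B = {e \<in> edges G. fst ` e \<subseteq> B}"

definition graph_disk :: "nat \<Rightarrow> ('v, 's, 'd, 'p) graph \<Rightarrow> 'v \<Rightarrow> ('v, 's, 'd, 'p) graph" where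
  "graph_disk n G p =
     \<lparr>verts = ball G p (n + 1), edges = edges_in G (ball G p (n + 1)),
      vlab = vlab G |` ball G p n, elab = elab G |` edges_in G (ball G p n)\<rparr>"

definition disk :: "nat \<Rightarrow> ('s, 'd, 'p) pgm \<Rightarrow> ('s, 'd, 'p) pgm" where
  "disk n X = (\<Union>(G, p)\<in>X. pgm_of (graph_disk n G p, p))"

text \<open>A vertex of \<open>X\<^sup>n\<close> is a class of paths staying inside the disk, so it is not literally a
  vertex of \<open>X\<close>.  The vertex \<open>u\<close> of \<open>X\<close> is identified with the vertex \<open>in_disk n X u\<close> of \<open>X\<^sup>n\<close>,
  and \<open>u\<close> lies outside the disk iff \<open>in_disk n X u\<close> is empty.\<close>

definition in_disk :: "nat \<Rightarrow> ('s, 'd, 'p) pgm \<Rightarrow> 'p word set \<Rightarrow> 'p word set" where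
  "in_disk n X u = u \<inter> paths (disk n X)"

section \<open>Causal graph dynamics\<close>

type_synonym ('s, 'd, 'p) dyn = "('s, 'd, 'p) pgm \<Rightarrow> ('s, 'd, 'p) pgm"
type_synonym ('s, 'd, 'p) vmap = "('s, 'd, 'p) pgm \<Rightarrow> 'p word set \<Rightarrow> 'p word set"

definition dynamics :: "('s, 'd, 'p) pgm set \<Rightarrow> ('s, 'd, 'p) dyn \<Rightarrow> ('s, 'd, 'p) vmap \<Rightarrow> bool" where
  "dynamics S F R \<longleftrightarrow> F \<in> S \<rightarrow> S \<and> (\<forall>X\<in>S. R X \<in> V X \<rightarrow> V (F X))"

text \<open>The domain of \<open>R\<^sub>X\<^sup>m\<close>, and the graph of \<open>R\<^sub>X\<^sup>m\<close> expressed through vertices of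
  \<open>X\<^sup>n\<close> and of \<open>F(X)\<^sup>m\<close>, so that it can be compared between graphs having the same disks.\<close>

definition dom_restr ::
  "('s, 'd, 'p) dyn \<Rightarrow> ('s, 'd, 'p) vmap \<Rightarrow> nat \<Rightarrow> ('s, 'd, 'p) pgm \<Rightarrow> 'p word set set" where
  "dom_restr F R m X = {u \<in> V X. in_disk m (F X) (R X u) \<noteq> {}}"

definition restr ::
  "('s, 'd, 'p) dyn \<Rightarrow> ('s, 'd, 'p) vmap \<Rightarrow> nat \<Rightarrow> nat \<Rightarrow> ('s, 'd, 'p) pgm
     \<Rightarrow> ('p word set \<times> 'p word set) set" where
  "restr F R m n X = (\<lambda>u. (in_disk n X u, in_disk m (F X) (R X u))) ` dom_restr F R m X"

text \<open>Continuity compares \<open>X\<close> with \<open>X\<^sup>n\<close>.  If \<open>X\<^sup>n\<close> is not in the domain \<open>S\<close> of the dynamics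
  (disks of graphs with invisible matter are finite, hence truncate it), then \<open>F(X\<^sup>n)\<close>
  is meaningless and \<open>X\<close> is compared with all elements of \<open>S\<close> having the same disk, as in
  continuity for the metric induced on \<open>S\<close>.\<close>

definition disk_reps :: "('s, 'd, 'p) pgm set \<Rightarrow> nat \<Rightarrow> ('s, 'd, 'p) pgm \<Rightarrow> ('s, 'd, 'p) pgm set" where
  "disk_reps S n X = (if disk n X \<in> S then {disk n X} else {Z \<in> S. disk n Z = disk n X})"

definition continuous_dyn :: "('s, 'd, 'p) pgm set \<Rightarrow> ('s, 'd, 'p) dyn \<Rightarrow> ('s, 'd, 'p) vmap \<Rightarrow> bool" where
  "continuous_dyn S F R \<longleftrightarrow>
     (\<forall>X\<in>S. \<forall>m. \<exists>n.
        (\<forall>u\<in>dom_restr F R m X. in_disk n X u \<noteq> {}) \<and>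
        (\<forall>Z\<in>disk_reps S n X.
           disk m (F X) = disk m (F Z) \<and> restr F R m n X = restr F R m n Z))"

definition shift_invariant :: "('s, 'd, 'p) pgm set \<Rightarrow> ('s, 'd, 'p) dyn \<Rightarrow> ('s, 'd, 'p) vmap \<Rightarrow> bool" where
  "shift_invariant S F R \<longleftrightarrow>
     (\<forall>X\<in>S. \<forall>u\<in>V X.
        F (repoint X u) = repoint (F X) (R X u) \<and>
        (\<forall>v\<in>V (repoint X u). R X (vcat X u v) = vcat (F X) (R X u) (R (repoint X u) v)))"

definition bounded_dyn :: "('s, 'd, 'p) pgm set \<Rightarrow> ('s, 'd, 'p) dyn \<Rightarrow> ('s, 'd, 'p) vmap \<Rightarrow> bool" where
  "bounded_dyn S F R \<longleftrightarrow>
     (\<exists>b. \<forall>X\<in>S. \<forall>w'\<in>V (F X).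
        \<exists>u'\<in>R X ` V X. \<exists>v'\<in>V (disk b (repoint (F X) u')). w' = vcat (F X) u' v')"

definition CGD :: "('s, 'd, 'p) pgm set \<Rightarrow> ('s, 'd, 'p) dyn \<Rightarrow> ('s, 'd, 'p) vmap \<Rightarrow> bool" where
  "CGD S F R \<longleftrightarrow>
     dynamics S F R \<and> continuous_dyn S F R \<and> shift_invariant S F R \<and> bounded_dyn S F R"

definition ACGD ::
  "'s set \<Rightarrow> 'd set \<Rightarrow> 'p set \<Rightarrow> (('s, 'd, 'p) anon \<Rightarrow> ('s, 'd, 'p) anon) \<Rightarrow> bool" where
  "ACGD \<Sigma> \<Delta> \<pi> Ft \<longleftrightarrow>
     Ft \<in> anons \<Sigma> \<Delta> \<pi> \<rightarrow> anons \<Sigma> \<Delta> \<pi> \<and>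
     (\<exists>F R. CGD (pgms \<Sigma> \<Delta> \<pi>) F R \<and>
        (\<forall>X\<in>pgms \<Sigma> \<Delta> \<pi>. Ft (forget_pointer X) = forget_pointer (F X)))"

definition invertible_ACGD ::
  "'s set \<Rightarrow> 'd set \<Rightarrow> 'p set \<Rightarrow> (('s, 'd, 'p) anon \<Rightarrow> ('s, 'd, 'p) anon) \<Rightarrow> bool" where
  "invertible_ACGD \<Sigma> \<Delta> \<pi> Ft \<longleftrightarrow>
     ACGD \<Sigma> \<Delta> \<pi> Ft \<and> bij_betw Ft (anons \<Sigma> \<Delta> \<pi>) (anons \<Sigma> \<Delta> \<pi>)"

section \<open>Invisible matter\<close>

text \<open>\<open>Inv v s\<close> is the node at address \<open>s\<close> in the tree attached to \<open>v\<close>; the child of \<open>s\<close> in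
  direction \<open>c\<close> (left for \<open>False\<close>, right for \<open>True\<close>) has address \<open>c # s\<close>.  The parameters
  \<open>mm\<close> and \<open>pm, pl, pr\<close> are the label \<open>m\<close> and the ports \<open>m, l, r\<close>.\<close>

datatype 'v xv = Vis 'v | Inv 'v "bool list"

definition tree_edges :: "'p \<Rightarrow> 'p \<Rightarrow> 'p \<Rightarrow> 'v \<Rightarrow> ('v xv \<times> 'p) set set" where
  "tree_edges pm pl pr v =
     {{(Vis v, pm), (Inv v [], pm)}} \<union>
     {{(Inv v s, pl), (Inv v (False # s), pm)} | s. True} \<union>
     {{(Inv v s, pr), (Inv v (True # s), pm)} | s. True}"

definition attach :: "'s \<Rightarrow> 'p \<Rightarrow> 'p \<Rightarrow> 'p \<Rightarrow> ('v, 's, 'd, 'p) graph \<Rightarrow> ('v xv, 's, 'd, 'p) graph" where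
  "attach mm pm pl pr G =
     \<lparr>verts = Vis ` verts G \<union> {Inv v s | v s. v \<in> verts G},
      edges = ren Vis ` edges G \<union> (\<Union>v\<in>verts G. tree_edges pm pl pr v),
      vlab = (\<lambda>x. case x of Vis v \<Rightarrow> vlab G v | Inv v s \<Rightarrow> if v \<in> verts G then Some mm else None),
      elab = (\<lambda>e. if e \<in> ren Vis ` edges G then elab G (map_prod Vis id -` e) else None)\<rparr>"

definition embed :: "'s \<Rightarrow> 'p \<Rightarrow> 'p \<Rightarrow> 'p \<Rightarrow> ('s, 'd, 'p) pgm \<Rightarrow> ('s, 'd, 'p) pgm" where
  "embed mm pm pl pr X = (\<Union>(G, p)\<in>X. pgm_of (attach mm pm pl pr G, Vis p))"

text \<open>The set \<open>\<Y>\<close>.\<close>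

definition impgms ::
  "'s set \<Rightarrow> 'd set \<Rightarrow> 'p set \<Rightarrow> 's \<Rightarrow> 'p \<Rightarrow> 'p \<Rightarrow> 'p \<Rightarrow> ('s, 'd, 'p) pgm set" where
  "impgms \<Sigma> \<Delta> \<pi> mm pm pl pr =
     {repoint (embed mm pm pl pr X) u | X u. X \<in> pgms \<Sigma> \<Delta> \<pi> \<and> u \<in> V (embed mm pm pl pr X)}"

text \<open>The graph \<open>X\<^sub>\<bullet>\<^sub>s\<close>.\<close>

definition im_at ::
  "'s \<Rightarrow> 'p \<Rightarrow> 'p \<Rightarrow> 'p \<Rightarrow> ('s, 'd, 'p) pgm \<Rightarrow> 'p word \<Rightarrow> ('s, 'd, 'p) pgm" where
  "im_at mm pm pl pr X s =
     repoint (embed mm pm pl pr X) (vertex (embed mm pm pl pr X) ((pm, pm) # s))"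

definition im_quiescent ::
  "'s set \<Rightarrow> 'd set \<Rightarrow> 'p set \<Rightarrow> 's \<Rightarrow> 'p \<Rightarrow> 'p \<Rightarrow> 'p
     \<Rightarrow> ('s, 'd, 'p) dyn \<Rightarrow> ('s, 'd, 'p) vmap \<Rightarrow> bool" where
  "im_quiescent \<Sigma> \<Delta> \<pi> mm pm pl pr F R \<longleftrightarrow>
     (\<exists>b. \<forall>X\<in>pgms \<Sigma> \<Delta> \<pi>. \<forall>s\<in>lists {(pl, pm), (pr, pm)}. \<forall>t\<in>lists {(pl, pm), (pr, pm)}.
        b \<le> length s \<longrightarrow>
        R (im_at mm pm pl pr X s) (vertex (im_at mm pm pl pr X s) t)
          = vertex (F (im_at mm pm pl pr X s)) t)"

definition vertex_preserving ::
  "('s, 'd, 'p) pgm set \<Rightarrow> ('s, 'd, 'p) dyn \<Rightarrow> ('s, 'd, 'p) vmap \<Rightarrow> bool" where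
  "vertex_preserving S F R \<longleftrightarrow> (\<forall>Y\<in>S. bij_betw (R Y) (V Y) (V (F Y)))"

definition IMCGD ::
  "'s set \<Rightarrow> 'd set \<Rightarrow> 'p set \<Rightarrow> 's \<Rightarrow> 'p \<Rightarrow> 'p \<Rightarrow> 'p
     \<Rightarrow> ('s, 'd, 'p) dyn \<Rightarrow> ('s, 'd, 'p) vmap \<Rightarrow> bool" where
  "IMCGD \<Sigma> \<Delta> \<pi> mm pm pl pr F R \<longleftrightarrow>
     CGD (impgms \<Sigma> \<Delta> \<pi> mm pm pl pr) F R \<and>
     vertex_preserving (impgms \<Sigma> \<Delta> \<pi> mm pm pl pr) F R \<and>
     im_quiescent \<Sigma> \<Delta> \<pi> mm pm pl pr F R"

definition invertible_IMCGD ::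
  "'s set \<Rightarrow> 'd set \<Rightarrow> 'p set \<Rightarrow> 's \<Rightarrow> 'p \<Rightarrow> 'p \<Rightarrow> 'p
     \<Rightarrow> ('s, 'd, 'p) dyn \<Rightarrow> ('s, 'd, 'p) vmap \<Rightarrow> bool" where
  "invertible_IMCGD \<Sigma> \<Delta> \<pi> mm pm pl pr F R \<longleftrightarrow>
     IMCGD \<Sigma> \<Delta> \<pi> mm pm pl pr F R \<and>
     bij_betw F (impgms \<Sigma> \<Delta> \<pi> mm pm pl pr) (impgms \<Sigma> \<Delta> \<pi> mm pm pl pr)"

text \<open>Since \<open>mm \<notin> \<Sigma>\<close>, the invisible vertices of a graph in \<open>\<Y>\<close> are those labelled \<open>mm\<close>.\<close>

definition visible_part :: "'s \<Rightarrow> ('v, 's, 'd, 'p) graph \<Rightarrow> ('v, 's, 'd, 'p) graph" where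
  "visible_part mm G =
     (let B = {v \<in> verts G. vlab G v \<noteq> Some mm} in
      \<lparr>verts = B, edges = edges_in G B, vlab = vlab G |` B, elab = elab G |` edges_in G B\<rparr>)"

definition alpha :: "'s \<Rightarrow> ('s, 'd, 'p) pgm \<Rightarrow> ('s, 'd, 'p) anon" where
  "alpha mm Y = (\<Union>G\<in>forget_pointer Y. anon_of (visible_part mm G))"

end

(* Shift invariance lets the dynamics act on all pointers of a graph at once: F turns the graph G with
   its trees attached into some H with its trees attached, and R becomes a bijection rho between their
   vertices.  Composing rho with the map that sends an invisible vertex to the visible vertex carrying
   its tree gives a shift-invariant dynamics on graphs without invisible matter.  The space of these
   graphs is compact, so continuity bounds uniformly the depth of the images of visible vertices and
   the distance between the images of a visible vertex and of the vertices at bounded depth in its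
   tree; hence the new dynamics is continuous.  It is bounded because, by quiescence, a visible vertex
   of H can only come from a bounded depth.  As rho is bijective, two graphs with isomorphic images
   have pointed versions, with invisible matter, whose images under F coincide: injectivity is
   inherited from F. *)

theory Submission
  imports Defs
begin

section \<open>Walks and isomorphisms\<close>

text \<open>Compactness is used only for pointers on visible vertices: \<open>\<Y>\<close> itself is
  not compact, since pointers sinking ever deeper into a tree can converge to a graph without
  visible vertices. The bounds must be uniform because continuity at \<open>X\<close> compares
  \<open>X\<close> with its truncation \<open>disk n X\<close>, another graph, whose images might
  sink to another depth. The two notions of continuity also differ: a disk is again a member of the
  space of visible graphs, but never of \<open>\<Y>\<close>, whose members are infinite. Attaching
  trees to the disk gives a member of \<open>\<Y>\<close> with the same disk, which connects the
  two. Passing to the visible carrier is compatible with disks because trees are recognised locally: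
  the label \<open>mm\<close> marks invisible vertices, and the ports leading up a tree fix the
  address. The image graph and \<open>rho\<close> are chosen separately for each concrete graph, so
  their independence of the representative, up to isomorphism, needs a proof. Finally, sending
  images to their carriers can merge vertices and miss others, so boundedness needs an argument of
  its own.\<close>

lemma edge_doubleton:
  assumes "is_graph G" "e \<in> edges G"
  obtains u a v b where "e = {(u, a), (v, b)}" "(u, a) \<noteq> (v, b)" "u \<in> verts G" "v \<in> verts G"
proof -
  have c: "card e = 2" "fst ` e \<subseteq> verts G" using assms by (auto simp: is_graph_def)
  then obtain x y where "e = {x, y}" "x \<noteq> y" by (auto simp: card_2_iff)
  with c show thesis using that by (cases x; cases y) auto
qed

lemma edge_verts:
  assumes "is_graph G" "{(u, a), (v, b)} \<in> edges G"
  shows "u \<in> verts G" "v \<in> verts G"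
  using assms by (auto simp: is_graph_def)

lemma edge_unique:
  assumes "is_graph G" "{(u, a), (v, b)} \<in> edges G" "{(u, a), (v', b')} \<in> edges G"
  shows "v = v' \<and> b = b'"
proof -
  have "{(u, a), (v, b)} = {(u, a), (v', b')}"
  proof -
    have "\<forall>e\<in>edges G. \<forall>e'\<in>edges G. e \<inter> e' \<noteq> {} \<longrightarrow> e = e'"
      using assms(1) by (simp add: is_graph_def)
    then have "{(u, a), (v, b)} \<inter> {(u, a), (v', b')} \<noteq> {} \<longrightarrow> {(u, a), (v, b)} = {(u, a), (v', b')}"
      using assms(2,3) by metis
    then show ?thesis by simp
  qed
  moreover have "card {(u, a), (v, b)} = 2" "card {(u, a), (v', b')} = 2"
    using assms by (simp_all add: is_graph_def)
  ultimately show ?thesis by (auto simp: doubleton_eq_iff)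
qed

text \<open>As edges are doubletons, disjointness of distinct edges reduces to determinism: a port
  of a vertex leads to a single far end. The graphs built below are easier to check in this
  form.\<close>

lemma is_graphI:
  assumes "verts G \<noteq> {}" "countable (verts G)"
    and e: "\<And>e. e \<in> edges G \<Longrightarrow>
      \<exists>u a v b. e = {(u, a), (v, b)} \<and> (u, a) \<noteq> (v, b) \<and> u \<in> verts G \<and> v \<in> verts G"
    and u: "\<And>u a v b v' b'. {(u, a), (v, b)} \<in> edges G \<Longrightarrow> {(u, a), (v', b')} \<in> edges G
      \<Longrightarrow> v = v' \<and> b = b'"
    and "dom (vlab G) \<subseteq> verts G" "dom (elab G) \<subseteq> edges G"
    and "\<And>u v. u \<in> verts G \<Longrightarrow> v \<in> verts G \<Longrightarrow> \<exists>w. walk G u w v"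
  shows "is_graph G"
proof -
  have "card e = 2 \<and> fst ` e \<subseteq> verts G" if "e \<in> edges G" for e
  proof -
    obtain u a v b where "e = {(u, a), (v, b)}" "(u, a) \<noteq> (v, b)" "u \<in> verts G" "v \<in> verts G"
      using e[OF \<open>e \<in> edges G\<close>] by blast
    then show ?thesis by (simp add: card_insert_if)
  qed
  moreover have "e = e'" if ee: "e \<in> edges G" "e' \<in> edges G" "e \<inter> e' \<noteq> {}" for e e'
  proof -
    obtain x a where x: "(x, a) \<in> e" "(x, a) \<in> e'" using ee(3) by auto
    have "\<exists>y b. f = {(x, a), (y, b)}" if "f \<in> edges G" "(x, a) \<in> f" for f
      using e[OF that(1)] that(2) by (auto simp: insert_commute)
    then obtain y b z c where "e = {(x, a), (y, b)}" "e' = {(x, a), (z, c)}"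
      using ee x by meson
    with u[of x a y b z c] ee show ?thesis by simp
  qed
  ultimately show ?thesis
    unfolding is_graph_def using assms(1,2,5,6,7) by (intro conjI ballI impI) simp_all
qed

lemma walk_verts:
  assumes "is_graph G" "walk G u w v"
  shows "u \<in> verts G" "v \<in> verts G"
proof -
  show "u \<in> verts G"
    using assms(2) edge_verts(1)[OF assms(1)] by (cases w) auto
  show "v \<in> verts G"
    using assms(2) by (induction G u w v rule: walk.induct) auto
qed

lemma walk_det: "is_graph G \<Longrightarrow> walk G u w v \<Longrightarrow> walk G u w v' \<Longrightarrow> v = v'"
proof (induction w arbitrary: u)
  case (Cons l w)
  obtain a b where l: "l = (a, b)" by (cases l)
  with Cons.prems obtain x x' where "{(u, a), (x, b)} \<in> edges G" "walk G x w v"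
    "{(u, a), (x', b)} \<in> edges G" "walk G x' w v'" by auto
  moreover from this have "x = x'" using edge_unique[OF Cons.prems(1)] by metis
  ultimately show ?case using Cons.IH[OF Cons.prems(1)] by blast
qed auto

lemma walk_append:
  "is_graph G \<Longrightarrow> walk G u (w @ w') v \<longleftrightarrow> (\<exists>x. walk G u w x \<and> walk G x w' v)"
proof (induction w arbitrary: u)
  case Nil
  then show ?case using walk_verts(1) by fastforce
next
  case (Cons l w)
  then show ?case by (cases l) auto
qed

lemma walk_single:
  "is_graph G \<Longrightarrow> walk G u [(a, b)] v \<longleftrightarrow> {(u, a), (v, b)} \<in> edges G"
  using edge_verts(2) by fastforce

lemma walk_snoc:
  "is_graph G \<Longrightarrow>
    walk G u (w @ [(a, b)]) v \<longleftrightarrow> (\<exists>x. walk G u w x \<and> {(x, a), (v, b)} \<in> edges G)"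
  by (simp add: walk_append walk_single del: walk.simps)

lemma walk_appendI: "walk G u w x \<Longrightarrow> walk G x w' v \<Longrightarrow> walk G u (w @ w') v"
  by (induction G u w x rule: walk.induct) auto

definition rev_word :: "'p word \<Rightarrow> 'p word" where
  "rev_word w = rev (map prod.swap w)"

lemma length_rev_word [simp]: "length (rev_word w) = length w"
  by (simp add: rev_word_def)

lemma walk_rev: "is_graph G \<Longrightarrow> walk G u w v \<Longrightarrow> walk G v (rev_word w) u"
proof (induction w arbitrary: u)
  case (Cons l w)
  obtain a b where l: "l = (a, b)" by (cases l)
  with Cons.prems obtain x where x: "{(u, a), (x, b)} \<in> edges G" "walk G x w v" by auto
  have "walk G v (rev_word w @ [(b, a)]) u"
    using Cons.IH[OF Cons.prems(1) x(2)] x(1) Cons.prems(1)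
    by (auto simp: walk_snoc insert_commute)
  then show ?case by (simp add: l rev_word_def)
qed (auto simp: rev_word_def)

lemma walk_connected:
  "is_graph G \<Longrightarrow> u \<in> verts G \<Longrightarrow> v \<in> verts G \<Longrightarrow> \<exists>w. walk G u w v"
  by (auto simp: is_graph_def)

text \<open>The concrete counterpart of an element of \<open>V\<close>: once a representative and
  its pointer \<open>u\<close> are fixed, \<open>vertex\<close>, \<open>repoint\<close> and
  \<open>vcat\<close> are all computed through it.\<close>

definition cls :: "('v, 's, 'd, 'p) graph \<Rightarrow> 'v \<Rightarrow> 'v \<Rightarrow> 'p word set" where
  "cls G u v = {w. walk G u w v}"

lemma cls_ne: "is_graph G \<Longrightarrow> u \<in> verts G \<Longrightarrow> v \<in> verts G \<Longrightarrow> cls G u v \<noteq> {}"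
  using walk_connected by (fastforce simp: cls_def)

lemma cls_meet: "is_graph G \<Longrightarrow> w \<in> cls G u v \<Longrightarrow> w \<in> cls G u v' \<Longrightarrow> v = v'"
  using walk_det by (fastforce simp: cls_def)

lemma cls_inj:
  "is_graph G \<Longrightarrow> u \<in> verts G \<Longrightarrow> v \<in> verts G \<Longrightarrow> cls G u v = cls G u v' \<Longrightarrow> v = v'"
  using cls_ne cls_meet by (metis ex_in_conv)

section \<open>Renamings and isomorphisms\<close>

lemma ren_pair [simp]: "ren f {(u, a), (v, b)} = {(f u, a), (f v, b)}"
  by (simp add: ren_def)

lemma ren_ren: "ren g (ren f e) = ren (g \<circ> f) e"
  by (force simp: ren_def)

lemma ren_cong: "(\<And>x. x \<in> fst ` e \<Longrightarrow> f x = g x) \<Longrightarrow> ren f e = ren g e"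
  unfolding ren_def by (rule image_cong) force+

lemma ren_id [simp]: "ren id e = e" "ren (\<lambda>x. x) e = e"
  by (auto simp: ren_def map_prod_def)

lemma fst_ren: "fst ` ren f e = f ` fst ` e"
  by (force simp: ren_def)

lemma snd_ren [simp]: "snd ` ren f e = snd ` e"
  by (force simp: ren_def)

lemma ren_inj:
  assumes "inj_on f B" "fst ` e \<subseteq> B" "fst ` e' \<subseteq> B" "ren f e = ren f e'"
  shows "e = e'"
proof -
  have "ren (inv_into B f) (ren f d) = d" if "fst ` d \<subseteq> B" for d :: "('a \<times> 'c) set"
  proof -
    have "ren (inv_into B f \<circ> f) d = ren id d"
      by (rule ren_cong) (use that assms(1) in auto)
    then show ?thesis by (simp add: ren_ren)
  qed
  then show ?thesis using assms by metis
qed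

lemma is_iso_inj: "is_iso f G H \<Longrightarrow> inj_on f (verts G)"
  by (auto simp: is_iso_def bij_betw_def)

lemma is_iso_verts: "is_iso f G H \<Longrightarrow> verts H = f ` verts G"
  by (auto simp: is_iso_def bij_betw_def)

lemma is_iso_id: "is_iso id G G"
  by (auto simp: is_iso_def)

lemma edges_fst: "is_graph G \<Longrightarrow> e \<in> edges G \<Longrightarrow> fst ` e \<subseteq> verts G"
  by (auto simp: is_graph_def)

lemma is_iso_edge:
  assumes "is_graph G" "is_iso f G H" "u \<in> verts G" "v \<in> verts G"
  shows "{(f u, a), (f v, b)} \<in> edges H \<longleftrightarrow> {(u, a), (v, b)} \<in> edges G"
proof
  assume "{(f u, a), (f v, b)} \<in> edges H"
  then obtain e where e: "e \<in> edges G" "ren f e = ren f {(u, a), (v, b)}"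
    using assms(2) by (auto simp: is_iso_def)
  have "e = {(u, a), (v, b)}"
    by (rule ren_inj[OF is_iso_inj[OF assms(2)] _ _ e(2)])
      (use assms edges_fst[OF assms(1) e(1)] in auto)
  with e show "{(u, a), (v, b)} \<in> edges G" by simp
next
  assume "{(u, a), (v, b)} \<in> edges G"
  then have "ren f {(u, a), (v, b)} \<in> edges H"
    using assms(2) unfolding is_iso_def by blast
  then show "{(f u, a), (f v, b)} \<in> edges H" by simp
qed

lemma is_iso_trans:
  assumes "is_iso f G H" "is_iso g H K"
  shows "is_iso (g \<circ> f) G K"
proof -
  have H: "verts H = f ` verts G" "edges H = ren f ` edges G"
    using assms(1) by (auto simp: is_iso_def bij_betw_def)
  have "bij_betw (g \<circ> f) (verts G) (verts K)"
    using assms bij_betw_trans by (auto simp: is_iso_def)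
  then show ?thesis using assms
    by (simp add: is_iso_def H image_image ren_ren[symmetric])
qed

lemma is_iso_inv:
  assumes "is_graph G" "is_iso f G H"
  shows "is_iso (inv_into (verts G) f) H G"
proof -
  let ?g = "inv_into (verts G) f"
  have b: "bij_betw ?g (verts H) (verts G)"
    using assms(2) by (auto simp: is_iso_def bij_betw_inv_into)
  have r: "ren ?g (ren f e) = e" if "e \<in> edges G" for e
  proof -
    have "ren (?g \<circ> f) e = ren id e"
      by (rule ren_cong) (use is_iso_inj[OF assms(2)] edges_fst[OF assms(1) that] in auto)
    then show ?thesis by (simp add: ren_ren)
  qed
  have H: "edges H = ren f ` edges G" using assms(2) by (simp add: is_iso_def)
  have "edges G = ren ?g ` edges H"
    unfolding H image_image by (simp add: r)
  moreover have "\<forall>v\<in>verts H. vlab G (?g v) = vlab H v"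
    unfolding is_iso_verts[OF assms(2)] using assms(2) is_iso_inj[OF assms(2)]
    by (simp add: is_iso_def)
  moreover have "\<forall>e\<in>edges H. elab G (ren ?g e) = elab H e"
    unfolding H using assms(2) by (auto simp: r is_iso_def)
  ultimately show ?thesis using b by (auto simp: is_iso_def)
qed

lemma is_iso_walk:
  assumes "is_graph G" "is_iso f G H" "walk G u w v"
  shows "walk H (f u) w (f v)"
  using assms(3)
proof (induction w arbitrary: u)
  case Nil
  then show ?case using is_iso_verts[OF assms(2)] by auto
next
  case (Cons l w)
  obtain a b where l: "l = (a, b)" by (cases l)
  with Cons.prems obtain x where x: "{(u, a), (x, b)} \<in> edges G" "walk G x w v" by auto
  then have "{(f u, a), (f x, b)} \<in> edges H"
    using is_iso_edge[OF assms(1,2)] edge_verts[OF assms(1) x(1)] by blast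
  then show ?case using Cons.IH[OF x(2)] by (auto simp: l)
qed

lemma is_iso_walk_iff:
  assumes "is_graph G" "is_graph H" "is_iso f G H" "u \<in> verts G" "v \<in> verts G"
  shows "walk H (f u) w (f v) \<longleftrightarrow> walk G u w v"
proof
  assume "walk H (f u) w (f v)"
  from is_iso_walk[OF assms(2) is_iso_inv[OF assms(1,3)] this]
  show "walk G u w v" using is_iso_inj[OF assms(3)] assms(4,5) by simp
qed (use is_iso_walk[OF assms(1,3)] in auto)

lemma is_iso_cls:
  assumes "is_graph G" "is_graph H" "is_iso f G H" "u \<in> verts G" "v \<in> verts G"
  shows "cls H (f u) (f v) = cls G u v"
  using is_iso_walk_iff[OF assms] by (simp add: cls_def)

text \<open>Shift invariance and continuity speak of path classes; this turns their equality back
  into a correspondence of concrete vertices.\<close>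

lemma is_iso_clsD:
  assumes "is_graph G" "is_graph H" "is_iso f G H" "u \<in> verts G" "v \<in> verts G"
    "cls H (f u) v' = cls G u v"
  shows "v' = f v"
  using assms is_iso_cls[OF assms(1-5)] cls_ne[OF assms(1,4,5)] cls_meet[OF assms(2)]
  by (metis ex_in_conv)

lemma is_iso_cong:
  assumes "is_graph G" "is_iso f G H" "\<And>v. v \<in> verts G \<Longrightarrow> g v = f v"
  shows "is_iso g G H"
proof -
  have r: "ren g e = ren f e" if "e \<in> edges G" for e
    by (rule ren_cong) (use edges_fst[OF assms(1) that] assms(3) in auto)
  then have "ren g ` edges G = ren f ` edges G" by simp
  then show ?thesis
    using assms(2,3) r bij_betw_cong[of "verts G" g f "verts H"] by (simp add: is_iso_def)
qed

text \<open>\<open>is_iso\<close> constrains the labels of \<open>H\<close> only on images of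
  vertices and edges of \<open>G\<close>, so stray labels elsewhere are excluded by the last two
  hypotheses.\<close>

lemma is_iso_is_graph:
  assumes "is_graph G" "is_iso f G H" "dom (vlab H) \<subseteq> verts H" "dom (elab H) \<subseteq> edges H"
  shows "is_graph H"
proof (rule is_graphI)
  have V: "verts H = f ` verts G" and E: "edges H = ren f ` edges G"
    using is_iso_verts[OF assms(2)] assms(2) by (simp_all add: is_iso_def)
  note f = is_iso_inj[OF assms(2)]
  show "verts H \<noteq> {}" "countable (verts H)"
    using assms(1) by (auto simp: V is_graph_def)
  show "\<exists>w. walk H u w v" if uv: "u \<in> verts H" "v \<in> verts H" for u v
  proof -
    obtain u' v' where "u' \<in> verts G" "v' \<in> verts G" "u = f u'" "v = f v'"
      using uv by (auto simp: V)
    then show ?thesis using is_iso_walk[OF assms(1,2)] walk_connected[OF assms(1)] by blast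
  qed
  show "\<exists>u a v b. e = {(u, a), (v, b)} \<and> (u, a) \<noteq> (v, b) \<and> u \<in> verts H \<and> v \<in> verts H"
    if e: "e \<in> edges H" for e
  proof -
    obtain e' where e': "e' \<in> edges G" "e = ren f e'" using e by (auto simp: E)
    from edge_doubleton[OF assms(1) e'(1)] obtain u a v b where
      "e' = {(u, a), (v, b)}" "(u, a) \<noteq> (v, b)" "u \<in> verts G" "v \<in> verts G" .
    moreover from this have "(f u, a) \<noteq> (f v, b)" using inj_onD[OF f, of u v] by auto
    ultimately have "e = {(f u, a), (f v, b)} \<and> (f u, a) \<noteq> (f v, b) \<and> f u \<in> verts H \<and> f v \<in> verts H"
      using e'(2) by (simp add: V)
    then show ?thesis by blast
  qed
  show "v = v' \<and> b = b'"
    if e: "{(u, a), (v, b)} \<in> edges H" "{(u, a), (v', b')} \<in> edges H" for u a v b v' b'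
  proof -
    \<comment> \<open>\<open>H\<close> is not yet known to be a graph, so the ends of its edges are
      located by pulling the edges back to \<open>G\<close>.\<close>
    have "fst ` d \<subseteq> verts H" if d: "d \<in> edges H" for d
    proof -
      obtain d' where "d' \<in> edges G" "d = ren f d'" using d by (auto simp: E)
      then show ?thesis
        using edges_fst[OF assms(1)] by (auto simp: V fst_ren simp del: image_subset_iff)
    qed
    from this[OF e(1)] this[OF e(2)] have "{u, v, v'} \<subseteq> verts H" by auto
    then obtain u0 v0 v1 where "u0 \<in> verts G" "v0 \<in> verts G" "v1 \<in> verts G"
      "u = f u0" "v = f v0" "v' = f v1" by (auto simp: V)
    then show ?thesis using e is_iso_edge[OF assms(1,2)] edge_unique[OF assms(1)] by metis
  qed
qed (use assms(3,4) in auto)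

lemma countable_copy:
  assumes "is_graph G"
  obtains f and H :: "(nat, 's, 'd, 'p) graph" where "is_graph H" "is_iso f G H"
proof -
  obtain f :: "'a \<Rightarrow> nat" where f: "inj_on f (verts G)"
    using assms by (auto simp: is_graph_def countable_def)
  let ?g = "inv_into (verts G) f"
  \<comment> \<open>Labels are \<open>None\<close> off the image, as \<open>is_iso_is_graph\<close>
    requires.\<close>
  define H :: "(nat, 's, 'd, 'p) graph" where
    "H = \<lparr>verts = f ` verts G, edges = ren f ` edges G,
      vlab = (\<lambda>x. if x \<in> f ` verts G then vlab G (?g x) else None),
      elab = (\<lambda>e. if e \<in> ren f ` edges G then elab G (ren ?g e) else None)\<rparr>"
  have r: "ren ?g (ren f e) = e" if "e \<in> edges G" for e
  proof -
    have "ren (?g \<circ> f) e = ren id e"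
      by (rule ren_cong) (use f edges_fst[OF assms that] in auto)
    then show ?thesis by (simp add: ren_ren)
  qed
  have iso: "is_iso f G H"
    using f by (auto simp: is_iso_def H_def bij_betw_def r)
  have "is_graph H"
    by (rule is_iso_is_graph[OF assms iso]) (auto simp: H_def split: if_splits)
  with iso show thesis by (rule that[rotated])
qed

section \<open>Graphs modulo isomorphism\<close>

lemma in_pgm_of: "(H, q) \<in> pgm_of (G, p) \<longleftrightarrow> is_graph H \<and> (\<exists>f. is_iso f G H \<and> q = f p)"
  by (simp add: pgm_of_def)

lemma pgm_of_rep:
  assumes "is_graph G"
  obtains H f where "(H, f p) \<in> pgm_of (G, p)" "is_graph H" "is_iso f G H"
proof -
  obtain f and H :: "(nat, 'b, 'c, 'd) graph" where "is_graph H" "is_iso f G H"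
    using countable_copy[OF assms] .
  then show thesis using that by (auto simp: in_pgm_of)
qed

lemma pgm_of_eqI:
  assumes "is_graph G" "is_graph H" "is_iso f G H" "p \<in> verts G"
  shows "pgm_of (G, p) = pgm_of (H, f p)"
proof -
  have 1: "x \<in> pgm_of (G, p)" if x: "x \<in> pgm_of (H, f p)" for x
  proof (cases x)
    case (Pair K r)
    with x obtain g where "is_graph K" "is_iso g H K" "r = g (f p)" by (auto simp: in_pgm_of)
    moreover have "is_iso (g \<circ> f) G K" using is_iso_trans[OF assms(3)] \<open>is_iso g H K\<close> .
    ultimately show ?thesis using Pair by (force simp: in_pgm_of)
  qed
  have 2: "x \<in> pgm_of (H, f p)" if x: "x \<in> pgm_of (G, p)" for x
  proof (cases x)
    case (Pair K r)
    let ?h = "inv_into (verts G) f"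
    from x Pair obtain g where g: "is_graph K" "is_iso g G K" "r = g p" by (auto simp: in_pgm_of)
    then have "r = (g \<circ> ?h) (f p)" using is_iso_inj[OF assms(3)] assms(4) by simp
    then show ?thesis using is_iso_trans[OF is_iso_inv[OF assms(1,3)] g(2)] g(1) Pair
      by (auto simp: in_pgm_of simp del: comp_apply)
  qed
  from 1 2 show ?thesis by blast
qed

text \<open>Classes are nonempty by \<open>countable_copy\<close>, so a common member on
  \<open>nat\<close> links the two graphs even when their vertex types differ.\<close>

lemma pgm_of_eqD:
  assumes "is_graph G" "is_graph H" "pgm_of (G, p) = pgm_of (H, q)" "p \<in> verts G" "q \<in> verts H"
  obtains f where "is_iso f G H" "f p = q"
proof -
  obtain K f where f: "(K, f p) \<in> pgm_of (G, p)" "is_graph K" "is_iso f G K"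
    using pgm_of_rep[OF assms(1)] .
  then obtain g where g: "is_iso g H K" "f p = g q"
    using assms(3) by (auto simp: in_pgm_of)
  let ?g = "inv_into (verts H) g"
  have "is_iso (?g \<circ> f) G H"
    by (rule is_iso_trans[OF f(3) is_iso_inv[OF assms(2) g(1)]])
  moreover have "(?g \<circ> f) p = q" using g(2) is_iso_inj[OF g(1)] assms(5) by simp
  ultimately show thesis using that by blast
qed

lemma forget_pgm_of: "forget_pointer (pgm_of (G, p)) = anon_of G"
  by (force simp: forget_pointer_def anon_of_def pgm_of_def)

lemma anon_of_eqI:
  assumes "is_graph G" "is_graph H" "is_iso f G H"
  shows "anon_of G = anon_of H"
proof -
  obtain p where "p \<in> verts G" using assms(1) by (auto simp: is_graph_def)
  from pgm_of_eqI[OF assms this] show ?thesis by (metis forget_pgm_of)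
qed

lemma anon_of_eqD:
  fixes G :: "('v, 's, 'd, 'p) graph" and H :: "('w, 's, 'd, 'p) graph"
  assumes "is_graph G" "is_graph H" "anon_of G = anon_of H"
  obtains f where "is_iso f G H"
proof -
  obtain p where "p \<in> verts G" using assms(1) by (auto simp: is_graph_def)
  obtain K :: "(nat, 's, 'd, 'p) graph" and f where f: "is_graph K" "is_iso f G K"
    using countable_copy[OF assms(1)] .
  then have "K \<in> anon_of H" using assms(3) by (auto simp: anon_of_def)
  then obtain g where g: "is_iso g H K" by (auto simp: anon_of_def)
  show thesis using that is_iso_trans[OF f(2) is_iso_inv[OF assms(2) g]] .
qed

text \<open>Words do not mention vertices, so a single representative, over any vertex type, decides
  what \<open>paths\<close> and \<open>vertex\<close> quantify over the whole class.\<close>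

lemma ex_walk_pgm_of:
  assumes "is_graph G" "p \<in> verts G"
  shows "(\<exists>(H, q)\<in>pgm_of (G, p). \<exists>v. walk H q w v \<and> walk H q w' v) \<longleftrightarrow>
    (\<exists>v. walk G p w v \<and> walk G p w' v)"
proof
  assume "\<exists>(H, q)\<in>pgm_of (G, p). \<exists>v. walk H q w v \<and> walk H q w' v"
  then obtain H q v where "(H, q) \<in> pgm_of (G, p)" "walk H q w v" "walk H q w' v"
    by blast
  then obtain f where H: "is_graph H" "is_iso f G H" "walk H (f p) w v" "walk H (f p) w' v"
    by (auto simp: in_pgm_of)
  then obtain v0 where "v0 \<in> verts G" "v = f v0"
    using walk_verts(2)[OF H(1,3)] is_iso_verts[OF H(2)] by auto
  then show "\<exists>v. walk G p w v \<and> walk G p w' v"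
    using H is_iso_walk_iff[OF assms(1) H(1,2) assms(2)] by auto
next
  assume "\<exists>v. walk G p w v \<and> walk G p w' v"
  moreover obtain H f where "(H, f p) \<in> pgm_of (G, p)" "is_iso f G H"
    using pgm_of_rep[OF assms(1)] .
  ultimately show "\<exists>(H, q)\<in>pgm_of (G, p). \<exists>v. walk H q w v \<and> walk H q w' v"
    using is_iso_walk[OF assms(1)] by blast
qed

lemma paths_pgm_of:
  "is_graph G \<Longrightarrow> p \<in> verts G \<Longrightarrow> paths (pgm_of (G, p)) = {w. \<exists>v. walk G p w v}"
  using ex_walk_pgm_of[of G p w w for w] by (simp add: paths_def)

lemma vertex_pgm_of:
  assumes "is_graph G" "p \<in> verts G" "walk G p w v"
  shows "vertex (pgm_of (G, p)) w = cls G p v"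
  unfolding vertex_def ex_walk_pgm_of[OF assms(1,2)]
  using assms(3) walk_det[OF assms(1)] by (auto simp: cls_def)

lemma V_pgm_of:
  assumes "is_graph G" "p \<in> verts G"
  shows "V (pgm_of (G, p)) = cls G p ` verts G"
proof -
  have "cls G p v \<in> V (pgm_of (G, p))" if "v \<in> verts G" for v
    using walk_connected[OF assms that] vertex_pgm_of[OF assms]
    by (auto simp: V_def paths_pgm_of assms)
  moreover have "x \<in> cls G p ` verts G" if "x \<in> V (pgm_of (G, p))" for x
    using that walk_verts[OF assms(1)] vertex_pgm_of[OF assms]
    by (auto simp: V_def paths_pgm_of assms)
  ultimately show ?thesis by blast
qed

lemma repoint_pgm_of:
  assumes "is_graph G" "p \<in> verts G" "v \<in> verts G"
  shows "repoint (pgm_of (G, p)) (cls G p v) = pgm_of (G, v)"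
proof -
  have 1: "(\<exists>w\<in>cls G p v. walk H (f p) w x) \<longleftrightarrow> x = f v"
    if H: "is_graph H" "is_iso f G H" for H :: "(nat, 'b, 'c, 'd) graph" and f x
  proof -
    obtain w where "walk G p w v" using walk_connected[OF assms] by auto
    then show ?thesis using walk_det[OF H(1)] is_iso_walk[OF assms(1) H(2)]
      by (auto simp: cls_def)
  qed
  have "(H, x) \<in> repoint (pgm_of (G, p)) (cls G p v) \<longleftrightarrow> (H, x) \<in> pgm_of (G, v)" for H x
    unfolding in_pgm_of repoint_def using 1 by (auto simp: in_pgm_of simp del: Bex_def) blast+
  then show ?thesis by auto
qed

text \<open>Any nonempty part \<open>c\<close> of the class is allowed because a vertex of a disk is
  a smaller class of paths; the boundedness condition concatenates with such vertices.\<close>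

lemma vcat_pgm_of:
  assumes "is_graph G" "p \<in> verts G" "u \<in> verts G" "v \<in> verts G"
    and c: "c \<subseteq> cls G u v" "c \<noteq> {}"
  shows "vcat (pgm_of (G, p)) (cls G p u) c = cls G p v"
proof -
  have "vertex (pgm_of (G, p)) (w @ w') = cls G p v" if "w \<in> cls G p u" "w' \<in> c" for w w'
    by (rule vertex_pgm_of[OF assms(1,2)])
      (use that c in \<open>auto simp: walk_append assms(1) cls_def\<close>)
  then show ?thesis
    unfolding vcat_def using cls_ne[OF assms(1-3)] c(2) by auto
qed

lemma graph_over_iso:
  assumes "graph_over \<Sigma> \<Delta> \<pi> G" "is_graph H" "is_iso f G H"
  shows "graph_over \<Sigma> \<Delta> \<pi> H"
proof -
  have d: "dom (vlab H) \<subseteq> verts H" "dom (elab H) \<subseteq> edges H"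
    using assms(2) by (auto simp: is_graph_def)
  have e: "edges H = ren f ` edges G" "verts H = f ` verts G"
    using assms(3) is_iso_verts[OF assms(3)] by (simp_all add: is_iso_def)
  have "ran (vlab H) \<subseteq> \<Sigma>"
  proof
    fix s assume "s \<in> ran (vlab H)"
    then obtain x where "vlab H x = Some s" by (auto simp: ran_def)
    moreover from this have "x \<in> f ` verts G" using d(1) e(2) by blast
    ultimately obtain v where "v \<in> verts G" "vlab H (f v) = Some s" by blast
    then have "vlab G v = Some s" using assms(3) by (auto simp: is_iso_def)
    then show "s \<in> \<Sigma>" using assms(1) by (auto simp: graph_over_def ran_def)
  qed
  moreover have "ran (elab H) \<subseteq> \<Delta>"
  proof
    fix s assume "s \<in> ran (elab H)"
    then obtain x where "elab H x = Some s" by (auto simp: ran_def)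
    moreover from this have "x \<in> ren f ` edges G" using d(2) e(1) by blast
    ultimately obtain v where "v \<in> edges G" "elab H (ren f v) = Some s" by blast
    then have "elab G v = Some s" using assms(3) by (auto simp: is_iso_def)
    then show "s \<in> \<Delta>" using assms(1) by (auto simp: graph_over_def ran_def)
  qed
  ultimately show ?thesis using assms(1,2) by (auto simp: graph_over_def e simp del: image_subset_iff)
qed

lemma graph_over_graph: "graph_over \<Sigma> \<Delta> \<pi> G \<Longrightarrow> is_graph G"
  by (simp add: graph_over_def)

lemma pgm_of_in_pgms:
  fixes G :: "('v, 's, 'd, 'p) graph"
  assumes "graph_over \<Sigma> \<Delta> \<pi> G" "p \<in> verts G"
  shows "pgm_of (G, p) \<in> pgms \<Sigma> \<Delta> \<pi>"
proof -
  have G: "is_graph G" using assms(1) by (rule graph_over_graph)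
  obtain H :: "(nat, 's, 'd, 'p) graph" and f where H: "is_graph H" "is_iso f G H"
    using countable_copy[OF G] .
  have "graph_over \<Sigma> \<Delta> \<pi> H" "f p \<in> verts H"
    using graph_over_iso[OF assms(1) H] is_iso_verts[OF H(2)] assms(2) by auto
  then show ?thesis unfolding pgm_of_eqI[OF G H assms(2)] pgms_def by blast
qed

lemma anon_of_in_anons:
  fixes G :: "('v, 's, 'd, 'p) graph"
  assumes "graph_over \<Sigma> \<Delta> \<pi> G"
  shows "anon_of G \<in> anons \<Sigma> \<Delta> \<pi>"
proof -
  have G: "is_graph G" using assms(1) by (rule graph_over_graph)
  obtain H :: "(nat, 's, 'd, 'p) graph" and f where H: "is_graph H" "is_iso f G H"
    using countable_copy[OF G] .
  then show ?thesis
    unfolding anon_of_eqI[OF G H] anons_def using graph_over_iso[OF assms H] by blast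
qed

section \<open>Subgraphs and disks\<close>

text \<open>The common shape of \<open>graph_disk\<close> and \<open>visible_part\<close>, so that
  transport along isomorphisms is proved once for both.\<close>

definition subgr ::
  "('v, 's, 'd, 'p) graph \<Rightarrow> 'v set \<Rightarrow> 'v set \<Rightarrow> ('v, 's, 'd, 'p) graph" where
  "subgr G B L =
     \<lparr>verts = B, edges = edges_in G B, vlab = vlab G |` L, elab = elab G |` edges_in G L\<rparr>"

lemma subgr_simps [simp]:
  "verts (subgr G B L) = B" "edges (subgr G B L) = edges_in G B"
  "vlab (subgr G B L) = vlab G |` L" "elab (subgr G B L) = elab G |` edges_in G L"
  by (simp_all add: subgr_def)

lemma graph_disk_subgr: "graph_disk n G p = subgr G (ball G p (n + 1)) (ball G p n)"
  by (simp add: graph_disk_def subgr_def)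

lemma visible_part_subgr:
  "visible_part mm G = subgr G {v \<in> verts G. vlab G v \<noteq> Some mm} {v \<in> verts G. vlab G v \<noteq> Some mm}"
  by (simp add: visible_part_def subgr_def Let_def)

lemma edges_in_subgr: "C \<subseteq> B \<Longrightarrow> edges_in (subgr G B L) C = edges_in G C"
  by (auto simp: edges_in_def)

lemma edges_in_mono: "C \<subseteq> B \<Longrightarrow> edges_in G C \<subseteq> edges_in G B"
  by (auto simp: edges_in_def)

lemma edges_in_pair:
  "{(u, a), (v, b)} \<in> edges_in G B \<longleftrightarrow> {(u, a), (v, b)} \<in> edges G \<and> u \<in> B \<and> v \<in> B"
  by (auto simp: edges_in_def)

lemma subgr_subgr:
  assumes "C \<subseteq> B" "K \<subseteq> L" "K \<subseteq> C"
  shows "subgr (subgr G B L) C K = subgr G C K"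
proof -
  have "L \<inter> K = K" using assms by auto
  moreover have "edges_in G L \<inter> edges_in G K = edges_in G K"
    using edges_in_mono[OF assms(2)] by blast
  moreover have "edges_in (subgr G B L) K = edges_in G K"
    by (rule edges_in_subgr) (use assms in auto)
  ultimately show ?thesis
    unfolding subgr_def[of "subgr G B L"] subgr_def[of G C]
    by (simp add: edges_in_subgr[OF assms(1)])
qed

lemma is_iso_subgr:
  assumes G: "\<And>e. e \<in> edges G \<Longrightarrow> fst ` e \<subseteq> verts G" and iso: "is_iso f G H"
    and C: "C \<subseteq> verts G" and K: "K \<subseteq> C"
  shows "is_iso f (subgr G C K) (subgr H (f ` C) (f ` K))"
proof -
  have inj: "inj_on f (verts G)" using is_iso_inj[OF iso] .
  have im: "f ` A \<subseteq> f ` B \<longleftrightarrow> A \<subseteq> B" if "A \<subseteq> verts G" "B \<subseteq> verts G" for A B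
  proof
    show "A \<subseteq> B" if "f ` A \<subseteq> f ` B"
    proof
      fix x assume "x \<in> A"
      then have "f x \<in> f ` B" "x \<in> verts G" using that \<open>A \<subseteq> verts G\<close> by auto
      then show "x \<in> B" using inj_on_image_mem_iff[OF inj _ \<open>B \<subseteq> verts G\<close>] by blast
    qed
  qed auto
  have mem: "f x \<in> f ` B \<longleftrightarrow> x \<in> B" if "x \<in> verts G" "B \<subseteq> verts G" for x B
    using that inj by (simp add: inj_on_image_mem_iff)
  have e: "edges_in H (f ` B) = ren f ` edges_in G B" if B: "B \<subseteq> verts G" for B
  proof -
    have "edges H = ren f ` edges G" using iso by (simp add: is_iso_def)
    then have "edges_in H (f ` B) = {ren f e | e. e \<in> edges G \<and> f ` fst ` e \<subseteq> f ` B}"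
      unfolding edges_in_def by (auto simp: fst_ren[symmetric])
    also have "\<dots> = ren f ` edges_in G B"
    proof -
      have "e \<in> edges G \<and> f ` fst ` e \<subseteq> f ` B \<longleftrightarrow> e \<in> edges_in G B" for e
        using im[OF G B, of e] by (auto simp: edges_in_def simp del: image_subset_iff)
      then show ?thesis by blast
    qed
    finally show ?thesis .
  qed
  have K': "K \<subseteq> verts G" using C K by auto
  have ee: "ren f d \<in> ren f ` edges_in G K \<longleftrightarrow> d \<in> edges_in G K" if "d \<in> edges G" for d
  proof
    assume "ren f d \<in> ren f ` edges_in G K"
    then obtain x where "x \<in> edges_in G K" "ren f d = ren f x" by blast
    moreover from this have "x \<in> edges G" by (simp add: edges_in_def)
    ultimately show "d \<in> edges_in G K" using ren_inj[OF inj G G, of d x] that by simp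
  qed simp
  show ?thesis
    unfolding is_iso_def
  proof (intro conjI ballI)
    show "bij_betw f (verts (subgr G C K)) (verts (subgr H (f ` C) (f ` K)))"
      using inj_on_subset[OF inj C] by (simp add: bij_betw_def)
    show "edges (subgr H (f ` C) (f ` K)) = ren f ` edges (subgr G C K)"
      by (simp add: e[OF C])
    show "vlab (subgr H (f ` C) (f ` K)) (f v) = vlab (subgr G C K) v"
      if "v \<in> verts (subgr G C K)" for v
      using that C iso mem[OF _ K'] by (auto simp: restrict_map_def is_iso_def)
    show "elab (subgr H (f ` C) (f ` K)) (ren f d) = elab (subgr G C K) d"
      if "d \<in> edges (subgr G C K)" for d
    proof -
      have "d \<in> edges G" using that by (auto simp: edges_in_def)
      then show ?thesis using iso by (auto simp: restrict_map_def e[OF K'] ee is_iso_def)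
    qed
  qed
qed

lemma restrict_map_superset: "dom m \<subseteq> A \<Longrightarrow> m |` A = m"
  by (auto simp: restrict_map_def fun_eq_iff domIff) (metis domIff subsetD)

lemma subgr_verts: "is_graph G \<Longrightarrow> subgr G (verts G) (verts G) = G"
proof -
  assume G: "is_graph G"
  have "edges_in G (verts G) = edges G" using edges_fst[OF G] by (auto simp: edges_in_def)
  moreover have "vlab G |` verts G = vlab G" "elab G |` edges G = elab G"
    using G by (simp_all add: is_graph_def restrict_map_superset)
  ultimately show ?thesis by (simp add: subgr_def)
qed

section \<open>Walks, balls and disks\<close>

lemma walk_mono:
  "walk G u w v \<Longrightarrow> verts G \<subseteq> verts H \<Longrightarrow> edges G \<subseteq> edges H \<Longrightarrow> walk H u w v"
  by (induction G u w v rule: walk.induct) auto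

lemma walk_ports:
  "is_graph G \<Longrightarrow> (\<And>e. e \<in> edges G \<Longrightarrow> snd ` e \<subseteq> P) \<Longrightarrow> walk G u w v \<Longrightarrow> w \<in> lists (P \<times> P)"
proof (induction w arbitrary: u)
  case (Cons l w)
  obtain a b where l: "l = (a, b)" by (cases l)
  with Cons.prems obtain x where x: "{(u, a), (x, b)} \<in> edges G" "walk G x w v" by auto
  then show ?case using Cons.IH[OF Cons.prems(1,2) x(2)] Cons.prems(2)[OF x(1)] l by auto
qed simp

text \<open>By determinism a word has at most one end, and only finitely many words of length at
  most \<open>n\<close> use the ports in \<open>P\<close>.\<close>

lemma finite_ball:
  assumes "is_graph G" "finite P" "\<And>e. e \<in> edges G \<Longrightarrow> snd ` e \<subseteq> P"
  shows "finite (ball G u n)"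
proof (rule finite_subset)
  show "finite ((\<lambda>w. THE v. walk G u w v) ` {w. set w \<subseteq> P \<times> P \<and> length w \<le> n})"
    using assms(2) by (intro finite_imageI finite_lists_length_le) simp
  show "ball G u n \<subseteq> (\<lambda>w. THE v. walk G u w v) ` {w. set w \<subseteq> P \<times> P \<and> length w \<le> n}"
  proof
    fix v assume "v \<in> ball G u n"
    then obtain w where w: "length w \<le> n" "walk G u w v" by (auto simp: ball_def)
    moreover have "(THE v. walk G u w v) = v" using w(2) walk_det[OF assms(1)] by blast
    moreover have "set w \<subseteq> P \<times> P" using walk_ports[OF assms(1,3) w(2)] by auto
    ultimately show "v \<in> (\<lambda>w. THE v. walk G u w v) ` {w. set w \<subseteq> P \<times> P \<and> length w \<le> n}"
      by (intro image_eqI[of _ _ w]) auto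
  qed
qed

lemma ball_mono: "m \<le> n \<Longrightarrow> ball G p m \<subseteq> ball G p n"
  by (auto simp: ball_def) (meson order_trans)

lemma ball_verts: "is_graph G \<Longrightarrow> ball G p n \<subseteq> verts G"
  using walk_verts(2) by (auto simp: ball_def)

lemma ball_self: "p \<in> verts G \<Longrightarrow> p \<in> ball G p n"
  by (auto simp: ball_def intro: exI[of _ "[]"])

lemma ball_step:
  assumes "is_graph G" "u \<in> ball G p k" "walk G u w v"
  shows "v \<in> ball G p (k + length w)"
proof -
  obtain w' where "length w' \<le> k" "walk G p w' u" using assms(2) by (auto simp: ball_def)
  then show ?thesis using assms(1,3)
    by (auto simp: ball_def walk_append intro!: exI[of _ "w' @ w"])
qed

lemma ball_trans:
  assumes "is_graph G" "u \<in> ball G p k" "v \<in> ball G u l"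
  shows "v \<in> ball G p (k + l)"
proof -
  obtain w where "length w \<le> l" "walk G u w v" using assms(3) by (auto simp: ball_def)
  then show ?thesis using ball_step[OF assms(1,2)] ball_mono[of "k + length w" "k + l"] by fastforce
qed

lemma ball_sym: "is_graph G \<Longrightarrow> u \<in> ball G v k \<Longrightarrow> v \<in> ball G u k"
  using walk_rev by (fastforce simp: ball_def intro: exI[of _ "rev_word w" for w])

lemma is_iso_ball:
  assumes "is_graph G" "is_graph H" "is_iso f G H" "p \<in> verts G"
  shows "ball H (f p) n = f ` ball G p n"
proof -
  have "x \<in> f ` ball G p n" if x: "x \<in> ball H (f p) n" for x
  proof -
    obtain v where "v \<in> verts G" "x = f v"
      using x ball_verts[OF assms(2)] is_iso_verts[OF assms(3)] by blast
    then show ?thesis using x is_iso_walk_iff[OF assms] by (auto simp: ball_def)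
  qed
  moreover have "f ` ball G p n \<subseteq> ball H (f p) n"
    using is_iso_walk[OF assms(1,3)] by (auto simp: ball_def)
  ultimately show ?thesis by blast
qed

lemma is_iso_graph_disk:
  assumes "is_graph G" "is_graph H" "is_iso f G H" "p \<in> verts G"
  shows "is_iso f (graph_disk n G p) (graph_disk n H (f p))"
  unfolding graph_disk_subgr is_iso_ball[OF assms]
  by (rule is_iso_subgr[OF edges_fst[OF assms(1)] assms(3) ball_verts[OF assms(1)] ball_mono]) simp_all

lemma walk_subgrD: "B \<subseteq> verts G \<Longrightarrow> walk (subgr G B L) u w v \<Longrightarrow> walk G u w v"
  by (induction "subgr G B L" u w v rule: walk.induct) (auto simp: edges_in_def)

lemma walk_graph_diskD: "is_graph G \<Longrightarrow> walk (graph_disk n G p) u w v \<Longrightarrow> walk G u w v"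
  unfolding graph_disk_subgr using walk_subgrD[OF ball_verts] .

text \<open>The walk stays within distance \<open>k + length w\<close> of \<open>p\<close>, and the
  disk of radius \<open>n\<close> has its vertices up to distance \<open>n + 1\<close>.\<close>

lemma walk_graph_diskI:
  assumes "is_graph G" "u \<in> ball G p k" "walk G u w v" "k + length w \<le> n + 1"
  shows "walk (graph_disk n G p) u w v"
  using assms(2-)
proof (induction w arbitrary: u k)
  case Nil
  then show ?case using ball_mono[of k "n + 1" G p] by (auto simp: graph_disk_subgr)
next
  case (Cons l w)
  obtain a b where l: "l = (a, b)" by (cases l)
  with Cons.prems obtain x where x: "{(u, a), (x, b)} \<in> edges G" "walk G x w v" by auto
  have xk: "x \<in> ball G p (k + 1)"
    using ball_step[OF assms(1) Cons.prems(1), of "[(a, b)]" x] x(1) walk_single[OF assms(1)]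
    by auto
  then have "walk (graph_disk n G p) x w v" using Cons.IH[OF xk x(2)] Cons.prems by simp
  moreover have "x \<in> ball G p (n + 1)" "u \<in> ball G p (n + 1)"
    using xk Cons.prems ball_mono[of "k + 1" "n + 1" G p] ball_mono[of k "n + 1" G p] by auto
  ultimately show ?case using x(1) by (auto simp: l graph_disk_subgr edges_in_pair)
qed

lemma verts_graph_disk [simp]: "verts (graph_disk n G p) = ball G p (n + 1)"
  by (simp add: graph_disk_subgr)

lemma is_graph_disk:
  assumes "is_graph G" "p \<in> verts G"
  shows "is_graph (graph_disk n G p)"
proof (rule is_graphI)
  let ?D = "graph_disk n G p"
  show "verts ?D \<noteq> {}" using ball_self[OF assms(2)] by auto
  show "countable (verts ?D)"
    using countable_subset[OF ball_verts[OF assms(1)]] assms(1)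
    by (simp add: is_graph_def graph_disk_subgr)
  show "dom (vlab ?D) \<subseteq> verts ?D"
    using ball_mono[of n "n + 1" G p] by (auto simp: graph_disk_subgr)
  show "dom (elab ?D) \<subseteq> edges ?D"
    using edges_in_mono[OF ball_mono[of n "n + 1" G p]] by (auto simp: graph_disk_subgr)
  show "\<exists>u a v b. e = {(u, a), (v, b)} \<and> (u, a) \<noteq> (v, b) \<and> u \<in> verts ?D \<and> v \<in> verts ?D"
    if e: "e \<in> edges ?D" for e
  proof -
    have "e \<in> edges G" using e by (auto simp: graph_disk_subgr edges_in_def)
    from edge_doubleton[OF assms(1) this] obtain u a v b
      where "e = {(u, a), (v, b)}" "(u, a) \<noteq> (v, b)" .
    then show ?thesis using e by (auto simp: graph_disk_subgr edges_in_pair)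
  qed
  show "v = v' \<and> b = b'"
    if "{(u, a), (v, b)} \<in> edges ?D" "{(u, a), (v', b')} \<in> edges ?D" for u a v b v' b'
    using edge_unique[OF assms(1)] that by (auto simp: graph_disk_subgr edges_in_pair)
  show "\<exists>w. walk ?D u w v" if uv: "u \<in> verts ?D" "v \<in> verts ?D" for u v
  proof -
    obtain w w' where w: "length w \<le> n + 1" "walk G p w u" "length w' \<le> n + 1" "walk G p w' v"
      using uv by (auto simp: ball_def)
    \<comment> \<open>Connectivity goes through the centre. Prefixes of \<open>w\<close> also have
      length at most \<open>n + 1\<close>, so their ends stay in the disk; hence the induction
      removes the last letter.\<close>
    have "walk ?D u (rev_word w) p"
      using w(1,2)
    proof (induction w arbitrary: u rule: rev_induct)
      case Nil
      then show ?case using ball_self[OF assms(2)] by (simp add: rev_word_def)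
    next
      case (snoc l w)
      obtain a b where l: "l = (a, b)" by (cases l)
      with snoc.prems obtain x where x: "walk G p w x" "{(x, a), (u, b)} \<in> edges G"
        by (auto simp: walk_snoc assms(1))
      have "walk ?D x (rev_word w) p" using snoc.IH snoc.prems(1) x(1) by simp
      moreover have "x \<in> ball G p (n + 1)" "u \<in> ball G p (n + 1)"
        using snoc.prems x(1) exI[of "\<lambda>w. length w \<le> n + 1 \<and> walk G p w x" w]
          exI[of "\<lambda>w. length w \<le> n + 1 \<and> walk G p w u" "w @ [l]"]
        by (simp_all add: ball_def)
      ultimately have "walk ?D u ((b, a) # rev_word w) p"
        using x(2) by (auto simp: graph_disk_subgr edges_in_pair insert_commute)
      then show ?case by (simp add: l rev_word_def)
    qed
    moreover have "walk ?D p w' v"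
      using walk_graph_diskI[OF assms(1) ball_self[OF assms(2)] w(4), of 0 n] w(3) by simp
    ultimately have "walk ?D u (rev_word w @ w') v" by (rule walk_appendI)
    then show ?thesis ..
  qed
qed

lemma disk_pgm_of:
  assumes "is_graph G" "p \<in> verts G"
  shows "disk n (pgm_of (G, p)) = pgm_of (graph_disk n G p, p)"
proof -
  have "pgm_of (graph_disk n H (f p), f p) = pgm_of (graph_disk n G p, p)"
    if H: "is_graph H" "is_iso f G H" for H :: "(nat, 'b, 'c, 'd) graph" and f
  proof -
    have "f p \<in> verts H" using is_iso_verts[OF H(2)] assms(2) by simp
    then show ?thesis
      using pgm_of_eqI[OF is_graph_disk[OF assms] is_graph_disk[OF H(1)]
          is_iso_graph_disk[OF assms(1) H assms(2)]] ball_self[OF assms(2)]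
      by simp
  qed
  moreover obtain H f where "(H, f p) \<in> pgm_of (G, p)" using pgm_of_rep[OF assms(1)] .
  ultimately have "pgm_of (graph_disk n (fst y) (snd y), snd y) = pgm_of (graph_disk n G p, p)"
    "pgm_of (G, p) \<noteq> {}" if "y \<in> pgm_of (G, p)" for y
    using that by (cases y; auto simp: in_pgm_of)+
  then show ?thesis
    unfolding disk_def using \<open>(H, f p) \<in> pgm_of (G, p)\<close> by (auto simp: case_prod_beta)
qed

lemma cls_graph_disk_ne:
  assumes "is_graph G" "p \<in> verts G"
  shows "cls (graph_disk n G p) p v \<noteq> {} \<longleftrightarrow> v \<in> ball G p (n + 1)"
proof
  assume "v \<in> ball G p (n + 1)"
  then show "cls (graph_disk n G p) p v \<noteq> {}"
    using cls_ne[OF is_graph_disk[OF assms], of p n v] ball_self[OF assms(2)] by simp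
next
  assume "cls (graph_disk n G p) p v \<noteq> {}"
  then show "v \<in> ball G p (n + 1)"
    using walk_verts(2)[OF is_graph_disk[OF assms]] by (fastforce simp: cls_def)
qed

text \<open>A word readable in the disk has the same end in \<open>G\<close> by determinism, so
  intersecting with the paths of the disk keeps exactly the words to \<open>v\<close> that stay
  inside.\<close>

lemma in_disk_pgm_of:
  assumes "is_graph G" "p \<in> verts G"
  shows "in_disk n (pgm_of (G, p)) (cls G p v) = cls (graph_disk n G p) p v"
proof -
  have "paths (disk n (pgm_of (G, p))) = {w. \<exists>v. walk (graph_disk n G p) p w v}"
    using paths_pgm_of[OF is_graph_disk[OF assms], of p n] ball_self[OF assms(2)]
    by (simp add: disk_pgm_of[OF assms])
  then show ?thesis
    unfolding in_disk_def cls_def using walk_graph_diskD[OF assms(1)] walk_det[OF assms(1)]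
    by auto metis
qed

lemma ball_graph_disk:
  assumes "is_graph G" "p \<in> verts G" "k \<le> n + 1"
  shows "ball (graph_disk n G p) p k = ball G p k"
proof -
  have "length w \<le> k \<Longrightarrow> walk (graph_disk n G p) p w v \<longleftrightarrow> walk G p w v" for w v
    using walk_graph_diskD[OF assms(1)] assms(3)
      walk_graph_diskI[OF assms(1) ball_self[OF assms(2), where n = 0], of w v n] by auto
  then show ?thesis by (auto simp: ball_def)
qed

lemma graph_disk_graph_disk:
  assumes "is_graph G" "p \<in> verts G" "m \<le> n"
  shows "graph_disk m (graph_disk n G p) p = graph_disk m G p"
proof -
  have "ball (graph_disk n G p) p (m + 1) = ball G p (m + 1)"
    "ball (graph_disk n G p) p m = ball G p m"
    by (rule ball_graph_disk[OF assms(1,2)]; use assms(3) in simp)+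
  then show ?thesis
    unfolding graph_disk_subgr[of m]
    unfolding graph_disk_subgr[of n]
    by (simp only:, intro subgr_subgr ball_mono) (use assms(3) in auto)
qed

lemma ran_restrict: "ran (m |` A) \<subseteq> ran m"
  by (auto simp: ran_def restrict_map_def split: if_splits)

lemma graph_over_disk:
  assumes "graph_over \<Sigma> \<Delta> \<pi> G" "p \<in> verts G"
  shows "graph_over \<Sigma> \<Delta> \<pi> (graph_disk n G p)"
proof -
  have "is_graph (graph_disk n G p)"
    using is_graph_disk[OF graph_over_graph[OF assms(1)] assms(2)] .
  moreover have "edges (graph_disk n G p) \<subseteq> edges G"
    by (auto simp: graph_disk_subgr edges_in_def)
  moreover have "ran (vlab (graph_disk n G p)) \<subseteq> \<Sigma>" "ran (elab (graph_disk n G p)) \<subseteq> \<Delta>"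
    using order_trans[OF ran_restrict] assms(1) by (auto simp: graph_disk_subgr graph_over_def)
  ultimately show ?thesis
    using assms(1) unfolding graph_over_def by blast
qed

lemma disk_eqD:
  assumes "is_graph G" "p \<in> verts G" "is_graph H" "q \<in> verts H"
    "disk n (pgm_of (G, p)) = disk n (pgm_of (H, q))"
  obtains f where "is_iso f (graph_disk n G p) (graph_disk n H q)" "f p = q"
proof (rule pgm_of_eqD[OF is_graph_disk[OF assms(1,2)] is_graph_disk[OF assms(3,4)]])
  show "pgm_of (graph_disk n G p, p) = pgm_of (graph_disk n H q, q)"
    using assms(5) unfolding disk_pgm_of[OF assms(1,2)] disk_pgm_of[OF assms(3,4)] .
  show "p \<in> verts (graph_disk n G p)" "q \<in> verts (graph_disk n H q)"
    using ball_self assms(2,4) by simp_all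
qed (rule that)

lemma disk_eqI:
  assumes "is_graph G" "p \<in> verts G" "is_graph H" "q \<in> verts H"
    and "is_iso f (graph_disk n G p) (graph_disk n H q)" "f p = q"
  shows "disk n (pgm_of (G, p)) = disk n (pgm_of (H, q))"
  using pgm_of_eqI[OF is_graph_disk[OF assms(1,2)] is_graph_disk[OF assms(3,4)] assms(5), of p]
    ball_self[OF assms(2)] assms(6)
  by (simp add: disk_pgm_of assms)

section \<open>Attaching invisible matter\<close>

fun root :: "'v xv \<Rightarrow> 'v" where
  "root (Vis v) = v"
| "root (Inv v s) = v"

fun depth :: "'v xv \<Rightarrow> nat" where
  "depth (Vis v) = 0"
| "depth (Inv v s) = Suc (length s)"

lemma depth_map_xv [simp]: "depth (map_xv f x) = depth x"
  by (cases x) auto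

lemma root_map_xv [simp]: "root (map_xv f x) = f (root x)"
  by (cases x) auto

locale invisible_matter =
  fixes \<Sigma> :: "'s set" and \<Delta> :: "'d set" and \<pi> :: "'p set"
    and mm :: 's and pm pl pr :: 'p
  assumes mm: "mm \<notin> \<Sigma>" and ports: "pm \<notin> \<pi>" "pl \<notin> \<pi>" "pr \<notin> \<pi>" "distinct [pm, pl, pr]"
begin

abbreviation att :: "('v, 's, 'd, 'p) graph \<Rightarrow> ('v xv, 's, 'd, 'p) graph" where
  "att \<equiv> attach mm pm pl pr"

abbreviation over :: "('v, 's, 'd, 'p) graph \<Rightarrow> bool" where
  "over \<equiv> graph_over \<Sigma> \<Delta> \<pi>"

definition dir :: "bool \<Rightarrow> 'p" where
  "dir c = (if c then pr else pl)"

lemma dir_bool: "dir False = pl" "dir True = pr"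
  by (simp_all add: dir_def)

lemma dir_simps [simp]:
  "dir c = dir d \<longleftrightarrow> c = d" "dir c \<noteq> pm" "pm \<noteq> dir c" "dir c \<notin> \<pi>"
  using ports by (auto simp: dir_def)

text \<open>Addresses list the turns from the node back to the root of its tree, hence the
  \<open>rev\<close> here and none in \<open>up\<close>.\<close>

definition down :: "bool list \<Rightarrow> 'p word" where
  "down s = (pm, pm) # map (\<lambda>c. (dir c, pm)) (rev s)"

definition up :: "bool list \<Rightarrow> 'p word" where
  "up s = map (\<lambda>c. (pm, dir c)) s @ [(pm, pm)]"

lemma length_up [simp]: "length (up s) = Suc (length s)"
  by (simp add: up_def)

lemma verts_att: "x \<in> verts (att G) \<longleftrightarrow> root x \<in> verts G"
  by (cases x) (auto simp: attach_def)

text \<open>The tree edges oriented from parent to child, with the link from a visible vertex to its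
  tree treated alike. As a relation it supports case analysis, unlike the unordered edges.\<close>

definition child_link :: "'v xv \<Rightarrow> 'p \<Rightarrow> 'v xv \<Rightarrow> 'p \<Rightarrow> bool" where
  "child_link x a y b \<longleftrightarrow> b = pm \<and>
    ((\<exists>v. x = Vis v \<and> a = pm \<and> y = Inv v []) \<or> (\<exists>v s c. x = Inv v s \<and> a = dir c \<and> y = Inv v (c # s)))"

lemma child_link_simps [simp]:
  "child_link (Vis u) a (Vis v) b \<longleftrightarrow> False"
  "child_link (Inv u s) a (Vis v) b \<longleftrightarrow> False"
  "child_link (Vis u) a (Inv v t) b \<longleftrightarrow> a = pm \<and> b = pm \<and> v = u \<and> t = []"
  "child_link (Inv u s) a (Inv v t) b \<longleftrightarrow> b = pm \<and> v = u \<and> (\<exists>c. a = dir c \<and> t = c # s)"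
  by (auto simp: child_link_def)

lemma child_link_root: "child_link x a y b \<Longrightarrow> root x = root y"
  by (auto simp: child_link_def)

lemma tree_edges_eq:
  "tree_edges pm pl pr v = {{(x, a), (y, b)} | x a y b. child_link x a y b \<and> root x = v}"
  (is "?B = ?A")
proof
  show "?A \<subseteq> ?B"
  proof
    fix e assume "e \<in> ?A"
    then obtain x a y b where e: "e = {(x, a), (y, b)}" "child_link x a y b" "root x = v"
      by blast
    then consider "x = Vis v" "a = pm" "b = pm" "y = Inv v []"
      | s where "x = Inv v s" "a = pl" "b = pm" "y = Inv v (False # s)"
      | s where "x = Inv v s" "a = pr" "b = pm" "y = Inv v (True # s)"
      unfolding child_link_def by (auto simp: dir_def split: if_splits)
    then show "e \<in> ?B" unfolding e(1) tree_edges_def by cases blast+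
  qed
  have A: "{(x, a), (y, b)} \<in> ?A" if "child_link x a y b" "root x = v" for x a y b
    using that by blast
  have link: "child_link (Inv v s) (dir c) (Inv v (c # s)) pm" for s c by simp
  show "?B \<subseteq> ?A"
    unfolding tree_edges_def
  proof (intro Un_least subsetI)
    fix e assume "e \<in> {{(Vis v, pm), (Inv v [], pm)}}"
    then show "e \<in> ?A" using A[of "Vis v" pm "Inv v []" pm] by simp
  next
    fix e assume "e \<in> {{(Inv v s, pl), (Inv v (False # s), pm)} | s. True}"
    then obtain s where "e = {(Inv v s, pl), (Inv v (False # s), pm)}" by blast
    then show "e \<in> ?A" using A[OF link[of s False]] by (simp add: dir_bool)
  next
    fix e assume "e \<in> {{(Inv v s, pr), (Inv v (True # s), pm)} | s. True}"
    then obtain s where "e = {(Inv v s, pr), (Inv v (True # s), pm)}" by blast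
    then show "e \<in> ?A" using A[OF link[of s True]] by (simp add: dir_bool)
  qed
qed

lemma edges_att: "edges (att G) = ren Vis ` edges G \<union>
    {{(x, a), (y, b)} | x a y b. child_link x a y b \<and> root x \<in> verts G}"
  by (auto simp: attach_def tree_edges_eq) blast

lemma over_ports:
  assumes "over G" "{(u, a), (v, b)} \<in> edges G"
  shows "a \<in> \<pi>" "b \<in> \<pi>"
  using assms by (auto simp: graph_over_def)

text \<open>Edges are unordered, so a tree edge may be read in either orientation of
  \<open>child_link\<close>; edges of \<open>G\<close> already allow both readings.\<close>

lemma att_adj:
  assumes "is_graph G"
  shows "{(x, a), (y, b)} \<in> edges (att G) \<longleftrightarrow>
    (\<exists>u v. x = Vis u \<and> y = Vis v \<and> {(u, a), (v, b)} \<in> edges G) \<or>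
    root x \<in> verts G \<and> child_link x a y b \<or> root y \<in> verts G \<and> child_link y b x a"
  (is "?L \<longleftrightarrow> ?R")
proof
  assume ?L
  then consider e where "e \<in> edges G" "{(x, a), (y, b)} = ren Vis e"
    | x' a' y' b' where "{(x, a), (y, b)} = {(x', a'), (y', b')}" "child_link x' a' y' b'"
      "root x' \<in> verts G"
    by (auto simp: edges_att)
  then show ?R
  proof cases
    case 1
    from edge_doubleton[OF assms 1(1)] obtain u a' v b' where "e = {(u, a'), (v, b')}" .
    with 1 show ?thesis by (auto simp: doubleton_eq_iff insert_commute)
  next
    case 2
    then show ?thesis by (auto simp: doubleton_eq_iff)
  qed
next
  assume ?R
  then consider u v where "x = Vis u" "y = Vis v" "{(u, a), (v, b)} \<in> edges G"
    | "root x \<in> verts G" "child_link x a y b" | "root y \<in> verts G" "child_link y b x a" by blast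
  then show ?L
  proof cases
    case 1
    then have "ren Vis {(u, a), (v, b)} \<in> edges (att G)" unfolding edges_att by blast
    with 1 show ?thesis by simp
  next
    case 2
    then show ?thesis unfolding edges_att by blast
  next
    case 3
    then show ?thesis unfolding edges_att insert_commute[of "(x, a)"] by blast
  qed
qed

lemma att_edge_doubleton:
  assumes "is_graph G" "e \<in> edges (att G)"
  obtains x a y b where "e = {(x, a), (y, b)}" "(x, a) \<noteq> (y, b)"
    "root x \<in> verts G" "root y \<in> verts G"
proof -
  from assms(2) consider e' where "e' \<in> edges G" "e = ren Vis e'"
    | x a y b where "e = {(x, a), (y, b)}" "child_link x a y b" "root x \<in> verts G"
    unfolding edges_att by blast
  then show thesis
  proof cases
    case 1
    from edge_doubleton[OF assms(1) 1(1)] obtain u a v b where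
      "e' = {(u, a), (v, b)}" "(u, a) \<noteq> (v, b)" "u \<in> verts G" "v \<in> verts G" .
    with 1 show thesis using that[of "Vis u" a "Vis v" b] by auto
  next
    case 2
    then show thesis using that[of x a y b] child_link_root[OF 2(2)]
      by (auto simp: child_link_def)
  qed
qed

lemma walk_att_VisI:
  assumes "is_graph G" "walk G u w v"
  shows "walk (att G) (Vis u) w (Vis v)"
  using assms(2)
proof (induction w arbitrary: u)
  case Nil
  then show ?case by (simp add: verts_att)
next
  case (Cons l w)
  obtain a b where l: "l = (a, b)" by (cases l)
  with Cons.prems obtain x where x: "{(u, a), (x, b)} \<in> edges G" "walk G x w v" by auto
  then have "{(Vis u, a), (Vis x, b)} \<in> edges (att G)" by (simp add: att_adj[OF assms(1)])
  then show ?case using Cons.IH[OF x(2)] by (auto simp: l)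
qed

lemma walk_up:
  assumes "is_graph G" "v \<in> verts G"
  shows "walk (att G) (Inv v s) (up s) (Vis v)"
proof (induction s)
  case Nil
  then show ?case using assms
    by (auto simp: up_def att_adj verts_att intro!: exI[of _ "Vis v"])
next
  case (Cons c s)
  have "{(Inv v (c # s), pm), (Inv v s, dir c)} \<in> edges (att G)"
    using assms by (auto simp: att_adj)
  with Cons show ?case by (auto simp: up_def)
qed

lemma walk_down:
  assumes "is_graph G" "v \<in> verts G"
  shows "walk (att G) (Vis v) (down s) (Inv v s)"
proof (induction s)
  case Nil
  then show ?case using assms
    by (auto simp: down_def att_adj verts_att intro!: exI[of _ "Inv v []"])
next
  case (Cons c s)
  have "{(Inv v s, dir c), (Inv v (c # s), pm)} \<in> edges (att G)"
    using assms by (auto simp: att_adj)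
  then have "walk (att G) (Inv v s) [(dir c, pm)] (Inv v (c # s))"
    using assms(2) by (auto simp: verts_att intro!: exI[of _ "Inv v (c # s)"])
  from walk_appendI[OF Cons this] show ?case by (simp add: down_def)
qed

lemma is_graph_att:
  assumes "over G"
  shows "is_graph (att G)"
proof (rule is_graphI)
  have G: "is_graph G" using assms by (rule graph_over_graph)
  show "verts (att G) \<noteq> {}" using G by (auto simp: attach_def is_graph_def)
  have "verts (att G) = Vis ` verts G \<union> (\<lambda>(v, s). Inv v s) ` (verts G \<times> UNIV)"
    by (auto simp: attach_def)
  then show "countable (verts (att G))" using G
    by (simp add: is_graph_def)
  show "\<exists>u a v b. e = {(u, a), (v, b)} \<and> (u, a) \<noteq> (v, b) \<and> u \<in> verts (att G) \<and> v \<in> verts (att G)"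
    if "e \<in> edges (att G)" for e
    using att_edge_doubleton[OF G that] by (simp add: verts_att) metis
  show "v = v' \<and> b = b'"
    if e: "{(u, a), (v, b)} \<in> edges (att G)" "{(u, a), (v', b')} \<in> edges (att G)" for u a v b v' b'
  proof -
    \<comment> \<open>Ports used in \<open>G\<close> lie in \<pi>, so port \<open>pm\<close> of a
      visible vertex is free for its tree.\<close>
    have q: "a \<noteq> pm" if "{(u, a), (v, b)} \<in> edges G" for u a v b
      using over_ports(1)[OF assms that] ports by auto
    show ?thesis
      using e q edge_unique[OF G] unfolding att_adj[OF G]
      by (cases u; cases v; cases v') auto
  qed
  show "dom (vlab (att G)) \<subseteq> verts (att G)"
    using G by (auto simp: verts_att) (auto simp: attach_def is_graph_def split: xv.splits if_splits)
  show "dom (elab (att G)) \<subseteq> edges (att G)"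
    by (auto simp: attach_def split: if_splits)
  \<comment> \<open>Connectivity: climb to the visible carrier, cross \<open>G\<close>, descend into
    the other tree.\<close>
  have to_root: "\<exists>w. walk (att G) x w (Vis (root x))" if "x \<in> verts (att G)" for x
    using that walk_up[OF G] by (cases x) (auto simp: verts_att intro: exI[of _ "[]"])
  have of_root: "\<exists>w. walk (att G) (Vis (root x)) w x" if "x \<in> verts (att G)" for x
    using that walk_down[OF G] by (cases x) (auto simp: verts_att intro: exI[of _ "[]"])
  show "\<exists>w. walk (att G) x w y" if xy: "x \<in> verts (att G)" "y \<in> verts (att G)" for x y
  proof -
    obtain w where "walk G (root x) w (root y)"
      using walk_connected[OF G] xy by (auto simp: verts_att)
    from walk_att_VisI[OF G this] show ?thesis
      using to_root[OF xy(1)] of_root[OF xy(2)] walk_appendI by metis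
  qed
qed

text \<open>Collapsing each tree onto its carrier turns a tree edge into a stationary step and keeps
  the edges of \<open>G\<close>, so walks never get longer.\<close>

lemma walk_att_project:
  assumes "is_graph G" "walk (att G) x w y"
  shows "\<exists>w'. length w' \<le> length w \<and> walk G (root x) w' (root y)"
  using assms(2)
proof (induction w arbitrary: x)
  case Nil
  then show ?case by (auto simp: verts_att)
next
  case (Cons l w)
  obtain a b where l: "l = (a, b)" by (cases l)
  with Cons.prems obtain z where z: "{(x, a), (z, b)} \<in> edges (att G)" "walk (att G) z w y" by auto
  then obtain w' where w': "length w' \<le> length w" "walk G (root z) w' (root y)"
    using Cons.IH by blast
  from z(1) consider "root x = root z" | u v where "x = Vis u" "z = Vis v" "{(u, a), (v, b)} \<in> edges G"
    unfolding att_adj[OF assms(1)] using child_link_root by metis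
  then show ?case
  proof cases
    case 1
    then show ?thesis using w' by (intro exI[of _ w']) auto
  next
    case 2
    then show ?thesis using w' by (intro exI[of _ "(a, b) # w'"]) (auto simp: l)
  qed
qed

lemma ball_att_project: "is_graph G \<Longrightarrow> y \<in> ball (att G) x k \<Longrightarrow> root y \<in> ball G (root x) k"
  unfolding ball_def using walk_att_project by (blast intro: order_trans)

lemma ball_att_Vis: "is_graph G \<Longrightarrow> v \<in> ball G u k \<Longrightarrow> Vis v \<in> ball (att G) (Vis u) k"
  using walk_att_VisI by (fastforce simp: ball_def)

lemma root_in_ball: "is_graph G \<Longrightarrow> x \<in> verts (att G) \<Longrightarrow> Vis (root x) \<in> ball (att G) x (depth x)"
  using walk_up[of G "root x"]
  by (cases x) (auto simp: verts_att ball_def intro: exI[of _ "[]"] exI[of _ "up s" for s])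

lemma vlab_att_inv: "x \<in> verts (att G) \<Longrightarrow> over G \<Longrightarrow> vlab (att G) x = Some mm \<longleftrightarrow> depth x \<noteq> 0"
  using mm by (cases x) (auto simp: attach_def graph_over_def ran_def)

lemma inj_Vis [simp]: "inj_on Vis A"
  by (auto simp: inj_on_def)

lemma elab_att: "elab (att G) (ren Vis e) = (if e \<in> edges G then elab G e else None)"
proof -
  have "ren Vis e \<in> ren Vis ` edges G \<longleftrightarrow> e \<in> edges G"
    using ren_inj[OF inj_Vis, of _ UNIV] by auto
  moreover have "map_prod Vis id -` ren Vis e = e"
    by (auto simp: ren_def inj_on_def)
  ultimately show ?thesis by (simp add: attach_def)
qed

lemma elab_att_None: "e \<notin> ren Vis ` edges G \<Longrightarrow> elab (att G) e = None"
  by (auto simp: attach_def)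

lemma is_iso_att:
  assumes "is_graph G" "is_iso f G H"
  shows "is_iso (map_xv f) (att G) (att H)"
proof -
  have H: "edges H = ren f ` edges G" "verts H = f ` verts G"
    using assms(2) is_iso_verts[OF assms(2)] by (simp_all add: is_iso_def)
  have inj: "inj_on f (verts G)" using is_iso_inj[OF assms(2)] .
  have r: "ren (map_xv f) (ren Vis e) = ren Vis (ren f e)" for e :: "('a \<times> 'p) set"
  proof -
    have "map_xv f \<circ> Vis = Vis \<circ> f" by auto
    then show ?thesis by (simp add: ren_ren)
  qed
  have cl: "child_link (map_xv f x) a (map_xv f y) b" if "child_link x a y b" for x a y b
    using that by (auto simp: child_link_def)
  have cl': "\<exists>x y. x' = map_xv f x \<and> y' = map_xv f y \<and> child_link x a y b \<and> root x = v"
    if "child_link x' a y' b" "root x' = f v" for x' a y' b v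
  proof -
    from that consider "x' = map_xv f (Vis v)" "y' = map_xv f (Inv v [])" "a = pm" "b = pm"
      | s c where "x' = map_xv f (Inv v s)" "y' = map_xv f (Inv v (c # s))" "a = dir c" "b = pm"
      by (cases x'; cases y') auto
    then show ?thesis by cases fastforce+
  qed
  have 1: "ren (map_xv f) ` {{(x, a), (y, b)} | x a y b. child_link x a y b \<and> root x \<in> verts G} =
    {{(x, a), (y, b)} | x a y b. child_link x a y b \<and> root x \<in> verts H}" (is "?A = ?B")
  proof
    show "?A \<subseteq> ?B" using cl by (auto simp: H root_map_xv) (metis root_map_xv imageI)
    show "?B \<subseteq> ?A"
    proof
      fix e assume "e \<in> ?B"
      then obtain x' a y' b where e: "e = {(x', a), (y', b)}" "child_link x' a y' b" "root x' \<in> verts H"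
        by blast
      then obtain v where "v \<in> verts G" "root x' = f v" by (auto simp: H)
      with cl'[OF e(2)] obtain x y where "x' = map_xv f x" "y' = map_xv f y" "child_link x a y b"
        "root x \<in> verts G" by metis
      then show "e \<in> ?A" using e(1)
        by (intro image_eqI[of _ _ "{(x, a), (y, b)}"]) auto
    qed
  qed
  have E: "edges (att H) = ren (map_xv f) ` edges (att G)"
    unfolding edges_att image_Un 1 by (simp add: H image_image r)
  have V: "verts (att H) = map_xv f ` verts (att G)"
  proof (intro set_eqI iffI)
    fix y assume "y \<in> verts (att H)"
    then obtain v where v: "v \<in> verts G" "root y = f v" by (auto simp: verts_att H)
    show "y \<in> map_xv f ` verts (att G)"
    proof (cases y)
      case (Vis u)
      then show ?thesis using v by (intro image_eqI[of _ _ "Vis v"]) (auto simp: verts_att)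
    next
      case (Inv u s)
      then show ?thesis using v by (intro image_eqI[of _ _ "Inv v s"]) (auto simp: verts_att)
    qed
  qed (auto simp: verts_att root_map_xv H)
  have inj': "inj_on (map_xv f) (verts (att G))"
  proof (rule inj_onI)
    fix x y assume "x \<in> verts (att G)" "y \<in> verts (att G)" "map_xv f x = map_xv f y"
    then show "x = y" using inj by (cases x; cases y) (auto simp: verts_att dest: inj_onD)
  qed
  show ?thesis
    unfolding is_iso_def
  proof (intro conjI ballI)
    show "bij_betw (map_xv f) (verts (att G)) (verts (att H))" using inj' V by (simp add: bij_betw_def)
    show "edges (att H) = ren (map_xv f) ` edges (att G)" by (rule E)
    show "vlab (att H) (map_xv f x) = vlab (att G) x" if "x \<in> verts (att G)" for x
      using that assms(2) by (cases x) (auto simp: attach_def is_iso_def H)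
    show "elab (att H) (ren (map_xv f) e) = elab (att G) e" if e: "e \<in> edges (att G)" for e
    proof (cases "e \<in> ren Vis ` edges G")
      case True
      then obtain e' where e': "e' \<in> edges G" "e = ren Vis e'" by auto
      moreover have "ren f e' \<in> edges H" using H e' by simp
      ultimately show ?thesis using assms(2) by (simp add: r elab_att is_iso_def)
    next
      case False
      have "fst ` e \<subseteq> verts (att G)"
      proof -
        from att_edge_doubleton[OF assms(1) e] obtain x a y b where
          "e = {(x, a), (y, b)}" "root x \<in> verts G" "root y \<in> verts G" .
        then show ?thesis by (simp add: verts_att)
      qed
      \<comment> \<open>A tree edge cannot land on an edge of \<open>H\<close>, because renaming is
        injective on edges with ends in \<open>att G\<close>; both labels are therefore
        \<open>None\<close>.\<close>
      have "ren (map_xv f) e \<notin> ren Vis ` edges H"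
      proof
        assume "ren (map_xv f) e \<in> ren Vis ` edges H"
        then obtain d where d: "d \<in> edges G" "ren (map_xv f) e = ren (map_xv f) (ren Vis d)"
          by (auto simp: H r)
        have "fst ` ren Vis d \<subseteq> verts (att G)"
          using edges_fst[OF assms(1) d(1)] by (auto simp: fst_ren verts_att)
        from ren_inj[OF inj' \<open>fst ` e \<subseteq> verts (att G)\<close> this d(2)] show False
          using False d(1) by auto
      qed
      then show ?thesis using False by (simp add: elab_att_None)
    qed
  qed
qed

end

context invisible_matter
begin

section \<open>Disks of graphs with trees attached\<close>

lemma root_fst_ren_Vis: "root ` fst ` ren Vis e = fst ` e"
  by (simp add: fst_ren image_image)

text \<open>Both ends of a tree edge have the same carrier, so restricting \<open>G\<close> keeps or
  drops whole trees.\<close>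

lemma edges_att_subgr:
  fixes G :: "('v, 's, 'd, 'p) graph"
  assumes "is_graph G" "B \<subseteq> verts G"
  shows "edges (att (subgr G B L)) = {e \<in> edges (att G). root ` fst ` e \<subseteq> B}"
proof -
  have "ren Vis ` edges_in G B = {e \<in> ren Vis ` edges G. root ` fst ` e \<subseteq> B}"
  proof -
    have "edges_in G B = {e \<in> edges G. root ` fst ` ren Vis e \<subseteq> B}"
      by (simp only: edges_in_def root_fst_ren_Vis)
    then show ?thesis by blast
  qed
  moreover have "{{(x, a), (y, b)} | x a y b. child_link x a y b \<and> root x \<in> B} =
    {e \<in> {{(x, a), (y, b)} | x a y b. child_link x a y b \<and> root x \<in> verts G}. root ` fst ` e \<subseteq> B}"
    using assms(2) child_link_root by fastforce
  ultimately show ?thesis unfolding edges_att by auto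
qed

text \<open>Along a walk of length at most \<open>n + 1\<close> from \<open>Vis p\<close>, the
  carriers stay in the ball of radius \<open>n + 1\<close> of \<open>G\<close> by projection, so
  every edge used survives the truncation.\<close>

lemma ball_att_disk:
  assumes "over G" "p \<in> verts G" "k \<le> n + 1"
  shows "ball (att (graph_disk n G p)) (Vis p) k = ball (att G) (Vis p) k"
proof -
  have G: "is_graph G" using assms(1) by (rule graph_over_graph)
  let ?B = "ball G p (n + 1)"
  have B: "?B \<subseteq> verts G" using ball_verts[OF G] .
  have E: "edges (att (graph_disk n G p)) = {e \<in> edges (att G). root ` fst ` e \<subseteq> ?B}"
    unfolding graph_disk_subgr by (rule edges_att_subgr[OF G B])
  have V: "verts (att (graph_disk n G p)) \<subseteq> verts (att G)"
    using B by (auto simp: verts_att)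
  have 1: "walk (att (graph_disk n G p)) (Vis p) w y \<Longrightarrow> walk (att G) (Vis p) w y" for w y
    by (rule walk_mono[OF _ V]) (auto simp: E)
  have "walk (att (graph_disk n G p)) (Vis p) w y"
    if "walk (att G) (Vis p) w y" "length w \<le> n + 1" for w y
    using that
  proof (induction w arbitrary: y rule: rev_induct)
    case Nil
    then show ?case using ball_self[OF assms(2)] by (simp add: verts_att)
  next
    case (snoc l w)
    obtain a b where l: "l = (a, b)" by (cases l)
    have gA: "is_graph (att G)" using is_graph_att[OF assms(1)] .
    from snoc.prems obtain x where x: "walk (att G) (Vis p) w x" "{(x, a), (y, b)} \<in> edges (att G)"
      by (auto simp: walk_snoc gA l)
    have "x \<in> ball (att G) (Vis p) (n + 1)"
      using x(1) snoc.prems(2) by (auto simp: ball_def simp del: walk.simps intro!: exI[of _ w])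
    moreover have "y \<in> ball (att G) (Vis p) (n + 1)"
      using snoc.prems unfolding ball_def by blast
    ultimately have xy: "root x \<in> ?B" "root y \<in> ?B"
      using ball_att_project[OF G, of _ "Vis p"] by auto
    then have "{(x, a), (y, b)} \<in> edges (att (graph_disk n G p))" using x(2) by (simp add: E)
    moreover have "y \<in> verts (att (graph_disk n G p))" using xy by (simp add: verts_att)
    ultimately have "walk (att (graph_disk n G p)) x [(a, b)] y" by auto
    with snoc.IH[OF x(1)] snoc.prems(2) show ?case unfolding l by (intro walk_appendI) auto
  qed
  with 1 assms(3) show ?thesis unfolding ball_def by (meson order_trans)
qed

text \<open>The bridge between the two notions of continuity: a truncated visible graph with full
  trees is a member of \<open>\<Y>\<close> indistinguishable from the original one at radius
  \<open>n\<close>.\<close>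

lemma graph_disk_att_disk:
  assumes "over G" "p \<in> verts G"
  shows "graph_disk n (att (graph_disk n G p)) (Vis p) = graph_disk n (att G) (Vis p)"
proof -
  let ?D = "graph_disk n G p" and ?X = "ball (att G) (Vis p) (n + 1)" and ?Y = "ball (att G) (Vis p) n"
  have G: "is_graph G" using assms(1) by (rule graph_over_graph)
  have E: "edges (att ?D) = {e \<in> edges (att G). root ` fst ` e \<subseteq> ball G p (n + 1)}"
    unfolding graph_disk_subgr by (rule edges_att_subgr[OF G ball_verts[OF G]])
  have X: "root x \<in> ball G p (n + 1)" if "x \<in> ?X" for x
    using ball_att_project[OF G that] by simp
  have Y: "root x \<in> ball G p n" if "x \<in> ?Y" for x
    using ball_att_project[OF G that] by simp
  have YX: "?Y \<subseteq> ?X" by (rule ball_mono) simp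
  have ein: "edges_in (att ?D) Z = edges_in (att G) Z" if Z: "Z \<subseteq> ?X" for Z
    using X Z by (fastforce simp: edges_in_def E)
  have vl: "vlab (att ?D) x = vlab (att G) x" if "x \<in> ?Y" for x
  proof (cases x)
    case (Vis v)
    then have "v \<in> ball G p n" using Y[OF that] by simp
    then show ?thesis using Vis by (simp add: attach_def graph_disk_subgr)
  next
    case (Inv v s)
    then have "v \<in> ball G p (n + 1)" using X YX that by fastforce
    then show ?thesis using Inv ball_verts[OF G] by (auto simp: attach_def)
  qed
  have el: "elab (att ?D) e = elab (att G) e" if e: "e \<in> edges_in (att G) ?Y" for e
  proof (cases "e \<in> ren Vis ` edges G")
    case True
    then obtain d where d: "d \<in> edges G" "e = ren Vis d" by blast
    have "fst ` d \<subseteq> ball G p n"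
      using e Y unfolding d(2) root_fst_ren_Vis[of d, symmetric] edges_in_def by blast
    then have "d \<in> edges_in G (ball G p n)" "d \<in> edges_in G (ball G p (n + 1))"
      using d(1) ball_mono[of n "n + 1" G p] by (auto simp: edges_in_def)
    then show ?thesis using d by (simp add: elab_att graph_disk_subgr)
  next
    case False
    then have "e \<notin> ren Vis ` edges ?D" by (auto simp: graph_disk_subgr edges_in_def)
    with False show ?thesis by (simp add: elab_att_None)
  qed
  have b: "ball (att ?D) (Vis p) (n + 1) = ?X" "ball (att ?D) (Vis p) n = ?Y"
    by (rule ball_att_disk[OF assms]; simp)+
  show ?thesis
    unfolding graph_disk_subgr[of n "att ?D"] graph_disk_subgr[of n "att G"] b subgr_def
    using vl el ein[of ?X] ein[OF YX] by (auto simp: restrict_map_def fun_eq_iff)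
qed

section \<open>Recovering visible graphs from isomorphisms\<close>

lemma is_iso_Vis_subgr:
  assumes "is_graph H" "B \<subseteq> verts H" "L \<subseteq> B"
  shows "is_iso Vis (subgr H B L) (subgr (att H) (Vis ` B) (Vis ` L))"
proof -
  have e: "edges_in (att H) (Vis ` C) = ren Vis ` edges_in H C" for C
  proof
    show "edges_in (att H) (Vis ` C) \<subseteq> ren Vis ` edges_in H C"
    proof
      fix e assume e: "e \<in> edges_in (att H) (Vis ` C)"
      then consider d where "d \<in> edges H" "e = ren Vis d"
        | x a y b where "e = {(x, a), (y, b)}" "child_link x a y b"
        unfolding edges_in_def edges_att by blast
      then show "e \<in> ren Vis ` edges_in H C"
      proof cases
        case 1
        then have "Vis ` fst ` d \<subseteq> Vis ` C" using e by (simp add: edges_in_def fst_ren)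
        then have "fst ` d \<subseteq> C" by auto
        with 1 show ?thesis by (auto simp: edges_in_def)
      next
        case 2
        \<comment> \<open>The child end of a link is always an \<open>Inv\<close>, so no tree edge
          has both ends visible.\<close>
        with e show ?thesis by (auto simp: edges_in_def child_link_def)
      qed
    qed
    show "ren Vis ` edges_in H C \<subseteq> edges_in (att H) (Vis ` C)"
    proof
      fix e assume "e \<in> ren Vis ` edges_in H C"
      then obtain d where d: "e = ren Vis d" "d \<in> edges H" "fst ` d \<subseteq> C"
        by (auto simp: edges_in_def)
      then have "fst ` e \<subseteq> Vis ` C" by (simp add: fst_ren image_mono)
      with d show "e \<in> edges_in (att H) (Vis ` C)" by (simp add: edges_in_def edges_att)
    qed
  qed
  have i': "ren Vis d \<in> ren Vis ` edges_in H L \<longleftrightarrow> d \<in> edges_in H L" for d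
    using ren_inj[OF inj_Vis, of d UNIV] by auto
  have v: "vlab (att H) (Vis v) = vlab H v" for v by (simp add: attach_def)
  show ?thesis
    unfolding is_iso_def
    by (auto simp: bij_betw_def e restrict_map_def i' v elab_att) (auto simp: edges_in_def)
qed

lemma is_iso_root_subgr:
  assumes "is_graph H" "is_graph (subgr H B L)" "B \<subseteq> verts H" "L \<subseteq> B"
  shows "is_iso root (subgr (att H) (Vis ` B) (Vis ` L)) (subgr H B L)"
proof -
  have iso: "is_iso Vis (subgr H B L) (subgr (att H) (Vis ` B) (Vis ` L))"
    by (rule is_iso_Vis_subgr[OF assms(1,3,4)])
  have "is_graph (subgr (att H) (Vis ` B) (Vis ` L))"
  proof (rule is_iso_is_graph[OF assms(2) iso])
    show "dom (vlab (subgr (att H) (Vis ` B) (Vis ` L))) \<subseteq> verts (subgr (att H) (Vis ` B) (Vis ` L))"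
      using assms(4) by auto
    show "dom (elab (subgr (att H) (Vis ` B) (Vis ` L))) \<subseteq> edges (subgr (att H) (Vis ` B) (Vis ` L))"
      using edges_in_mono[OF image_mono[OF assms(4)]] by auto
  qed
  then show ?thesis
    by (rule is_iso_cong[OF _ is_iso_inv[OF assms(2) iso]]) auto
qed

lemma disk_iso_root:
  assumes "over H" "over H'" "y \<in> verts (att H)"
    and g: "is_iso g (graph_disk M (att H) y) (graph_disk M (att H') (g y))"
    and gy: "g y \<in> verts (att H')"
    and x: "x \<in> ball (att H) y k" "k + depth x \<le> M"
  shows "g (Vis (root x)) = Vis (root (g x))" "g x = map_xv (\<lambda>_. root (g x)) x"
proof -
  let ?A = "att H" and ?A' = "att H'"
  let ?D = "graph_disk M ?A y" and ?D' = "graph_disk M ?A' (g y)"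
  have gr: "is_graph H" "is_graph H'" "is_graph ?A" "is_graph ?A'"
    using assms(1,2) graph_over_graph is_graph_att by blast+
  have gD: "is_graph ?D" "is_graph ?D'"
    by (intro is_graph_disk gr assms(3) gy)+
  have xv: "x \<in> verts ?A" using x(1) ball_verts[OF gr(3)] by blast
  let ?r = "Vis (root x)"
  have "?r \<in> ball ?A y (k + depth x)"
    using ball_trans[OF gr(3) x(1) root_in_ball[OF gr(1) xv]] .
  then have r: "?r \<in> ball ?A y M" using ball_mono[OF x(2), of ?A y] by blast
  have "g ?r \<in> ball ?D' (g y) M"
  proof -
    have "ball ?D y M = ball ?A y M" by (rule ball_graph_disk[OF gr(3) assms(3)]) simp
    then show ?thesis
      using is_iso_ball[OF gD g, of y M] r ball_self[OF assms(3)] by simp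
  qed
  then have gr': "g ?r \<in> ball ?A' (g y) M"
    using ball_graph_disk[OF gr(4) gy, of M M] by simp
  \<comment> \<open>This says something about the whole graphs only because both vertices are within
    distance \<open>M\<close>, not merely \<open>M + 1\<close>.\<close>
  have "vlab ?D' (g ?r) = vlab ?D ?r"
    using g r ball_mono[of M "M + 1" ?A y] by (auto simp: is_iso_def)
  then have "vlab ?A' (g ?r) = vlab ?A ?r"
    using r gr' by (simp add: graph_disk_subgr)
  moreover have "vlab ?A ?r \<noteq> Some mm"
    using vlab_att_inv[of ?r H] xv assms(1) by (simp add: verts_att)
  ultimately have "depth (g ?r) = 0"
    using vlab_att_inv[of "g ?r" H'] gr' ball_verts[OF gr(4)] assms(2) by auto
  then obtain v' where v': "g ?r = Vis v'" by (cases "g ?r") auto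
  have gx: "g x = map_xv (\<lambda>_. v') x"
  proof (cases x)
    case (Vis v)
    then show ?thesis using v' by simp
  next
    case (Inv v s)
    have "walk ?A x (up s) (Vis v)"
      using walk_up[OF gr(1)] xv Inv by (simp add: verts_att)
    then have "walk ?D x (up s) (Vis v)"
      using walk_graph_diskI[OF gr(3) x(1)] x(2) Inv by simp
    then have "walk ?D' (g x) (up s) (Vis v')"
      using is_iso_walk[OF gD(1) g] v' Inv by fastforce
    then have 1: "walk ?A' (g x) (up s) (Vis v')" by (rule walk_graph_diskD[OF gr(4)])
    then have "v' \<in> verts H'" using walk_verts(2)[OF gr(4)] by (fastforce simp: verts_att)
    then have "walk ?A' (Inv v' s) (up s) (Vis v')" by (rule walk_up[OF gr(2)])
    \<comment> \<open>Read backwards from \<open>Vis v'\<close>, the word \<open>up s\<close> has a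
      single end.\<close>
    with 1 have "g x = Inv v' s"
      using walk_rev[OF gr(4)] walk_det[OF gr(4)] by blast
    then show ?thesis using Inv by simp
  qed
  then have "root (g x) = v'" by (cases x) auto
  with v' gx show "g (Vis (root x)) = Vis (root (g x))" "g x = map_xv (\<lambda>_. root (g x)) x"
    by simp_all
qed

text \<open>The image of a short visible walk is a walk between visible vertices of
  \<open>att H'\<close>, and projection brings it into \<open>H'\<close> without lengthening
  it.\<close>

lemma disk_iso_ball:
  assumes "over H" "over H'" "y \<in> verts (att H)"
    and g: "is_iso g (graph_disk M (att H) y) (graph_disk M (att H') (g y))"
    and gy: "g y \<in> verts (att H')"
    and v: "v \<in> ball H (root y) k" "depth y + k \<le> M"
  shows "g (Vis v) = Vis (root (g (Vis v)))" "root (g (Vis v)) \<in> ball H' (root (g y)) k"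
proof -
  let ?A = "att H" and ?A' = "att H'"
  let ?D = "graph_disk M ?A y" and ?D' = "graph_disk M ?A' (g y)"
  have gr: "is_graph H" "is_graph H'" "is_graph ?A" "is_graph ?A'"
    using assms(1,2) graph_over_graph is_graph_att by blast+
  have gD: "is_graph ?D" by (intro is_graph_disk gr assms(3))
  have r: "Vis (root y) \<in> ball ?A y (depth y)" using root_in_ball[OF gr(1) assms(3)] .
  have gr0: "g (Vis (root y)) = Vis (root (g y))"
    by (rule disk_iso_root[OF assms(1-5) ball_self[OF assms(3), of 0]]) (use v in simp)
  have "Vis v \<in> ball ?A y (depth y + k)"
    using ball_trans[OF gr(3) r ball_att_Vis[OF gr(1) v(1)]] .
  from disk_iso_root(1)[OF assms(1-5) this] v(2)
  show 1: "g (Vis v) = Vis (root (g (Vis v)))" by simp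
  obtain w where w: "length w \<le> k" "walk H (root y) w v" using v(1) by (auto simp: ball_def)
  have "walk ?D (Vis (root y)) w (Vis v)"
    using walk_graph_diskI[OF gr(3) r walk_att_VisI[OF gr(1) w(2)]] w(1) v(2) by simp
  from is_iso_walk[OF gD g this] have "walk ?D' (Vis (root (g y))) w (Vis (root (g (Vis v))))"
    using 1 gr0 by simp
  from walk_att_project[OF gr(2) walk_graph_diskD[OF gr(4) this]]
  obtain w' where "length w' \<le> length w" "walk H' (root (g y)) w' (root (g (Vis v)))" by auto
  with w(1) show "root (g (Vis v)) \<in> ball H' (root (g y)) k"
    unfolding ball_def by (auto intro!: exI[of _ w'])
qed

lemma Vis_ball_subset:
  assumes "over G" "z \<in> verts (att G)" "depth z + k \<le> l"
  shows "Vis ` ball G (root z) k \<subseteq> ball (att G) z l"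
proof -
  have gr: "is_graph G" "is_graph (att G)"
    using assms graph_over_graph is_graph_att by blast+
  have "Vis ` ball G (root z) k \<subseteq> ball (att G) z (depth z + k)"
    by (intro image_subsetI ball_trans[OF gr(2) root_in_ball[OF gr(1) assms(2)]] ball_att_Vis[OF gr(1)])
  then show ?thesis using ball_mono[OF assms(3), of "att G" z] by blast
qed

text \<open>From \<open>y\<close>, at most \<open>depth y\<close> steps lead to its carrier and
  \<open>m + 1\<close> more exhaust the visible disk around it; this is where the lower bound on
  \<open>M\<close> comes from. Restricting \<open>g\<close> to these visible vertices gives the
  isomorphism.\<close>

lemma disk_iso_visible:
  assumes "over H" "over H'" "y \<in> verts (att H)"
    and g: "is_iso g (graph_disk M (att H) y) (graph_disk M (att H') (g y))"
    and gy: "g y \<in> verts (att H')"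
    and M: "depth y + m + 1 \<le> M"
  shows "is_iso (root \<circ> g \<circ> Vis) (graph_disk m H (root y)) (graph_disk m H' (root (g y)))"
proof -
  let ?A = "att H" and ?A' = "att H'"
  let ?D = "graph_disk M ?A y" and ?D' = "graph_disk M ?A' (g y)"
  let ?g = "inv_into (verts ?D) g"
  have gr: "is_graph H" "is_graph H'" "is_graph ?A" "is_graph ?A'"
    using assms(1,2) graph_over_graph is_graph_att by blast+
  have gD: "is_graph ?D" "is_graph ?D'"
    by (intro is_graph_disk gr assms(3) gy)+
  have ry: "root y \<in> verts H" "root (g y) \<in> verts H'" using assms(3) gy by (simp_all add: verts_att)
  have dy: "depth (g y) = depth y"
  proof -
    have "g y = map_xv (\<lambda>_. root (g y)) y"
      by (rule disk_iso_root[OF assms(1-5) ball_self[OF assms(3), of 0]]) (use M in simp)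
    then show ?thesis by (cases y) (metis depth.simps xv.map)+
  qed
  have gy': "?g (g y) = y"
    using is_iso_inj[OF g] ball_self[OF assms(3)] by (simp add: inv_into_f_f)
  \<comment> \<open>The inverse is again an isomorphism of disks, and \<open>dy\<close> gives it the
    same depth budget, so \<open>disk_iso_ball\<close> also yields the reverse inclusion of
    balls.\<close>
  have inv: "is_iso ?g ?D' (graph_disk M ?A (?g (g y)))"
    unfolding gy' by (rule is_iso_inv[OF gD(1) g])
  have im: "g ` Vis ` ball H (root y) k = Vis ` ball H' (root (g y)) k" if k: "k \<le> m + 1" for k
  proof
    show "g ` Vis ` ball H (root y) k \<subseteq> Vis ` ball H' (root (g y)) k"
      using disk_iso_ball[OF assms(1-5), of _ k] k M by fastforce
    show "Vis ` ball H' (root (g y)) k \<subseteq> g ` Vis ` ball H (root y) k"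
    proof
      fix z assume "z \<in> Vis ` ball H' (root (g y)) k"
      then obtain v where v: "z = Vis v" "v \<in> ball H' (root (g y)) k" by blast
      have 1: "?g (Vis v) = Vis (root (?g (Vis v)))" "root (?g (Vis v)) \<in> ball H (root y) k"
        using disk_iso_ball[OF assms(2,1) gy inv _ v(2)] assms(3) dy k M unfolding gy' by linarith+
      have "Vis v \<in> ball ?A' (g y) (depth (g y) + k)"
        using ball_trans[OF gr(4) root_in_ball[OF gr(2) gy] ball_att_Vis[OF gr(2) v(2)]] .
      then have "Vis v \<in> verts ?D'"
        using ball_mono[of "depth (g y) + k" "M + 1" ?A' "g y"] dy k M by auto
      then have "g (?g (Vis v)) = Vis v"
        using is_iso_verts[OF g] by (metis f_inv_into_f)
      with 1 v(1) show "z \<in> g ` Vis ` ball H (root y) k" by (metis imageI)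
    qed
  qed
  let ?C = "Vis ` ball H (root y) (m + 1)" and ?K = "Vis ` ball H (root y) m"
  let ?C' = "Vis ` ball H' (root (g y)) (m + 1)" and ?K' = "Vis ` ball H' (root (g y)) m"
  have "?C \<subseteq> ball ?A y (M + 1)" "?K \<subseteq> ball ?A y M"
    using Vis_ball_subset[OF assms(1,3)] M by simp_all
  moreover have "?C' \<subseteq> ball ?A' (g y) (M + 1)" "?K' \<subseteq> ball ?A' (g y) M"
    using Vis_ball_subset[OF assms(2) gy] M dy by simp_all
  moreover have KC: "?K \<subseteq> ?C" "?K' \<subseteq> ?C'" by (intro image_mono ball_mono; simp)+
  ultimately have s: "subgr ?D ?C ?K = subgr ?A ?C ?K" "subgr ?D' ?C' ?K' = subgr ?A' ?C' ?K'"
    and C: "?C \<subseteq> verts ?D"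
    unfolding graph_disk_subgr by (simp_all add: subgr_subgr)
  have 1: "is_iso g (subgr ?A ?C ?K) (subgr ?A' ?C' ?K')"
    using is_iso_subgr[OF edges_fst[OF gD(1)] g C KC(1)]
    unfolding im[OF order_refl] im[OF le_add1] s .
  have 2: "is_iso Vis (graph_disk m H (root y)) (subgr ?A ?C ?K)"
    unfolding graph_disk_subgr by (rule is_iso_Vis_subgr[OF gr(1) ball_verts[OF gr(1)] ball_mono]) simp
  have 3: "is_iso root (subgr ?A' ?C' ?K') (graph_disk m H' (root (g y)))"
    using is_graph_disk[OF gr(2) ry(2), of m] unfolding graph_disk_subgr
    by (rule is_iso_root_subgr[OF gr(2) _ ball_verts[OF gr(2)] ball_mono]) simp
  show ?thesis using is_iso_trans[OF 2 is_iso_trans[OF 1 3]] by (simp add: comp_assoc)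
qed

lemma visible_part_att: "over G \<Longrightarrow> visible_part mm (att G) = subgr (att G) (Vis ` verts G) (Vis ` verts G)"
proof -
  assume G: "over G"
  have "x \<in> verts (att G) \<and> vlab (att G) x \<noteq> Some mm \<longleftrightarrow> x \<in> Vis ` verts G" for x
    using vlab_att_inv[OF _ G, of x] by (cases x) (auto simp: verts_att)
  then show ?thesis by (simp add: visible_part_subgr)
qed

lemma is_iso_visible_part:
  assumes "is_graph A" "is_iso g A A'"
  shows "is_iso g (visible_part mm A) (visible_part mm A')"
proof -
  have "g ` {v \<in> verts A. vlab A v \<noteq> Some mm} = {v \<in> verts A'. vlab A' v \<noteq> Some mm}"
    using assms(2) is_iso_verts[OF assms(2)] by (auto simp: is_iso_def)
  moreover have "is_iso g (subgr A C C) (subgr A' (g ` C) (g ` C))" if "C \<subseteq> verts A" for C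
    by (rule is_iso_subgr[OF edges_fst[OF assms(1)] assms(2) that order_refl])
  ultimately show ?thesis unfolding visible_part_subgr by (metis (no_types, lifting) mem_Collect_eq subsetI)
qed

lemma is_iso_Vis: "over G \<Longrightarrow> is_iso Vis G (visible_part mm (att G))"
  using is_iso_Vis_subgr[OF graph_over_graph order_refl order_refl]
  by (metis visible_part_att subgr_verts graph_over_graph)

text \<open>An isomorphism of whole graphs restricts to disks of every radius, so
  \<open>disk_iso_root\<close> applies to each \<open>x\<close> at the centre of its own disk of
  radius \<open>depth x\<close>.\<close>

lemma att_isoD:
  assumes "over H" "over H'" "is_iso g (att H) (att H')"
  shows "is_iso (root \<circ> g \<circ> Vis) H H'" "\<And>x. x \<in> verts (att H) \<Longrightarrow> g x = map_xv (root \<circ> g \<circ> Vis) x"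
proof -
  have gr: "is_graph H" "is_graph H'" "is_graph (att H)" "is_graph (att H')"
    using assms(1,2) graph_over_graph is_graph_att by blast+
  have "is_iso root (visible_part mm (att H')) H'"
    using is_iso_root_subgr[OF gr(2) _ order_refl order_refl] gr(2)
    by (simp add: visible_part_att assms(2) subgr_verts)
  then show "is_iso (root \<circ> g \<circ> Vis) H H'"
    using is_iso_trans[OF is_iso_Vis[OF assms(1)]
        is_iso_trans[OF is_iso_visible_part[OF gr(3) assms(3)]]] by (simp add: comp_assoc)
  show "g x = map_xv (root \<circ> g \<circ> Vis) x" if x: "x \<in> verts (att H)" for x
  proof -
    have gx: "g x \<in> verts (att H')" using is_iso_verts[OF assms(3)] x by blast
    have g: "is_iso g (graph_disk (depth x) (att H) x) (graph_disk (depth x) (att H') (g x))"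
      by (rule is_iso_graph_disk[OF gr(3,4) assms(3) x])
    note disk_iso_root[OF assms(1,2) x g gx ball_self[OF x, of 0], simplified]
    then show ?thesis by (cases x) auto
  qed
qed

lemma pgm_of_att_eqD:
  assumes "over H" "over H'" "y \<in> verts (att H)" "y' \<in> verts (att H')"
    "pgm_of (att H, y) = pgm_of (att H', y')"
  obtains f where "is_iso f H H'" "is_iso (map_xv f) (att H) (att H')" "map_xv f y = y'"
proof -
  have gr: "is_graph H" "is_graph H'" "is_graph (att H)" "is_graph (att H')"
    using assms(1,2) graph_over_graph is_graph_att by blast+
  obtain g where g: "is_iso g (att H) (att H')" "g y = y'"
    using pgm_of_eqD[OF gr(3,4) assms(5,3,4)] .
  note * = att_isoD[OF assms(1,2) g(1)]
  show thesis
  proof (rule that[OF *(1)])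
    show "is_iso (map_xv (root \<circ> g \<circ> Vis)) (att H) (att H')"
      by (rule is_iso_att[OF gr(1) *(1)])
    show "map_xv (root \<circ> g \<circ> Vis) y = y'" using *(2)[OF assms(3)] g(2) by simp
  qed
qed

section \<open>\<open>alpha\<close>, \<open>embed\<close> and \<open>\<Y>\<close> on
  representatives\<close>

lemma alpha_pgm_of_att:
  assumes "over G"
  shows "alpha mm (pgm_of (att G, u)) = anon_of G"
proof -
  have gr: "is_graph G" "is_graph (att G)"
    using assms graph_over_graph is_graph_att by blast+
  have "anon_of (visible_part mm K) = anon_of G" if K: "K \<in> anon_of (att G)" for K
  proof -
    obtain f where f: "is_iso f (att G) K" using K by (auto simp: anon_of_def)
    have iso: "is_iso (f \<circ> Vis) G (visible_part mm K)"
      by (rule is_iso_trans[OF is_iso_Vis[OF assms] is_iso_visible_part[OF gr(2) f]])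
    have "is_graph (visible_part mm K)"
      by (rule is_iso_is_graph[OF gr(1) iso]) (auto simp: visible_part_subgr)
    then show ?thesis using anon_of_eqI[OF gr(1) _ iso] by simp
  qed
  moreover obtain K :: "(nat, 's, 'd, 'p) graph" where "K \<in> anon_of (att G)"
    using countable_copy[OF gr(2)] unfolding anon_of_def by blast
  ultimately show ?thesis unfolding alpha_def forget_pgm_of by auto
qed

lemma embed_pgm_of:
  fixes G :: "('v, 's, 'd, 'p) graph"
  assumes "over G" "p \<in> verts G"
  shows "embed mm pm pl pr (pgm_of (G, p)) = pgm_of (att G, Vis p)"
proof -
  have gr: "is_graph G" "is_graph (att G)"
    using assms graph_over_graph is_graph_att by blast+
  have 1: "pgm_of (att (fst y), Vis (snd y)) = pgm_of (att G, Vis p)" if y: "y \<in> pgm_of (G, p)" for y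
  proof -
    obtain H :: "(nat, 's, 'd, 'p) graph" and f where y: "y = (H, f p)" "is_graph H" "is_iso f G H"
      using y by (cases y) (auto simp: in_pgm_of)
    have "is_graph (att H)" by (rule is_graph_att[OF graph_over_iso[OF assms(1) y(2,3)]])
    from pgm_of_eqI[OF gr(2) this is_iso_att[OF gr(1) y(3)], of "Vis p"] assms(2)
    show ?thesis by (simp add: y(1) verts_att)
  qed
  obtain H f where "(H, f p) \<in> pgm_of (G, p)" using pgm_of_rep[OF gr(1)] .
  with 1 show ?thesis unfolding embed_def by (auto simp: case_prod_beta)
qed

text \<open>The working description of \<open>\<Y>\<close>. For the converse the graph modulo is
  pointed at the carrier of \<open>u\<close>, from which \<open>u\<close> is reached by
  repointing.\<close>

lemma impgms_iff:
  "Y \<in> impgms \<Sigma> \<Delta> \<pi> mm pm pl pr \<longleftrightarrow>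
    (\<exists>(G :: (nat, 's, 'd, 'p) graph) u. over G \<and> u \<in> verts (att G) \<and> Y = pgm_of (att G, u))"
  (is "?L \<longleftrightarrow> ?R")
proof
  assume ?L
  then obtain G :: "(nat, 's, 'd, 'p) graph" and p u where Y: "over G" "p \<in> verts G"
    "Y = repoint (embed mm pm pl pr (pgm_of (G, p))) u" "u \<in> V (embed mm pm pl pr (pgm_of (G, p)))"
    by (auto simp: impgms_def pgms_def)
  note A = is_graph_att[OF Y(1)] and p = Y(2)
  have p': "Vis p \<in> verts (att G)" using p by (simp add: verts_att)
  from Y(4) obtain v where "v \<in> verts (att G)" "u = cls (att G) (Vis p) v"
    by (auto simp: embed_pgm_of[OF Y(1,2)] V_pgm_of[OF A p'])
  then show ?R using Y(1,3) repoint_pgm_of[OF A p'] by (auto simp: embed_pgm_of[OF Y(1,2)])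
next
  assume ?R
  then obtain G :: "(nat, 's, 'd, 'p) graph" and u where
    Y: "over G" "u \<in> verts (att G)" "Y = pgm_of (att G, u)" by blast
  have p: "root u \<in> verts G" using Y(2) by (simp add: verts_att)
  have A: "is_graph (att G)" by (rule is_graph_att[OF Y(1)])
  have p': "Vis (root u) \<in> verts (att G)" using p by (simp add: verts_att)
  let ?X = "pgm_of (G, root u)"
  have "?X \<in> pgms \<Sigma> \<Delta> \<pi>" by (rule pgm_of_in_pgms[OF Y(1) p])
  moreover have "Y = repoint (embed mm pm pl pr ?X) (cls (att G) (Vis (root u)) u)"
    "cls (att G) (Vis (root u)) u \<in> V (embed mm pm pl pr ?X)"
    using repoint_pgm_of[OF A p' Y(2)] Y(2,3) by (simp_all add: embed_pgm_of[OF Y(1) p] V_pgm_of[OF A p'])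
  ultimately show ?L unfolding impgms_def by blast
qed

lemma att_ports: "over G \<Longrightarrow> e \<in> edges (att G) \<Longrightarrow> snd ` e \<subseteq> insert pm (insert pl (insert pr \<pi>))"
  by (auto simp: edges_att graph_over_def child_link_def dir_def split: if_splits) (metis image_eqI snd_conv snd_ren subsetD)+

text \<open>With finitely many ports a disk is finite, whereas each member of \<open>\<Y>\<close>
  contains an infinite tree. Hence \<open>disk_reps\<close> over \<open>\<Y>\<close> always consists
  of all members with the same disk.\<close>

lemma disk_notin_impgms:
  assumes "finite \<pi>" "over G" "u \<in> verts (att G)"
  shows "disk n (pgm_of (att G, u)) \<notin> impgms \<Sigma> \<Delta> \<pi> mm pm pl pr"
proof
  have A: "is_graph (att G)" by (rule is_graph_att[OF assms(2)])
  assume "disk n (pgm_of (att G, u)) \<in> impgms \<Sigma> \<Delta> \<pi> mm pm pl pr"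
  then obtain H :: "(nat, 's, 'd, 'p) graph" and x where
    H: "over H" "x \<in> verts (att H)" "pgm_of (graph_disk n (att G) u, u) = pgm_of (att H, x)"
    unfolding impgms_iff disk_pgm_of[OF A assms(3)] by blast
  obtain f where f: "is_iso f (graph_disk n (att G) u) (att H)"
    using pgm_of_eqD[OF is_graph_disk[OF A assms(3)] is_graph_att[OF H(1)] H(3) _ H(2)]
      ball_self[OF assms(3)] by auto
  have "finite (verts (graph_disk n (att G) u))"
    using finite_ball[OF A _ att_ports[OF assms(2)]] assms(1) by simp
  then have "finite (verts (att H))" using is_iso_verts[OF f] by simp
  moreover have "range (Inv (root x)) \<subseteq> verts (att H)" using H(2) by (auto simp: verts_att)
  ultimately have "finite (range (Inv (root x)))" using finite_subset by blast
  then have "finite (UNIV :: bool list set)" by (rule finite_imageD) (auto simp: inj_on_def)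
  then show False using infinite_UNIV_listI by blast
qed

end

section \<open>Compactness\<close>

text \<open>As in Koenig's lemma: a bad set split by the next property has a bad half, and dependent
  choice follows the bad halves forever.\<close>

lemma binary_branch:
  fixes P :: "nat \<Rightarrow> 'x \<Rightarrow> bool"
  assumes "bad S" "\<And>A B. bad (A \<union> B) \<Longrightarrow> bad A \<or> bad B"
  obtains b where "\<And>n. bad {x \<in> S. \<forall>i<n. P i x \<longleftrightarrow> b i}"
proof -
  have "\<exists>A. (bad (A 0) \<and> A 0 = S) \<and> (\<forall>n. bad (A n)) \<and>
    (\<forall>n. A (Suc n) = {x \<in> A n. P n x} \<or> A (Suc n) = {x \<in> A n. \<not> P n x})"
  proof -
    have "\<exists>A. \<forall>n::nat. (bad (A n) \<and> (n = 0 \<longrightarrow> A n = S)) \<and>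
      (A (Suc n) = {x \<in> A n. P n x} \<or> A (Suc n) = {x \<in> A n. \<not> P n x})"
    proof (rule dependent_nat_choice)
      show "\<exists>x. bad x \<and> (0 = (0::nat) \<longrightarrow> x = S)" using assms(1) by blast
      fix A and n :: nat assume "bad A \<and> (n = 0 \<longrightarrow> A = S)"
      moreover have "A = {x \<in> A. P n x} \<union> {x \<in> A. \<not> P n x}" by blast
      ultimately have "bad {x \<in> A. P n x} \<or> bad {x \<in> A. \<not> P n x}" using assms(2) by metis
      then show "\<exists>B. (bad B \<and> (Suc n = 0 \<longrightarrow> B = S)) \<and>
        (B = {x \<in> A. P n x} \<or> B = {x \<in> A. \<not> P n x})" by auto
    qed
    then show ?thesis by blast
  qed
  then obtain A where A: "A 0 = S" "\<And>n. bad (A n)"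
    "\<And>n. A (Suc n) = {x \<in> A n. P n x} \<or> A (Suc n) = {x \<in> A n. \<not> P n x}" by blast
  define b where "b n \<longleftrightarrow> A (Suc n) = {x \<in> A n. P n x}" for n
  have S: "A (Suc n) = {x \<in> A n. P n x \<longleftrightarrow> b n}" for n
    using A(3)[of n] by (auto simp: b_def)
  have "A n = {x \<in> S. \<forall>i<n. P i x \<longleftrightarrow> b i}" for n
    by (induction n) (auto simp: A(1) S less_Suc_eq)
  then have "bad {x \<in> S. \<forall>i<n. P i x \<longleftrightarrow> b i}" for n using A(2)[of n] by simp
  then show thesis by (rule that)
qed

text \<open>The properties are enumerated. A finite \<open>J\<close> lies in an initial segment, and
  the bad cell cut out by that segment is contained in the one cut out by \<open>J\<close>, which is
  then bad by monotonicity.\<close>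

lemma binary_branch_countable:
  fixes P :: "'i \<Rightarrow> 'x \<Rightarrow> bool"
  assumes "countable I" "bad S" "\<And>A B. bad (A \<union> B) \<Longrightarrow> bad A \<or> bad B"
    and mono: "\<And>A B. bad A \<Longrightarrow> A \<subseteq> B \<Longrightarrow> bad B"
  obtains T where "T \<subseteq> I"
    "\<And>J. finite J \<Longrightarrow> J \<subseteq> I \<Longrightarrow> bad {x \<in> S. \<forall>i\<in>J. P i x \<longleftrightarrow> i \<in> T}"
proof -
  obtain b where b: "\<And>n. bad {x \<in> S. \<forall>i<n. P (from_nat_into I i) x \<longleftrightarrow> b i}"
    by (rule binary_branch[of bad S "\<lambda>i. P (from_nat_into I i)"]) (use assms in blast)+
  let ?T = "{i \<in> I. b (to_nat_on I i)}"
  show thesis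
  proof (rule that[of ?T])
    fix J assume J: "finite J" "J \<subseteq> I"
    obtain N where N: "\<And>j. j \<in> J \<Longrightarrow> to_nat_on I j < N"
      using finite_nat_bounded[of "to_nat_on I ` J"] J(1) by auto
    have "{x \<in> S. \<forall>i<N. P (from_nat_into I i) x \<longleftrightarrow> b i} \<subseteq> {x \<in> S. \<forall>i\<in>J. P i x \<longleftrightarrow> i \<in> ?T}"
      using N J(2) assms(1) from_nat_into_to_nat_on by fastforce
    with b mono show "bad {x \<in> S. \<forall>i\<in>J. P i x \<longleftrightarrow> i \<in> ?T}" by blast
  qed blast
qed

text \<open>A pointed graph modulo is determined by the truth values of countably many elementary
  properties of its paths: which paths have the same end, the label of the end of a path, and the
  label of the last edge of a path.\<close>

datatype ('s, 'd, 'p) probe = Same "'p word" "'p word" | VLab "'p word" 's | ELab "'p word" 'd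

fun holds :: "('v, 's, 'd, 'p) pgraph \<Rightarrow> ('s, 'd, 'p) probe \<Rightarrow> bool" where
  "holds (G, p) (Same w w') \<longleftrightarrow> (\<exists>v. walk G p w v \<and> walk G p w' v)"
| "holds (G, p) (VLab w s) \<longleftrightarrow> (\<exists>v. walk G p w v \<and> vlab G v = Some s)"
| "holds (G, p) (ELab w d) \<longleftrightarrow> (\<exists>w' a b u v. w = w' @ [(a, b)] \<and> walk G p w' u \<and>
     {(u, a), (v, b)} \<in> edges G \<and> elab G {(u, a), (v, b)} = Some d)"

lemma holds_ELab:
  assumes "is_graph G" "walk G p w u" "{(u, a), (v, b)} \<in> edges G"
  shows "holds (G, p) (ELab (w @ [(a, b)]) d) \<longleftrightarrow> elab G {(u, a), (v, b)} = Some d"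
proof
  assume "holds (G, p) (ELab (w @ [(a, b)]) d)"
  then obtain u' v' where u: "walk G p w u'" "{(u', a), (v', b)} \<in> edges G"
    "elab G {(u', a), (v', b)} = Some d" by auto
  moreover from this have "u' = u" using walk_det[OF assms(1)] assms(2) by blast
  moreover from this u have "v' = v" using edge_unique[OF assms(1,3)] by blast
  ultimately show "elab G {(u, a), (v, b)} = Some d" by simp
qed (use assms in auto)

fun probe_len :: "('s, 'd, 'p) probe \<Rightarrow> nat" where
  "probe_len (Same w w') = max (length w) (length w')"
| "probe_len (VLab w s) = length w"
| "probe_len (ELab w d) = length w"

definition probes :: "'s set \<Rightarrow> 'd set \<Rightarrow> 'p set \<Rightarrow> ('s, 'd, 'p) probe set" where
  "probes \<Sigma> \<Delta> \<pi> = (let W = lists (\<pi> \<times> \<pi>) in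
     case_prod Same ` (W \<times> W) \<union> case_prod VLab ` (W \<times> \<Sigma>) \<union> case_prod ELab ` (W \<times> \<Delta>))"

lemma in_probes [simp]:
  "Same w w' \<in> probes \<Sigma> \<Delta> \<pi> \<longleftrightarrow> w \<in> lists (\<pi> \<times> \<pi>) \<and> w' \<in> lists (\<pi> \<times> \<pi>)"
  "VLab w s \<in> probes \<Sigma> \<Delta> \<pi> \<longleftrightarrow> w \<in> lists (\<pi> \<times> \<pi>) \<and> s \<in> \<Sigma>"
  "ELab w d \<in> probes \<Sigma> \<Delta> \<pi> \<longleftrightarrow> w \<in> lists (\<pi> \<times> \<pi>) \<and> d \<in> \<Delta>"
  by (auto simp: probes_def Let_def)

lemma countable_probes:
  assumes "finite \<Sigma>" "finite \<Delta>" "finite \<pi>"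
  shows "countable (probes \<Sigma> \<Delta> \<pi>)"
proof -
  have "countable (lists (\<pi> \<times> \<pi>))" using assms(3) by (intro countable_lists countable_finite) simp
  then show ?thesis unfolding probes_def Let_def
    by (intro countable_Un countable_image countable_SIGMA) (use assms countable_finite in auto)
qed

lemma finite_probes:
  assumes "finite \<Sigma>" "finite \<Delta>" "finite \<pi>"
  shows "finite {i \<in> probes \<Sigma> \<Delta> \<pi>. probe_len i \<le> n}"
proof (rule finite_subset)
  let ?W = "{w. set w \<subseteq> \<pi> \<times> \<pi> \<and> length w \<le> n}"
  have "finite ?W" using assms(3) by (intro finite_lists_length_le) simp
  then show "finite (case_prod Same ` (?W \<times> ?W) \<union> case_prod VLab ` (?W \<times> \<Sigma>) \<union> case_prod ELab ` (?W \<times> \<Delta>))"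
    using assms by blast
  show "{i \<in> probes \<Sigma> \<Delta> \<pi>. probe_len i \<le> n} \<subseteq>
    case_prod Same ` (?W \<times> ?W) \<union> case_prod VLab ` (?W \<times> \<Sigma>) \<union> case_prod ELab ` (?W \<times> \<Delta>)"
    by (auto simp: probes_def Let_def)
qed

text \<open>Probes outside the countable set fail in every graph considered, so branching over that
  set decides all probes.\<close>

lemma holds_probes:
  assumes "graph_over \<Sigma> \<Delta> \<pi> G" "holds (G, p) i"
  shows "i \<in> probes \<Sigma> \<Delta> \<pi>"
proof -
  have G: "is_graph G" using assms(1) by (rule graph_over_graph)
  have W: "w \<in> lists (\<pi> \<times> \<pi>)" if "walk G p w v" for w v
    by (rule walk_ports[OF G _ that]) (use assms(1) in \<open>auto simp: graph_over_def\<close>)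
  show ?thesis
  proof (cases i)
    case (Same w w')
    with assms(2) W have "w \<in> lists (\<pi> \<times> \<pi>)" "w' \<in> lists (\<pi> \<times> \<pi>)" by auto
    then show ?thesis unfolding Same by (simp only: in_probes)
  next
    case (VLab w s)
    with assms(2) obtain v where "walk G p w v" "vlab G v = Some s" by auto
    then have "w \<in> lists (\<pi> \<times> \<pi>)" "s \<in> \<Sigma>"
      using W assms(1) by (auto simp: graph_over_def ran_def)
    then show ?thesis unfolding VLab by (simp only: in_probes)
  next
    case (ELab w d)
    with assms(2) obtain w' a b u v where e: "w = w' @ [(a, b)]" "walk G p w' u"
      "{(u, a), (v, b)} \<in> edges G" "elab G {(u, a), (v, b)} = Some d" by auto
    then have "walk G p w v" by (auto simp: walk_snoc[OF G])
    with e have "w \<in> lists (\<pi> \<times> \<pi>)" "d \<in> \<Delta>"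
      using W assms(1) by (auto simp: graph_over_def ran_def)
    then show ?thesis unfolding ELab by (simp only: in_probes)
  qed
qed

lemma is_isoI:
  assumes "is_graph G" "is_graph H" and f: "bij_betw f (verts G) (verts H)"
    and adj: "\<And>u v a b. u \<in> verts G \<Longrightarrow> v \<in> verts G \<Longrightarrow>
      {(f u, a), (f v, b)} \<in> edges H \<longleftrightarrow> {(u, a), (v, b)} \<in> edges G"
    and vl: "\<And>v. v \<in> verts G \<Longrightarrow> vlab H (f v) = vlab G v"
    and el: "\<And>u v a b. {(u, a), (v, b)} \<in> edges G \<Longrightarrow>
      elab H {(f u, a), (f v, b)} = elab G {(u, a), (v, b)}"
  shows "is_iso f G H"
  unfolding is_iso_def
proof (intro conjI ballI)
  have V: "verts H = f ` verts G" using f by (simp add: bij_betw_def)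
  show "edges H = ren f ` edges G"
  proof (intro set_eqI iffI)
    fix e assume e: "e \<in> edges H"
    from edge_doubleton[OF assms(2) e] obtain x a y b where
      x: "e = {(x, a), (y, b)}" "x \<in> verts H" "y \<in> verts H" .
    then obtain u v where "u \<in> verts G" "v \<in> verts G" "x = f u" "y = f v" unfolding V by blast
    with x e adj have "{(u, a), (v, b)} \<in> edges G" "e = ren f {(u, a), (v, b)}" by auto
    then show "e \<in> ren f ` edges G" by blast
  next
    fix e assume "e \<in> ren f ` edges G"
    then obtain d where d: "d \<in> edges G" "e = ren f d" by blast
    from edge_doubleton[OF assms(1) d(1)] obtain u a v b where
      "d = {(u, a), (v, b)}" "u \<in> verts G" "v \<in> verts G" .
    with d adj show "e \<in> edges H" by simp
  qed
  show "elab H (ren f e) = elab G e" if e: "e \<in> edges G" for e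
  proof -
    from edge_doubleton[OF assms(1) e] obtain u a v b where "e = {(u, a), (v, b)}" .
    with el e show ?thesis by simp
  qed
qed (use f vl in auto)

text \<open>The bound \<open>n + 2\<close> comes from edges between two vertices at distance
  \<open>n + 1\<close>: testing one means extending a word of length \<open>n + 1\<close> by a
  letter.\<close>

lemma holds_disk_eq:
  fixes G :: "('v, 's, 'd, 'p) graph" and H :: "('w, 's, 'd, 'p) graph"
  assumes G: "is_graph G" "p \<in> verts G" and H: "is_graph H" "q \<in> verts H"
    and eq: "\<And>i. probe_len i \<le> n + 2 \<Longrightarrow> holds (G, p) i \<longleftrightarrow> holds (H, q) i"
  shows "disk n (pgm_of (G, p)) = disk n (pgm_of (H, q))"
proof -
  \<comment> \<open>\<open>f\<close> sends the end of a short word in \<open>G\<close> to the end of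
    the same word in \<open>H\<close>; the \<open>Same\<close> probes make the choice of the word
    irrelevant.\<close>
  define f where "f v = (SOME z. \<exists>w. length w \<le> n + 1 \<and> walk G p w v \<and> walk H q w z)" for v
  have same: "(\<exists>v. walk G p w v \<and> walk G p w' v) \<longleftrightarrow> (\<exists>v. walk H q w v \<and> walk H q w' v)"
    if "length w \<le> n + 2" "length w' \<le> n + 2" for w w'
    using eq[of "Same w w'"] that by simp
  have f: "walk H q w (f v)" if w: "length w \<le> n + 1" "walk G p w v" for w v
  proof -
    obtain z where "walk H q w z" using same[of w w] w by auto
    with w have "\<exists>z w. length w \<le> n + 1 \<and> walk G p w v \<and> walk H q w z" by blast
    from someI_ex[OF this] obtain w0 where w0: "length w0 \<le> n + 1" "walk G p w0 v" "walk H q w0 (f v)"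
      unfolding f_def by blast
    with w same[of w0 w] obtain x where "walk H q w0 x" "walk H q w x" by auto
    with w0 show ?thesis using walk_det[OF H(1)] by metis
  qed
  have f': "walk G p w v" if w: "length w \<le> n + 1" "walk H q w (f v)" "v \<in> ball G p (n + 1)" for w v
  proof -
    obtain w0 where w0: "length w0 \<le> n + 1" "walk G p w0 v" using w(3) by (auto simp: ball_def)
    with f w same[of w0 w] obtain x where "walk G p w0 x" "walk G p w x" by auto
    with w0 show ?thesis using walk_det[OF G(1)] by metis
  qed
  have ex: "\<exists>v\<in>ball G p k. z = f v" if z: "z \<in> ball H q k" "k \<le> n + 1" for z k
  proof -
    obtain w where w: "length w \<le> k" "walk H q w z" using z by (auto simp: ball_def)
    then obtain v where v: "walk G p w v" using same[of w w] z(2) by auto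
    have "z = f v" using f[of w v] v w z(2) walk_det[OF H(1)] by auto
    moreover have "v \<in> ball G p k" using v w by (auto simp: ball_def)
    ultimately show ?thesis by blast
  qed
  have inj: "inj_on f (ball G p (n + 1))"
  proof (rule inj_onI)
    fix u v assume uv: "u \<in> ball G p (n + 1)" "v \<in> ball G p (n + 1)" "f u = f v"
    then obtain w where "length w \<le> n + 1" "walk G p w u" by (auto simp: ball_def)
    moreover from this have "walk G p w v" using f f' uv by metis
    ultimately show "u = v" using walk_det[OF G(1)] by metis
  qed
  have im: "f ` ball G p k = ball H q k" if k: "k \<le> n + 1" for k
  proof
    show "f ` ball G p k \<subseteq> ball H q k"
      using f k by (fastforce simp: ball_def)
    show "ball H q k \<subseteq> f ` ball G p k" using ex k by blast
  qed
  have fin: "f v \<in> ball H q n \<longleftrightarrow> v \<in> ball G p n" if "v \<in> ball G p (n + 1)" for v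
    using inj_on_image_mem_iff[OF inj that, of "ball G p n"] ball_mono[of n "n + 1" G p] im[of n]
    by simp
  have adj: "{(f u, a), (f v, b)} \<in> edges H \<longleftrightarrow> {(u, a), (v, b)} \<in> edges G"
    if uv: "u \<in> ball G p (n + 1)" "v \<in> ball G p (n + 1)" for u v a b
  proof -
    obtain w w' where w: "length w \<le> n + 1" "walk G p w u" "length w' \<le> n + 1" "walk G p w' v"
      using uv by (auto simp: ball_def)
    note fw = f[OF w(1,2)] f[OF w(3,4)]
    \<comment> \<open>Adjacency is itself a \<open>Same\<close> probe: the word to \<open>u\<close>
      extended by the edge ends where the word to \<open>v\<close> ends.\<close>
    have "{(u, a), (v, b)} \<in> edges G \<longleftrightarrow> (\<exists>x. walk G p (w @ [(a, b)]) x \<and> walk G p w' x)"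
      using w walk_det[OF G(1)] unfolding walk_snoc[OF G(1)] by metis
    also have "\<dots> \<longleftrightarrow> (\<exists>x. walk H q (w @ [(a, b)]) x \<and> walk H q w' x)"
      using w by (intro same) auto
    also have "\<dots> \<longleftrightarrow> {(f u, a), (f v, b)} \<in> edges H"
      using fw walk_det[OF H(1)] unfolding walk_snoc[OF H(1)] by metis
    finally show ?thesis by simp
  qed
  have vl: "vlab H (f v) = vlab G v" if v: "v \<in> ball G p n" for v
  proof -
    obtain w where w: "length w \<le> n" "walk G p w v" using v by (auto simp: ball_def)
    have fw: "walk H q w (f v)" using f w by simp
    have "vlab G v = Some s \<longleftrightarrow> vlab H (f v) = Some s" for s
      using eq[of "VLab w s"] w fw walk_det[OF G(1)] walk_det[OF H(1)] by auto metis+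
    then show ?thesis by (metis option.exhaust)
  qed
  have el: "elab H {(f u, a), (f v, b)} = elab G {(u, a), (v, b)}"
    if uv: "u \<in> ball G p n" "v \<in> ball G p n" "{(u, a), (v, b)} \<in> edges G" for u v a b
  proof -
    obtain w where w: "length w \<le> n" "walk G p w u" using uv by (auto simp: ball_def)
    have fw: "walk H q w (f u)" using f w by simp
    have uv': "{(f u, a), (f v, b)} \<in> edges H"
      using adj[of u v a b] uv subsetD[OF ball_mono[of n "n + 1" G p]] by simp
    have "holds (G, p) (ELab (w @ [(a, b)]) d) \<longleftrightarrow> elab G {(u, a), (v, b)} = Some d" for d
      by (rule holds_ELab[OF G(1) w(2) uv(3)])
    moreover have "holds (H, q) (ELab (w @ [(a, b)]) d) \<longleftrightarrow> elab H {(f u, a), (f v, b)} = Some d" for d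
      by (rule holds_ELab[OF H(1) fw uv'])
    ultimately have "elab G {(u, a), (v, b)} = Some d \<longleftrightarrow> elab H {(f u, a), (f v, b)} = Some d" for d
      using eq[of "ELab (w @ [(a, b)]) d"] w(1) by simp
    then show ?thesis by (metis option.exhaust)
  qed
  have "is_iso f (graph_disk n G p) (graph_disk n H q)"
  proof (rule is_isoI[OF is_graph_disk[OF G] is_graph_disk[OF H]])
    show "bij_betw f (verts (graph_disk n G p)) (verts (graph_disk n H q))"
      using inj im[of "n + 1"] by (simp add: bij_betw_def)
    show "{(f u, a), (f v, b)} \<in> edges (graph_disk n H q) \<longleftrightarrow> {(u, a), (v, b)} \<in> edges (graph_disk n G p)"
      if "u \<in> verts (graph_disk n G p)" "v \<in> verts (graph_disk n G p)" for u v a b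
      using that adj im[of "n + 1"] by (auto simp: graph_disk_subgr edges_in_pair)
    show "vlab (graph_disk n H q) (f v) = vlab (graph_disk n G p) v"
      if "v \<in> verts (graph_disk n G p)" for v
      using that vl fin by (auto simp: graph_disk_subgr restrict_map_def)
    show "elab (graph_disk n H q) {(f u, a), (f v, b)} = elab (graph_disk n G p) {(u, a), (v, b)}"
      if "{(u, a), (v, b)} \<in> edges (graph_disk n G p)" for u v a b
      using that el fin adj by (auto simp: graph_disk_subgr restrict_map_def edges_in_pair)
  qed
  moreover have "f p = q"
    using f[of "[]" p] G(2) by auto
  ultimately show ?thesis by (rule disk_eqI[OF G H])
qed

text \<open>A consistent choice of truth values for all probes comes from a graph, whose vertices are
  the classes of equivalent paths.\<close>

definition limit_class :: "('s, 'd, 'p) probe set \<Rightarrow> 'p word \<Rightarrow> 'p word set" where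
  "limit_class T w = {w'. Same w w' \<in> T}"

definition limit_edge :: "('s, 'd, 'p) probe set \<Rightarrow> 'p word \<Rightarrow> ('p word set \<times> 'p) set" where
  "limit_edge T w = {(limit_class T (butlast w), fst (last w)), (limit_class T w, snd (last w))}"

text \<open>A term model. The choices by \<open>SOME\<close> are unambiguous thanks to
  \<open>VLab_cong\<close> and \<open>ELab_cong\<close>.\<close>

definition limit_graph :: "('s, 'd, 'p) probe set \<Rightarrow> ('p word set, 's, 'd, 'p) graph" where
  "limit_graph T =
     \<lparr>verts = limit_class T ` {w. Same w w \<in> T},
      edges = limit_edge T ` {w. w \<noteq> [] \<and> Same w w \<in> T},
      vlab = (\<lambda>x. if \<exists>s w. x = limit_class T w \<and> VLab w s \<in> T
        then Some (SOME s. \<exists>w. x = limit_class T w \<and> VLab w s \<in> T) else None),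
      elab = (\<lambda>e. if \<exists>d w. e = limit_edge T w \<and> ELab w d \<in> T
        then Some (SOME d. \<exists>w. e = limit_edge T w \<and> ELab w d \<in> T) else None)\<rparr>"

text \<open>\<open>T\<close> is finitely satisfiable. Any law that involves finitely many probes
  therefore holds for \<open>T\<close>: it is read off a graph agreeing with \<open>T\<close> on
  just these probes.\<close>

locale limit_theory =
  fixes \<Sigma> :: "'s set" and \<Delta> :: "'d set" and \<pi> :: "'p set" and T :: "('s, 'd, 'p) probe set"
  assumes approx: "\<And>J. finite J \<Longrightarrow> \<exists>(G :: (nat, 's, 'd, 'p) graph) p.
    graph_over \<Sigma> \<Delta> \<pi> G \<and> p \<in> verts G \<and> (\<forall>i\<in>J. holds (G, p) i \<longleftrightarrow> i \<in> T)"
begin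

abbreviation "path w \<equiv> Same w w \<in> T"

lemma approxE:
  assumes "finite J"
  obtains G :: "(nat, 's, 'd, 'p) graph" and p where "is_graph G" "p \<in> verts G"
    "graph_over \<Sigma> \<Delta> \<pi> G" "\<forall>i\<in>J. i \<in> T \<longleftrightarrow> holds (G, p) i"
  using approx[OF assms] graph_over_graph by metis

lemma path_Nil: "path []"
proof -
  obtain G :: "(nat, 's, 'd, 'p) graph" and p where "p \<in> verts G"
    "\<forall>i\<in>{Same [] []}. i \<in> T \<longleftrightarrow> holds (G, p) i"
    using approxE[of "{Same [] []}"] by blast
  then show ?thesis by simp
qed

lemma Same_sym: "Same w w' \<in> T \<Longrightarrow> Same w' w \<in> T"
  by (rule approxE[of "{Same w w', Same w' w}"]) auto

lemma Same_trans:
  assumes "Same w w' \<in> T" "Same w' w'' \<in> T"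
  shows "Same w w'' \<in> T"
proof (rule approxE[of "{Same w w', Same w' w'', Same w w''}"])
  fix G :: "(nat, 's, 'd, 'p) graph" and p
  assume G: "is_graph G" and i: "\<forall>i\<in>{Same w w', Same w' w'', Same w w''}. i \<in> T \<longleftrightarrow> holds (G, p) i"
  then obtain v v' where v: "walk G p w v" "walk G p w' v" "walk G p w' v'" "walk G p w'' v'"
    using assms by auto
  then have "v' = v" using walk_det[OF G] by metis
  with v i show ?thesis by auto
qed simp

lemma Same_path: "Same w w' \<in> T \<Longrightarrow> path w"
  using Same_sym Same_trans by blast

lemma limit_class_eq:
  assumes "path w"
  shows "limit_class T w = limit_class T w' \<longleftrightarrow> Same w w' \<in> T"
proof
  assume "limit_class T w = limit_class T w'"
  then have "w \<in> limit_class T w'" using assms by (auto simp: limit_class_def)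
  then show "Same w w' \<in> T" using Same_sym by (simp add: limit_class_def)
next
  assume "Same w w' \<in> T"
  then show "limit_class T w = limit_class T w'"
    unfolding limit_class_def using Same_sym Same_trans by blast
qed

lemma path_snocD: "path (w @ [l]) \<Longrightarrow> path w"
proof (rule approxE[of "{Same w w, Same (w @ [l]) (w @ [l])}"])
  fix G :: "(nat, 's, 'd, 'p) graph" and p
  assume "path (w @ [l])" "is_graph G"
    "\<forall>i\<in>{Same w w, Same (w @ [l]) (w @ [l])}. i \<in> T \<longleftrightarrow> holds (G, p) i"
  then show "path w" by (cases l) (auto simp: walk_snoc)
qed simp

lemma Same_snoc:
  assumes "Same w w' \<in> T" "path (w @ [l])"
  shows "Same (w @ [l]) (w' @ [l]) \<in> T"
proof (rule approxE[of "{Same w w', Same (w @ [l]) (w @ [l]), Same (w @ [l]) (w' @ [l])}"])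
  fix G :: "(nat, 's, 'd, 'p) graph" and p
  assume "is_graph G" "\<forall>i\<in>{Same w w', Same (w @ [l]) (w @ [l]), Same (w @ [l]) (w' @ [l])}. i \<in> T \<longleftrightarrow> holds (G, p) i"
  then have i: "\<exists>v. walk G p w v \<and> walk G p w' v" "\<exists>v. walk G p (w @ [l]) v"
    "Same (w @ [l]) (w' @ [l]) \<in> T \<longleftrightarrow> (\<exists>v. walk G p (w @ [l]) v \<and> walk G p (w' @ [l]) v)"
    using assms by simp_all
  obtain a b where l: "l = (a, b)" by (cases l)
  obtain u x v where u: "walk G p w u" "{(u, a), (x, b)} \<in> edges G" "walk G p w v" "walk G p w' v"
    using i(1,2) unfolding l walk_snoc[OF \<open>is_graph G\<close>] by blast
  then have "u = v" using walk_det[OF \<open>is_graph G\<close>] by metis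
  with u show ?thesis unfolding i(3) unfolding l walk_snoc[OF \<open>is_graph G\<close>] by blast
qed simp

lemma Same_port:
  assumes "Same w w' \<in> T" "path (w @ [(a, b)])" "path (w' @ [(a, b')])"
  shows "b = b'"
proof (rule approxE[of "{Same w w', Same (w @ [(a, b)]) (w @ [(a, b)]), Same (w' @ [(a, b')]) (w' @ [(a, b')])}"])
  fix G :: "(nat, 's, 'd, 'p) graph" and p
  assume G: "is_graph G" and "\<forall>i\<in>{Same w w', Same (w @ [(a, b)]) (w @ [(a, b)]),
    Same (w' @ [(a, b')]) (w' @ [(a, b')])}. i \<in> T \<longleftrightarrow> holds (G, p) i"
  then obtain v x x' where v: "walk G p w v" "walk G p w' v"
    "walk G p (w @ [(a, b)]) x" "walk G p (w' @ [(a, b')]) x'" using assms by auto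
  then obtain u u' where u: "walk G p w u" "{(u, a), (x, b)} \<in> edges G"
    "walk G p w' u'" "{(u', a), (x', b')} \<in> edges G" by (auto simp: walk_snoc[OF G])
  then have "u = v" "u' = v" using v walk_det[OF G] by metis+
  with u show "b = b'" using edge_unique[OF G] by metis
qed simp

lemma Same_back:
  assumes "path (w @ [(a, b)])"
  shows "Same (w @ [(a, b), (b, a)]) w \<in> T"
proof (rule approxE[of "{Same (w @ [(a, b)]) (w @ [(a, b)]), Same (w @ [(a, b), (b, a)]) w}"])
  fix G :: "(nat, 's, 'd, 'p) graph" and p
  assume G: "is_graph G" and i: "\<forall>i\<in>{Same (w @ [(a, b)]) (w @ [(a, b)]),
    Same (w @ [(a, b), (b, a)]) w}. i \<in> T \<longleftrightarrow> holds (G, p) i"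
  then obtain x where "walk G p (w @ [(a, b)]) x" using assms by auto
  then obtain u where u: "walk G p w u" "{(u, a), (x, b)} \<in> edges G" by (auto simp: walk_snoc[OF G])
  then have "walk G p (w @ [(a, b)]) x" "{(x, b), (u, a)} \<in> edges G"
    unfolding walk_snoc[OF G] by (auto simp: insert_commute)
  then have "walk G p ((w @ [(a, b)]) @ [(b, a)]) u"
    unfolding walk_snoc[OF G, of p "w @ [(a, b)]"] by blast
  with u(1) i show ?thesis by (simp del: walk.simps) blast
qed simp

text \<open>A port linked to itself would be a singleton edge. Loops joining two different ports of
  one vertex remain possible.\<close>

lemma no_loop:
  assumes "path (w @ [(a, b)])" "Same w (w @ [(a, b)]) \<in> T"
  shows "a \<noteq> b"
proof (rule approxE[of "{Same w (w @ [(a, b)])}"])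
  fix G :: "(nat, 's, 'd, 'p) graph" and p
  assume G: "is_graph G" and "\<forall>i\<in>{Same w (w @ [(a, b)])}. i \<in> T \<longleftrightarrow> holds (G, p) i"
  then obtain x where x: "walk G p w x" "walk G p (w @ [(a, b)]) x" using assms by auto
  then have "{(x, a), (x, b)} \<in> edges G" unfolding walk_snoc[OF G] using walk_det[OF G] by metis
  then have "card {(x, a), (x, b)} = 2" using G by (simp add: is_graph_def)
  then show "a \<noteq> b" by auto
qed simp

lemma VLabD:
  assumes "VLab w s \<in> T" shows "path w" "s \<in> \<Sigma>"
proof -
  obtain G :: "(nat, 's, 'd, 'p) graph" and p where G: "graph_over \<Sigma> \<Delta> \<pi> G"
    "\<forall>i\<in>{VLab w s, Same w w}. i \<in> T \<longleftrightarrow> holds (G, p) i"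
    using approxE[of "{VLab w s, Same w w}"] by blast
  with assms show "path w" "s \<in> \<Sigma>" by (auto simp: graph_over_def ran_def)
qed

lemma VLab_cong:
  assumes "Same w w' \<in> T" "VLab w s \<in> T"
  shows "VLab w' s' \<in> T \<longleftrightarrow> s' = s"
proof (rule approxE[of "{Same w w', VLab w s, VLab w' s'}"])
  fix G :: "(nat, 's, 'd, 'p) graph" and p
  assume G: "is_graph G"
    and "\<forall>i\<in>{Same w w', VLab w s, VLab w' s'}. i \<in> T \<longleftrightarrow> holds (G, p) i"
  then have "holds (G, p) (Same w w')" "holds (G, p) (VLab w s)"
    "VLab w' s' \<in> T \<longleftrightarrow> holds (G, p) (VLab w' s')" using assms by blast+
  then show ?thesis using walk_det[OF G] by auto (metis option.inject)+
qed simp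

lemma ELabD:
  assumes "ELab w d \<in> T" shows "path w" "w \<noteq> []" "d \<in> \<Delta>"
proof -
  obtain G :: "(nat, 's, 'd, 'p) graph" and p where G: "graph_over \<Sigma> \<Delta> \<pi> G" "is_graph G"
    "\<forall>i\<in>{ELab w d, Same w w}. i \<in> T \<longleftrightarrow> holds (G, p) i"
    using approxE[of "{ELab w d, Same w w}"] by blast
  then obtain w' a b u v where w: "w = w' @ [(a, b)]" "walk G p w' u" "{(u, a), (v, b)} \<in> edges G"
    "elab G {(u, a), (v, b)} = Some d" using assms by auto
  then have "walk G p w v" by (auto simp: walk_snoc[OF G(2)])
  with G w show "path w" "w \<noteq> []" "d \<in> \<Delta>" by (auto simp: graph_over_def ran_def)
qed

text \<open>The last edge of a word may be traversed in either direction; the two cases of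
  \<open>e\<close> are those in which both words end by the same unordered edge.\<close>

lemma ELab_cong:
  assumes d: "ELab (w @ [(a, b)]) d \<in> T" and p: "path (w' @ [(a', b')])"
    and e: "Same w w' \<in> T \<and> a = a' \<and> b = b' \<or> Same w (w' @ [(a', b')]) \<in> T \<and> a = b' \<and> b = a' "
  shows "ELab (w' @ [(a', b')]) d' \<in> T \<longleftrightarrow> d' = d"
proof (rule approxE[of "{ELab (w @ [(a, b)]) d, ELab (w' @ [(a', b')]) d', Same w w',
    Same w (w' @ [(a', b')]), Same (w' @ [(a', b')]) (w' @ [(a', b')])}"])
  fix G :: "(nat, 's, 'd, 'p) graph" and p
  assume G: "is_graph G" and i: "\<forall>i\<in>{ELab (w @ [(a, b)]) d, ELab (w' @ [(a', b')]) d', Same w w',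
    Same w (w' @ [(a', b')]), Same (w' @ [(a', b')]) (w' @ [(a', b')])}. i \<in> T \<longleftrightarrow> holds (G, p) i"
  obtain u v where u: "walk G p w u" "{(u, a), (v, b)} \<in> edges G" "elab G {(u, a), (v, b)} = Some d"
    using d i by auto
  have "holds (G, p) (Same (w' @ [(a', b')]) (w' @ [(a', b')]))" using i p by blast
  then obtain u' v' where u': "walk G p w' u'" "{(u', a'), (v', b')} \<in> edges G"
    by (auto simp: walk_snoc[OF G])
  have "{(u, a), (v, b)} = {(u', a'), (v', b')}"
    using e
  proof (elim disjE conjE)
    assume *: "Same w w' \<in> T" "a = a'" "b = b'"
    then have "u = u'" using i u(1) u'(1) walk_det[OF G] by (auto; metis)
    then show ?thesis using * u(2) u'(2) edge_unique[OF G] by metis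
  next
    assume *: "Same w (w' @ [(a', b')]) \<in> T" "a = b'" "b = a'"
    have "walk G p (w' @ [(a', b')]) v'" unfolding walk_snoc[OF G] using u' by blast
    then have "u = v'" using i *(1) u(1) walk_det[OF G] by (auto; metis)
    moreover have "{(v', b'), (u', a')} \<in> edges G" using u'(2) by (simp add: insert_commute)
    moreover have "{(v', b'), (v, a')} \<in> edges G" using u(2) \<open>u = v'\<close> *(2,3) by simp
    ultimately have "u' = v" using edge_unique[OF G] by metis
    then show ?thesis unfolding *(2,3) \<open>u = v'\<close> by (simp only: insert_commute)
  qed
  moreover have "ELab (w' @ [(a', b')]) d' \<in> T \<longleftrightarrow> elab G {(u', a'), (v', b')} = Some d'"
    using i holds_ELab[OF G u'] by simp
  ultimately show ?thesis using u(3) by auto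
qed simp

lemma limit_edge_snoc [simp]:
  "limit_edge T (w @ [(a, b)]) = {(limit_class T w, a), (limit_class T (w @ [(a, b)]), b)}"
  by (simp add: limit_edge_def)

lemma limit_edges:
  "e \<in> edges (limit_graph T) \<longleftrightarrow> (\<exists>w a b. path (w @ [(a, b)]) \<and> e = limit_edge T (w @ [(a, b)]))"
proof -
  have "w \<noteq> [] \<longleftrightarrow> (\<exists>w' a b. w = w' @ [(a, b)])" for w :: "'p word"
    by (cases w rule: rev_cases) auto
  then show ?thesis unfolding limit_graph_def by (simp add: image_iff del: limit_edge_snoc) blast
qed

lemma limit_edge_eqD:
  assumes "path w" "{(limit_class T w, a), (y, b)} = limit_edge T (w' @ [(a', b')])" "path (w' @ [(a', b')])"
  shows "path (w @ [(a, b)])" "y = limit_class T (w @ [(a, b)])"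
    "Same w w' \<in> T \<and> a = a' \<and> b = b' \<or> Same w (w' @ [(a', b')]) \<in> T \<and> a = b' \<and> b = a'"
proof -
  from assms(2) consider "limit_class T w = limit_class T w'" "a = a'" "b = b'" "y = limit_class T (w' @ [(a', b')])"
    | "limit_class T w = limit_class T (w' @ [(a', b')])" "a = b'" "b = a'" "y = limit_class T w'"
    by (auto simp: doubleton_eq_iff)
  then have "path (w @ [(a, b)]) \<and> y = limit_class T (w @ [(a, b)]) \<and>
    (Same w w' \<in> T \<and> a = a' \<and> b = b' \<or> Same w (w' @ [(a', b')]) \<in> T \<and> a = b' \<and> b = a')"
  proof cases
    case 1
    then have s: "Same w w' \<in> T" using limit_class_eq[OF assms(1)] by simp
    then have "Same (w' @ [(a, b)]) (w @ [(a, b)]) \<in> T"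
      using Same_snoc[OF Same_sym] assms(3) 1 by simp
    then show ?thesis using 1 s limit_class_eq[OF assms(3)] Same_path Same_sym by metis
  next
    case 2
    then have s: "Same w (w' @ [(a', b')]) \<in> T" using limit_class_eq[OF assms(1)] by simp
    \<comment> \<open>The edge is traversed backwards here, so the letter undoing it leads back to
      the class of \<open>w'\<close>.\<close>
    have b: "Same ((w' @ [(a', b')]) @ [(b', a')]) w' \<in> T" using Same_back[OF assms(3)] by simp
    have "Same ((w' @ [(a', b')]) @ [(b', a')]) (w @ [(b', a')]) \<in> T"
      by (rule Same_snoc[OF Same_sym[OF s] Same_path[OF b]])
    then have "Same (w @ [(b', a')]) w' \<in> T" using b Same_sym Same_trans by metis
    then show ?thesis using 2 s limit_class_eq Same_path by metis
  qed
  then show "path (w @ [(a, b)])" "y = limit_class T (w @ [(a, b)])"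
    "Same w w' \<in> T \<and> a = a' \<and> b = b' \<or> Same w (w' @ [(a', b')]) \<in> T \<and> a = b' \<and> b = a'" by blast+
qed

lemma limit_adj:
  assumes "path w"
  shows "{(limit_class T w, a), (y, b)} \<in> edges (limit_graph T) \<longleftrightarrow>
    path (w @ [(a, b)]) \<and> y = limit_class T (w @ [(a, b)])"
  using limit_edge_eqD[OF assms] unfolding limit_edges by (metis limit_edge_snoc)

lemma limit_verts: "x \<in> verts (limit_graph T) \<longleftrightarrow> (\<exists>w. path w \<and> x = limit_class T w)"
  by (auto simp: limit_graph_def)

lemma walk_limit: "path w \<Longrightarrow> walk (limit_graph T) (limit_class T w) w' x \<longleftrightarrow>
  path (w @ w') \<and> x = limit_class T (w @ w')"
proof (induction w' arbitrary: w)
  case Nil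
  then show ?case by (auto simp: limit_verts)
next
  case (Cons l w')
  obtain a b where l: "l = (a, b)" by (cases l)
  have pre: "path (w @ w') \<Longrightarrow> path w" for w w'
    by (induction w' rule: rev_induct) (use path_snocD in \<open>force simp flip: append_assoc\<close>)+
  have "walk (limit_graph T) (limit_class T w) (l # w') x \<longleftrightarrow> path (w @ [l]) \<and>
    walk (limit_graph T) (limit_class T (w @ [l])) w' x"
    using limit_adj[OF Cons.prems] by (auto simp: l)
  also have "\<dots> \<longleftrightarrow> path (w @ [l]) \<and> path ((w @ [l]) @ w') \<and> x = limit_class T ((w @ [l]) @ w')"
    using Cons.IH[of "w @ [l]"] by blast
  also have "\<dots> \<longleftrightarrow> path (w @ l # w') \<and> x = limit_class T (w @ l # w')"
    using pre[of "w @ [l]" w'] by auto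
  finally show ?case .
qed

lemma vlab_limit:
  assumes "path w"
  shows "vlab (limit_graph T) (limit_class T w) = Some s \<longleftrightarrow> VLab w s \<in> T"
proof -
  have key: "(\<exists>w'. limit_class T w = limit_class T w' \<and> VLab w' s \<in> T) \<longleftrightarrow> VLab w s \<in> T" for s
    using limit_class_eq[OF assms] VLab_cong VLabD Same_sym by metis
  have u: "VLab w s \<in> T \<Longrightarrow> VLab w s' \<in> T \<Longrightarrow> s = s'" for s s'
    using VLab_cong[OF assms] by blast
  have "(SOME s. VLab w s \<in> T) = s" if "VLab w s \<in> T" for s
    using that u by (metis someI)
  then show ?thesis unfolding limit_graph_def by (auto simp: key)
qed

lemma elab_limit:
  assumes "path (w @ [(a, b)])"
  shows "elab (limit_graph T) (limit_edge T (w @ [(a, b)])) = Some d \<longleftrightarrow> ELab (w @ [(a, b)]) d \<in> T"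
proof -
  have pw: "path w" using path_snocD[OF assms] .
  have key: "(\<exists>w'. limit_edge T (w @ [(a, b)]) = limit_edge T w' \<and> ELab w' d \<in> T) \<longleftrightarrow>
    ELab (w @ [(a, b)]) d \<in> T" for d
  proof
    assume "\<exists>w'. limit_edge T (w @ [(a, b)]) = limit_edge T w' \<and> ELab w' d \<in> T"
    then obtain w' where w': "limit_edge T (w @ [(a, b)]) = limit_edge T w'" "ELab w' d \<in> T" by blast
    obtain v a' b' where v: "w' = v @ [(a', b')]"
      using ELabD(2)[OF w'(2)] by (cases w' rule: rev_cases) auto
    have pv: "path (v @ [(a', b')])" using ELabD(1)[OF w'(2)] v by simp
    have "Same v w \<in> T \<and> a' = a \<and> b' = b \<or> Same v (w @ [(a, b)]) \<in> T \<and> a' = b \<and> b' = a"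
      by (rule limit_edge_eqD(3)[OF path_snocD[OF pv] _ assms]) (use w'(1) v in simp)
    from ELab_cong[OF _ assms this] w'(2) v show "ELab (w @ [(a, b)]) d \<in> T" by blast
  qed blast
  have "ELab (w @ [(a, b)]) d \<in> T \<Longrightarrow> ELab (w @ [(a, b)]) d' \<in> T \<Longrightarrow> d = d'" for d d'
    using ELab_cong[OF _ assms, of w a b] pw by blast
  then have "(SOME d. ELab (w @ [(a, b)]) d \<in> T) = d" if "ELab (w @ [(a, b)]) d \<in> T" for d
    using that by (metis someI)
  then show ?thesis unfolding limit_graph_def by (auto simp: key simp del: limit_edge_snoc)
qed

text \<open>The local axioms follow from finite satisfiability. Countability comes from that of the
  set of words, and connectivity from the fact that every vertex is the end of a path starting at
  the class of \<open>[]\<close>.\<close>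

lemma graph_over_limit:
  assumes "countable (lists (\<pi> \<times> \<pi>))"
  shows "graph_over \<Sigma> \<Delta> \<pi> (limit_graph T)"
proof -
  let ?L = "limit_graph T"
  have W: "w \<in> lists (\<pi> \<times> \<pi>)" if "path w" for w
  proof (rule approxE[of "{Same w w}"])
    fix G :: "(nat, 's, 'd, 'p) graph" and p
    assume "is_graph G" "graph_over \<Sigma> \<Delta> \<pi> G" "\<forall>i\<in>{Same w w}. i \<in> T \<longleftrightarrow> holds (G, p) i"
    with that show ?thesis using walk_ports[of G \<pi> p w] by (auto simp: graph_over_def)
  qed simp
  have "is_graph ?L"
  proof (rule is_graphI)
    show "verts ?L \<noteq> {}" using path_Nil limit_verts by blast
    have "verts ?L \<subseteq> limit_class T ` lists (\<pi> \<times> \<pi>)"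
      using W by (auto simp: limit_graph_def)
    from countable_subset[OF this countable_image[OF assms]] show "countable (verts ?L)" .
    show "\<exists>u a v b. e = {(u, a), (v, b)} \<and> (u, a) \<noteq> (v, b) \<and> u \<in> verts ?L \<and> v \<in> verts ?L"
      if e: "e \<in> edges ?L" for e
    proof -
      obtain w a b where w: "path (w @ [(a, b)])" "e = limit_edge T (w @ [(a, b)])"
        using e limit_edges by blast
      have "(limit_class T w, a) \<noteq> (limit_class T (w @ [(a, b)]), b)"
        using no_loop[OF w(1)] limit_class_eq[OF path_snocD[OF w(1)]] by auto
      then show ?thesis using w path_snocD[OF w(1)] limit_verts
        by (metis limit_edge_snoc)
    qed
    show "v = v' \<and> b = b'"
      if e: "{(u, a), (v, b)} \<in> edges ?L" "{(u, a), (v', b')} \<in> edges ?L" for u a v b v' b'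
    proof -
      have "u \<in> verts ?L"
        using e(1) path_snocD unfolding limit_edges limit_verts
        by (auto simp: doubleton_eq_iff)
      then obtain w where w: "path w" "u = limit_class T w" using limit_verts by blast
      with e have "path (w @ [(a, b)])" "path (w @ [(a, b')])"
        "v = limit_class T (w @ [(a, b)])" "v' = limit_class T (w @ [(a, b')])"
        by (simp_all add: limit_adj)
      with Same_port[OF w(1)] show ?thesis by blast
    qed
    show "dom (vlab ?L) \<subseteq> verts ?L"
      using VLabD(1) by (auto simp: limit_graph_def split: if_splits)
    show "dom (elab ?L) \<subseteq> edges ?L"
      using ELabD(1,2) by (auto simp: limit_graph_def split: if_splits)
    show "\<exists>w. walk ?L x w y" if xy: "x \<in> verts ?L" "y \<in> verts ?L" for x y
    proof -
      obtain w w' where w: "path w" "x = limit_class T w" "path w'" "y = limit_class T w'"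
        using xy unfolding limit_verts by auto
      \<comment> \<open>All prefixes of a path are paths by \<open>path_snocD\<close>, so the word
        can be undone letter by letter.\<close>
      have to_Nil: "walk ?L (limit_class T v) (rev_word v) (limit_class T [])" if "path v" for v
        using that
      proof (induction v rule: rev_induct)
        case Nil
        then show ?case by (auto simp: rev_word_def limit_verts)
      next
        case (snoc l v)
        obtain a b where l: "l = (a, b)" by (cases l)
        have pv: "path v" using path_snocD[OF snoc.prems] .
        have "{(limit_class T v, a), (limit_class T (v @ [(a, b)]), b)} \<in> edges ?L"
          using limit_adj[OF pv] snoc.prems l by simp
        with snoc.IH[OF pv] have "walk ?L (limit_class T (v @ [(a, b)])) ((b, a) # rev_word v) (limit_class T [])"
          by (auto simp: insert_commute)
        then show ?case by (simp add: l rev_word_def)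
      qed
      have "walk ?L (limit_class T []) w' y" using walk_limit[OF path_Nil] w by simp
      from walk_appendI[OF to_Nil[OF w(1)] this] show ?thesis unfolding w(2) ..
    qed
  qed
  moreover have "snd ` e \<subseteq> \<pi>" if e: "e \<in> edges ?L" for e
  proof -
    obtain w a b where "path (w @ [(a, b)])" "e = limit_edge T (w @ [(a, b)])"
      using e limit_edges by blast
    then show ?thesis using W[of "w @ [(a, b)]"] by auto
  qed
  moreover have "ran (vlab ?L) \<subseteq> \<Sigma>"
  proof
    fix s assume "s \<in> ran (vlab ?L)"
    then obtain x where x: "vlab ?L x = Some s" by (auto simp: ran_def)
    then obtain w where "x = limit_class T w" "path w"
      using VLabD(1) by (auto simp: limit_graph_def split: if_splits)
    then show "s \<in> \<Sigma>" using x vlab_limit VLabD(2) by blast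
  qed
  moreover have "ran (elab ?L) \<subseteq> \<Delta>"
  proof
    fix d assume "d \<in> ran (elab ?L)"
    then obtain e where x: "elab ?L e = Some d" by (auto simp: ran_def)
    then obtain w where w: "e = limit_edge T w" "path w" "w \<noteq> []"
      using ELabD(1,2) by (auto simp: limit_graph_def split: if_splits)
    then obtain w' a b where "w = w' @ [(a, b)]" by (cases w rule: rev_cases) auto
    then show "d \<in> \<Delta>" using x w elab_limit ELabD(3) by blast
  qed
  ultimately show ?thesis by (simp add: graph_over_def)
qed

text \<open>The truth lemma of the term model: reading \<open>w\<close> from the class of
  \<open>[]\<close> succeeds exactly for paths and ends in the class of \<open>w\<close>.\<close>

lemma holds_limit: "holds (limit_graph T, limit_class T []) i \<longleftrightarrow> i \<in> T"
proof -
  have w: "walk (limit_graph T) (limit_class T []) w x \<longleftrightarrow> path w \<and> x = limit_class T w" for w x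
    using walk_limit[OF path_Nil, of w x] by simp
  show ?thesis
  proof (cases i)
    case (Same w w')
    then show ?thesis using limit_class_eq Same_path Same_sym by (auto simp: w; metis)
  next
    case (VLab v s)
    then show ?thesis using vlab_limit VLabD(1) by (auto simp: w)
  next
    case (ELab v d)
    have "holds (limit_graph T, limit_class T []) i \<longleftrightarrow>
      (\<exists>w' a b. v = w' @ [(a, b)] \<and> path (w' @ [(a, b)]) \<and> elab (limit_graph T) (limit_edge T (w' @ [(a, b)])) = Some d)"
      unfolding ELab using limit_adj path_snocD by (auto simp: w)
    also have "\<dots> \<longleftrightarrow> (\<exists>w' a b. v = w' @ [(a, b)]) \<and> ELab v d \<in> T"
      using elab_limit ELabD(1) by blast
    also have "\<dots> \<longleftrightarrow> i \<in> T"
      using ELabD(2)[of v d] by (cases v rule: rev_cases) (auto simp: ELab)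
    finally show ?thesis .
  qed
qed

end

text \<open>A set is bad if no single \<open>k\<close> works on it. If the whole space were bad,
  branching on the probes would give a limit graph all of whose finite approximations form bad sets.
  Yet \<open>loc\<close> at the limit graph provides one \<open>k\<close> for all graphs with the
  same disk, and finitely many probes fix that disk.\<close>

lemma pgms_compact:
  fixes \<Sigma> :: "'s set" and \<Delta> :: "'d set" and \<pi> :: "'p set"
    and Q :: "nat \<Rightarrow> ('s, 'd, 'p) pgm \<Rightarrow> bool"
  assumes fin: "finite \<Sigma>" "finite \<Delta>" "finite \<pi>"
    and mono: "\<And>k k' Z. Q k Z \<Longrightarrow> k \<le> k' \<Longrightarrow> Q k' Z"
    and loc: "\<And>X. X \<in> pgms \<Sigma> \<Delta> \<pi> \<Longrightarrow> \<exists>n k. \<forall>Z\<in>pgms \<Sigma> \<Delta> \<pi>. disk n Z = disk n X \<longrightarrow> Q k Z"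
  shows "\<exists>k. \<forall>Z\<in>pgms \<Sigma> \<Delta> \<pi>. Q k Z"
proof (rule ccontr)
  assume neg: "\<not> ?thesis"
  define S where "S = {(G :: (nat, 's, 'd, 'p) graph, p). graph_over \<Sigma> \<Delta> \<pi> G \<and> p \<in> verts G}"
  define bad where "bad A \<longleftrightarrow> \<not> (\<exists>k. \<forall>x\<in>A. Q k (pgm_of x))" for A :: "(nat, 's, 'd, 'p) pgraph set"
  obtain T where T: "T \<subseteq> probes \<Sigma> \<Delta> \<pi>"
    "\<And>J. finite J \<Longrightarrow> J \<subseteq> probes \<Sigma> \<Delta> \<pi> \<Longrightarrow> bad {x \<in> S. \<forall>i\<in>J. holds x i \<longleftrightarrow> i \<in> T}"
  proof (rule binary_branch_countable[OF countable_probes[OF fin], of bad S "\<lambda>i x. holds x i"])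
    show "bad S"
    proof -
      have "pgms \<Sigma> \<Delta> \<pi> = pgm_of ` S" by (force simp: pgms_def S_def)
      then show ?thesis using neg by (auto simp: bad_def)
    qed
    show "bad A \<or> bad B" if "bad (A \<union> B)" for A B
    proof (rule ccontr)
      assume "\<not> (bad A \<or> bad B)"
      then obtain k l where "\<forall>x\<in>A. Q k (pgm_of x)" "\<forall>x\<in>B. Q l (pgm_of x)" by (auto simp: bad_def)
      then have "\<forall>x\<in>A \<union> B. Q (max k l) (pgm_of x)" using mono by (meson Un_iff max.cobounded1 max.cobounded2)
      with that show False by (auto simp: bad_def)
    qed
    show "bad B" if "bad A" "A \<subseteq> B" for A B using that by (auto simp: bad_def)
  qed blast
  have fromT: "bad {x \<in> S. \<forall>i\<in>J. holds x i \<longleftrightarrow> i \<in> T}" if "finite J" for J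
  proof -
    have "{x \<in> S. \<forall>i\<in>J. holds x i \<longleftrightarrow> i \<in> T} = {x \<in> S. \<forall>i\<in>J \<inter> probes \<Sigma> \<Delta> \<pi>. holds x i \<longleftrightarrow> i \<in> T}"
      using holds_probes T(1) by (fastforce simp: S_def)
    with T(2)[of "J \<inter> probes \<Sigma> \<Delta> \<pi>"] that show ?thesis by simp
  qed
  interpret limit_theory \<Sigma> \<Delta> \<pi> T
  proof
    fix J :: "('s, 'd, 'p) probe set" assume "finite J"
    from fromT[OF this] have "{x \<in> S. \<forall>i\<in>J. holds x i \<longleftrightarrow> i \<in> T} \<noteq> {}"
      unfolding bad_def by blast
    then show "\<exists>(G :: (nat, 's, 'd, 'p) graph) p. graph_over \<Sigma> \<Delta> \<pi> G \<and> p \<in> verts G \<and>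
      (\<forall>i\<in>J. holds (G, p) i \<longleftrightarrow> i \<in> T)" by (auto simp: S_def)
  qed
  have L: "graph_over \<Sigma> \<Delta> \<pi> (limit_graph T)"
    using fin(3) by (intro graph_over_limit countable_lists countable_finite) simp
  note gL = graph_over_graph[OF L]
  have p: "limit_class T [] \<in> verts (limit_graph T)" using path_Nil limit_verts by blast
  obtain n k where nk: "\<And>Z. Z \<in> pgms \<Sigma> \<Delta> \<pi> \<Longrightarrow>
      disk n Z = disk n (pgm_of (limit_graph T, limit_class T [])) \<Longrightarrow> Q k Z"
    using loc[OF pgm_of_in_pgms[OF L p]] by blast
  \<comment> \<open>These finitely many probes determine the disk of radius \<open>n\<close> by
    \<open>holds_disk_eq\<close>.\<close>
  let ?J = "{i \<in> probes \<Sigma> \<Delta> \<pi>. probe_len i \<le> n + 2}"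
  have "Q k (pgm_of x)" if x: "x \<in> S" "\<forall>i\<in>?J. holds x i \<longleftrightarrow> i \<in> T" for x
  proof -
    obtain G p' where G: "x = (G, p')" "graph_over \<Sigma> \<Delta> \<pi> G" "p' \<in> verts G" using x(1) by (auto simp: S_def)
    have "disk n (pgm_of (G, p')) = disk n (pgm_of (limit_graph T, limit_class T []))"
    proof (rule holds_disk_eq[OF graph_over_graph[OF G(2)] G(3) gL p])
      fix i :: "('s, 'd, 'p) probe" assume "probe_len i \<le> n + 2"
      then show "holds (G, p') i \<longleftrightarrow> holds (limit_graph T, limit_class T []) i"
        using x(2) G(1) T(1) holds_probes[OF G(2), of p' i] unfolding holds_limit by blast
    qed
    then show ?thesis using nk pgm_of_in_pgms[OF G(2,3)] G(1) by blast
  qed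
  with fromT[OF finite_probes[OF fin, of "n + 2"]] show False by (auto simp: bad_def)
qed

section \<open>The induced anonymous dynamics\<close>

text \<open>Expresses the data compared by continuity through a concrete vertex map. It serves both
  the given dynamics, with \<open>rho\<close>, and the induced one, with
  \<open>vis_rho\<close>.\<close>

lemma restr_rep:
  assumes A: "is_graph A" "p \<in> verts A" and B: "is_graph B" "q \<in> verts B"
    and F: "F (pgm_of (A, p)) = pgm_of (B, q)"
    and R: "\<forall>v\<in>verts A. R (pgm_of (A, p)) (cls A p v) = cls B q (\<rho> v)"
  shows "dom_restr F R m (pgm_of (A, p)) = cls A p ` {v \<in> verts A. \<rho> v \<in> ball B q (m + 1)}"
    and "restr F R m n (pgm_of (A, p)) =
      (\<lambda>v. (cls (graph_disk n A p) p v, cls (graph_disk m B q) q (\<rho> v))) `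
        {v \<in> verts A. \<rho> v \<in> ball B q (m + 1)}"
proof -
  show 1: "dom_restr F R m (pgm_of (A, p)) = cls A p ` {v \<in> verts A. \<rho> v \<in> ball B q (m + 1)}"
  proof -
    have "in_disk m (pgm_of (B, q)) (R (pgm_of (A, p)) (cls A p v)) \<noteq> {} \<longleftrightarrow> \<rho> v \<in> ball B q (m + 1)"
      if "v \<in> verts A" for v
      unfolding R[rule_format, OF that] in_disk_pgm_of[OF B] by (rule cls_graph_disk_ne[OF B])
    then show ?thesis unfolding dom_restr_def V_pgm_of[OF A] F by blast
  qed
  show "restr F R m n (pgm_of (A, p)) =
      (\<lambda>v. (cls (graph_disk n A p) p v, cls (graph_disk m B q) q (\<rho> v))) `
        {v \<in> verts A. \<rho> v \<in> ball B q (m + 1)}"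
    unfolding restr_def 1 image_image F
    by (rule image_cong) (simp_all add: R[rule_format] in_disk_pgm_of[OF A] in_disk_pgm_of[OF B])
qed

text \<open>Distances from the centre up to \<open>M + 1\<close> are the same in the disk as in the
  whole graph, and an isomorphism preserves them.\<close>

lemma disk_iso_mem_ball:
  assumes "is_graph A" "is_graph A'" "y \<in> verts A" "g y \<in> verts A'"
    and g: "is_iso g (graph_disk M A y) (graph_disk M A' (g y))"
    and z: "z \<in> ball A y (M + 1)" "k \<le> M + 1"
  shows "g z \<in> ball A' (g y) k \<longleftrightarrow> z \<in> ball A y k"
proof -
  have y: "y \<in> verts (graph_disk M A y)" using ball_self[OF assms(3)] by simp
  have "ball (graph_disk M A' (g y)) (g y) k = g ` ball (graph_disk M A y) y k"
    by (rule is_iso_ball[OF is_graph_disk[OF assms(1,3)] is_graph_disk[OF assms(2,4)] g y])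
  then have "ball A' (g y) k = g ` ball A y k"
    using ball_graph_disk z(2) assms by metis
  then show ?thesis
    using inj_on_image_mem_iff[OF is_iso_inj[OF g]] z ball_mono[OF z(2), of A y] by simp
qed

locale imcgd = invisible_matter \<Sigma> \<Delta> \<pi> mm pm pl pr
  for \<Sigma> :: "'s set" and \<Delta> :: "'d set" and \<pi> :: "'p set" and mm :: 's and pm pl pr :: 'p +
  fixes F :: "('s, 'd, 'p) dyn" and R :: "('s, 'd, 'p) vmap"
  assumes fin: "finite \<Sigma>" "finite \<Delta>" "finite \<pi>"
    and IM: "IMCGD \<Sigma> \<Delta> \<pi> mm pm pl pr F R"
begin

abbreviation "\<Y> \<equiv> impgms \<Sigma> \<Delta> \<pi> mm pm pl pr"

abbreviation "\<X> \<equiv> pgms \<Sigma> \<Delta> \<pi>"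

text \<open>Shift invariance allows to follow all pointers of a graph simultaneously: the dynamics turns
  the graph \<open>att G\<close> into \<open>att H\<close> and maps its vertices by \<open>\<rho>\<close>.\<close>

definition evolves ::
  "(nat, 's, 'd, 'p) graph \<Rightarrow> (nat, 's, 'd, 'p) graph \<Rightarrow> (nat xv \<Rightarrow> nat xv) \<Rightarrow> bool" where
  "evolves G H \<rho> \<longleftrightarrow> over H \<and> bij_betw \<rho> (verts (att G)) (verts (att H)) \<and>
     (\<forall>u\<in>verts (att G). F (pgm_of (att G, u)) = pgm_of (att H, \<rho> u) \<and>
       (\<forall>v\<in>verts (att G). R (pgm_of (att G, u)) (cls (att G) u v) = cls (att H) (\<rho> u) (\<rho> v)))"

text \<open>\<open>\<rho>\<close> is read off \<open>R\<close> at one fixed pointer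
  \<open>x0\<close>. The first shift equation gives \<open>F\<close> at the other pointers, the
  second shows that \<open>R\<close> there is given by the same \<open>\<rho>\<close>, and vertex
  preservation makes it bijective because \<open>cls\<close> from a fixed pointer is
  injective.\<close>

lemma evolves_ex:
  assumes G: "over G"
  shows "\<exists>H \<rho>. evolves G H \<rho>"
proof -
  let ?A = "att G"
  have dyn: "F Y \<in> \<Y>" "v \<in> V Y \<Longrightarrow> R Y v \<in> V (F Y)" "bij_betw (R Y) (V Y) (V (F Y))"
    and shift: "u \<in> V Y \<Longrightarrow> F (repoint Y u) = repoint (F Y) (R Y u)"
      "u \<in> V Y \<Longrightarrow> v \<in> V (repoint Y u) \<Longrightarrow> R Y (vcat Y u v) = vcat (F Y) (R Y u) (R (repoint Y u) v)"
    if "Y \<in> \<Y>" for Y u v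
    using IM that by (auto simp: IMCGD_def CGD_def dynamics_def shift_invariant_def vertex_preserving_def)
  have A: "is_graph ?A" by (rule is_graph_att[OF G])
  obtain x0 where x0: "x0 \<in> verts ?A" using A by (auto simp: is_graph_def)
  let ?Y = "pgm_of (?A, x0)"
  have Y: "pgm_of (?A, u) \<in> \<Y>" if "u \<in> verts ?A" for u
    using that G impgms_iff by blast
  obtain H :: "(nat, 's, 'd, 'p) graph" and y where H: "over H" "y \<in> verts (att H)" "F ?Y = pgm_of (att H, y)"
    using dyn(1)[OF Y[OF x0]] impgms_iff by blast
  have B: "is_graph (att H)" by (rule is_graph_att[OF H(1)])
  have VA: "V ?Y = cls ?A x0 ` verts ?A" by (rule V_pgm_of[OF A x0])
  have VB: "V (F ?Y) = cls (att H) y ` verts (att H)" unfolding H(3) by (rule V_pgm_of[OF B H(2)])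
  have "\<forall>v\<in>verts ?A. \<exists>z\<in>verts (att H). R ?Y (cls ?A x0 v) = cls (att H) y z"
    using dyn(2)[OF Y[OF x0]] unfolding VA VB by blast
  then obtain \<rho> where \<rho>: "\<And>v. v \<in> verts ?A \<Longrightarrow> \<rho> v \<in> verts (att H)"
    "\<And>v. v \<in> verts ?A \<Longrightarrow> R ?Y (cls ?A x0 v) = cls (att H) y (\<rho> v)" by metis
  have F: "F (pgm_of (?A, u)) = pgm_of (att H, \<rho> u)" if u: "u \<in> verts ?A" for u
    using shift(1)[OF Y[OF x0], of "cls ?A x0 u"] u
    by (simp add: VA H(3) \<rho> repoint_pgm_of[OF A x0] repoint_pgm_of[OF B H(2)])
  have R: "R (pgm_of (?A, u)) (cls ?A u v) = cls (att H) (\<rho> u) (\<rho> v)"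
    if u: "u \<in> verts ?A" and v: "v \<in> verts ?A" for u v
  proof -
    have VAu: "V (pgm_of (?A, u)) = cls ?A u ` verts ?A" by (rule V_pgm_of[OF A u])
    obtain z where z: "z \<in> verts (att H)" "R (pgm_of (?A, u)) (cls ?A u v) = cls (att H) (\<rho> u) z"
      using dyn(2)[OF Y[OF u], of "cls ?A u v"] v
      unfolding VAu F[OF u] V_pgm_of[OF B \<rho>(1)[OF u]] by blast
    have rp: "repoint ?Y (cls ?A x0 u) = pgm_of (?A, u)" by (rule repoint_pgm_of[OF A x0 u])
    have "R ?Y (vcat ?Y (cls ?A x0 u) (cls ?A u v)) =
      vcat (F ?Y) (R ?Y (cls ?A x0 u)) (R (pgm_of (?A, u)) (cls ?A u v))"
      using shift(2)[OF Y[OF x0], of "cls ?A x0 u" "cls ?A u v"] u v by (simp add: VA rp VAu)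
    also have "vcat ?Y (cls ?A x0 u) (cls ?A u v) = cls ?A x0 v"
      by (rule vcat_pgm_of[OF A x0 u v order_refl cls_ne[OF A u v]])
    also have "vcat (F ?Y) (R ?Y (cls ?A x0 u)) (R (pgm_of (?A, u)) (cls ?A u v)) = cls (att H) y z"
      unfolding H(3) \<rho>(2)[OF u] z(2)
      by (rule vcat_pgm_of[OF B H(2) \<rho>(1)[OF u] z(1) order_refl cls_ne[OF B \<rho>(1)[OF u] z(1)]])
    \<comment> \<open>Both \<open>z\<close> and \<open>\<rho> v\<close> are now designated from the
      same pointer \<open>y\<close>, hence comparable.\<close>
    finally have "cls (att H) y z = cls (att H) y (\<rho> v)" using \<rho>(2)[OF v] by simp
    then have "z = \<rho> v" by (rule cls_inj[OF B H(2) z(1)])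
    then show ?thesis using z(2) by simp
  qed
  have "bij_betw \<rho> (verts ?A) (verts (att H))"
    unfolding bij_betw_def
  proof
    have bR: "bij_betw (R ?Y) (cls ?A x0 ` verts ?A) (cls (att H) y ` verts (att H))"
      using dyn(3)[OF Y[OF x0]] unfolding VA VB .
    show "inj_on \<rho> (verts ?A)"
    proof (rule inj_onI)
      fix u v assume uv: "u \<in> verts ?A" "v \<in> verts ?A" "\<rho> u = \<rho> v"
      then have "R ?Y (cls ?A x0 u) = R ?Y (cls ?A x0 v)" by (simp add: \<rho>)
      then have "cls ?A x0 u = cls ?A x0 v"
        using bR uv unfolding bij_betw_def by (auto dest: inj_onD)
      then show "u = v" by (rule cls_inj[OF A x0 uv(1)])
    qed
    show "\<rho> ` verts ?A = verts (att H)"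
    proof
      show "verts (att H) \<subseteq> \<rho> ` verts ?A"
      proof
        fix z assume z: "z \<in> verts (att H)"
        then have "cls (att H) y z \<in> R ?Y ` cls ?A x0 ` verts ?A" using bR by (simp add: bij_betw_def)
        then obtain v where v: "v \<in> verts ?A" "cls (att H) y z = R ?Y (cls ?A x0 v)" by blast
        then have "cls (att H) y z = cls (att H) y (\<rho> v)" by (simp add: \<rho>)
        from cls_inj[OF B H(2) z this] v show "z \<in> \<rho> ` verts ?A" by blast
      qed
    qed (use \<rho>(1) in blast)
  qed
  then show ?thesis unfolding evolves_def using H(1) F R by blast
qed

text \<open>An arbitrary choice for each concrete graph; \<open>nxt_iso\<close> shows that
  isomorphic graphs receive compatible choices.\<close>

definition evol :: "(nat, 's, 'd, 'p) graph \<Rightarrow> (nat, 's, 'd, 'p) graph \<times> (nat xv \<Rightarrow> nat xv)" where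
  "evol G = (SOME (H, \<rho>). evolves G H \<rho>)"

abbreviation nxt :: "(nat, 's, 'd, 'p) graph \<Rightarrow> (nat, 's, 'd, 'p) graph" where
  "nxt G \<equiv> fst (evol G)"

abbreviation rho :: "(nat, 's, 'd, 'p) graph \<Rightarrow> nat xv \<Rightarrow> nat xv" where
  "rho G \<equiv> snd (evol G)"

definition vis_rho :: "(nat, 's, 'd, 'p) graph \<Rightarrow> nat \<Rightarrow> nat" where
  "vis_rho G v = root (rho G (Vis v))"

lemma evolves_evol: "over G \<Longrightarrow> evolves G (nxt G) (rho G)"
  using evolves_ex[of G] unfolding evol_def by (metis (mono_tags, lifting) case_prod_beta fst_conv snd_conv someI)

lemma
  assumes "over G"
  shows over_nxt: "over (nxt G)"
    and rho_bij: "bij_betw (rho G) (verts (att G)) (verts (att (nxt G)))"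
    and F_att: "\<And>u. u \<in> verts (att G) \<Longrightarrow> F (pgm_of (att G, u)) = pgm_of (att (nxt G), rho G u)"
    and R_att: "\<And>u v. u \<in> verts (att G) \<Longrightarrow> v \<in> verts (att G) \<Longrightarrow>
      R (pgm_of (att G, u)) (cls (att G) u v) = cls (att (nxt G)) (rho G u) (rho G v)"
  using evolves_evol[OF assms] by (auto simp: evolves_def)

lemma R_att_all: "over G \<Longrightarrow> u \<in> verts (att G) \<Longrightarrow> \<forall>v\<in>verts (att G).
    R (pgm_of (att G, u)) (cls (att G) u v) = cls (att (nxt G)) (rho G u) (rho G v)"
  using R_att by blast

lemma rho_verts: "over G \<Longrightarrow> u \<in> verts (att G) \<Longrightarrow> rho G u \<in> verts (att (nxt G))"
  using rho_bij by (auto simp: bij_betw_def)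

lemma vis_rho_verts: "over G \<Longrightarrow> v \<in> verts G \<Longrightarrow> vis_rho G v \<in> verts (nxt G)"
  using rho_verts[of G "Vis v"] by (simp add: vis_rho_def verts_att)

text \<open>Isomorphic graphs with matching pointers are the same graph modulo, so \<open>F\<close>
  and \<open>R\<close> treat them alike. This provides an isomorphism of the images matching the
  pointers, and equality of path classes from there forces it to intertwine the two maps
  \<open>rho\<close>.\<close>

lemma nxt_iso:
  assumes "over G" "over G'" "is_iso f G G'"
  obtains h where "is_iso h (nxt G) (nxt G')"
    "\<And>x. x \<in> verts (att G) \<Longrightarrow> rho G' (map_xv f x) = map_xv h (rho G x)"
proof -
  have gr: "is_graph G" "is_graph (att G)" "is_graph (att G')" "is_graph (att (nxt G))" "is_graph (att (nxt G'))"
    using assms over_nxt graph_over_graph is_graph_att by blast+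
  obtain p where p: "p \<in> verts G" using gr(1) by (auto simp: is_graph_def)
  have fa: "is_iso (map_xv f) (att G) (att G')" by (rule is_iso_att[OF gr(1) assms(3)])
  have v: "map_xv f x \<in> verts (att G')" if "x \<in> verts (att G)" for x
    using that is_iso_verts[OF fa] by blast
  have p': "Vis p \<in> verts (att G)" using p by (simp add: verts_att)
  have eq: "pgm_of (att G, Vis p) = pgm_of (att G', map_xv f (Vis p))"
    by (rule pgm_of_eqI[OF gr(2,3) fa p'])
  then have "pgm_of (att (nxt G), rho G (Vis p)) = pgm_of (att (nxt G'), rho G' (map_xv f (Vis p)))"
    using F_att[OF assms(1) p'] F_att[OF assms(2) v[OF p']] by simp
  then obtain h where h: "is_iso h (nxt G) (nxt G')" "is_iso (map_xv h) (att (nxt G)) (att (nxt G'))"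
    "map_xv h (rho G (Vis p)) = rho G' (map_xv f (Vis p))"
    using pgm_of_att_eqD[OF over_nxt[OF assms(1)] over_nxt[OF assms(2)]
        rho_verts[OF assms(1) p'] rho_verts[OF assms(2) v[OF p']]] by metis
  show thesis
  proof (rule that[OF h(1)])
    fix x assume x: "x \<in> verts (att G)"
    have "cls (att G') (map_xv f (Vis p)) (map_xv f x) = cls (att G) (Vis p) x"
      by (rule is_iso_cls[OF gr(2,3) fa p' x])
    then have "cls (att (nxt G')) (map_xv h (rho G (Vis p))) (rho G' (map_xv f x)) =
      cls (att (nxt G)) (rho G (Vis p)) (rho G x)"
      using R_att[OF assms(1) p' x] R_att[OF assms(2) v[OF p'] v[OF x]] eq h(3) by simp
    then show "rho G' (map_xv f x) = map_xv h (rho G x)"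
      by (rule is_iso_clsD[OF gr(4,5) h(2) rho_verts[OF assms(1) p'] rho_verts[OF assms(1) x]])
  qed
qed

section \<open>The induced dynamics and its bounds\<close>

definition rep :: "('s, 'd, 'p) pgm \<Rightarrow> (nat, 's, 'd, 'p) graph \<times> nat" where
  "rep X = (SOME (G, p). over G \<and> p \<in> verts G \<and> X = pgm_of (G, p))"

definition vis_F :: "('s, 'd, 'p) dyn" where
  "vis_F X = (case rep X of (G, p) \<Rightarrow> pgm_of (nxt G, vis_rho G p))"

definition vis_R :: "('s, 'd, 'p) vmap" where
  "vis_R X u = (case rep X of (G, p) \<Rightarrow>
     cls (nxt G) (vis_rho G p) (vis_rho G (THE v. v \<in> verts G \<and> u = cls G p v)))"

text \<open>The representative picked by \<open>rep\<close> may be exchanged for any other one,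
  since \<open>nxt_iso\<close> supplies an isomorphism of the images compatible with
  \<open>vis_rho\<close>.\<close>

lemma
  assumes "over G" "p \<in> verts G"
  shows vis_F: "vis_F (pgm_of (G, p)) = pgm_of (nxt G, vis_rho G p)"
    and vis_R: "\<And>v. v \<in> verts G \<Longrightarrow>
      vis_R (pgm_of (G, p)) (cls G p v) = cls (nxt G) (vis_rho G p) (vis_rho G v)"
proof -
  obtain G0 p0 where r: "rep (pgm_of (G, p)) = (G0, p0)" by fastforce
  have "case rep (pgm_of (G, p)) of (G0, p0) \<Rightarrow> over G0 \<and> p0 \<in> verts G0 \<and> pgm_of (G, p) = pgm_of (G0, p0)"
    unfolding rep_def by (rule someI[of _ "(G, p)"]) (use assms in simp)
  then have G0: "over G0" "p0 \<in> verts G0" "pgm_of (G0, p0) = pgm_of (G, p)" by (simp_all add: r)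
  have gr: "is_graph G" "is_graph G0" "is_graph (nxt G)" "is_graph (nxt G0)"
    using assms(1) G0(1) over_nxt graph_over_graph by blast+
  obtain f where f: "is_iso f G0 G" "f p0 = p"
    using pgm_of_eqD[OF gr(2,1) G0(3,2) assms(2)] .
  obtain h where h: "is_iso h (nxt G0) (nxt G)"
    "\<And>x. x \<in> verts (att G0) \<Longrightarrow> rho G (map_xv f x) = map_xv h (rho G0 x)"
    using nxt_iso[OF G0(1) assms(1) f(1)] by blast
  have hv: "h (vis_rho G0 v) = vis_rho G (f v)" if "v \<in> verts G0" for v
    using h(2)[of "Vis v"] that by (simp add: vis_rho_def verts_att)
  have p0: "vis_rho G0 p0 \<in> verts (nxt G0)" using vis_rho_verts G0 by blast
  show "vis_F (pgm_of (G, p)) = pgm_of (nxt G, vis_rho G p)"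
    unfolding vis_F_def r using pgm_of_eqI[OF gr(4,3) h(1) p0] hv[OF G0(2)] f(2) by simp
  show "vis_R (pgm_of (G, p)) (cls G p v) = cls (nxt G) (vis_rho G p) (vis_rho G v)"
    if v: "v \<in> verts G" for v
  proof -
    obtain v0 where v0: "v0 \<in> verts G0" "v = f v0" using v is_iso_verts[OF f(1)] by blast
    have c: "cls G p v = cls G0 p0 v0"
      using is_iso_cls[OF gr(2,1) f(1) G0(2) v0(1)] f(2) v0(2) by simp
    have "(THE w. w \<in> verts G0 \<and> cls G p v = cls G0 p0 w) = v0"
      unfolding c using v0(1) cls_inj[OF gr(2) G0(2)] by (intro the_equality) auto
    then show ?thesis
      unfolding vis_R_def r
      using is_iso_cls[OF gr(4,3) h(1) p0 vis_rho_verts[OF G0(1) v0(1)]]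
        hv[OF G0(2)] hv[OF v0(1)] f(2) v0(2) by simp
  qed
qed

lemma vis_R_all: "over G \<Longrightarrow> p \<in> verts G \<Longrightarrow> \<forall>v\<in>verts G.
    vis_R (pgm_of (G, p)) (cls G p v) = cls (nxt G) (vis_rho G p) (vis_rho G v)"
  using vis_R by blast

text \<open>Deep in a tree the step by \<open>pl\<close> to the left child is still readable at the
  image, by quiescence. A visible vertex has no edge at port \<open>pl\<close>, so the image is
  invisible.\<close>

lemma quiescent:
  obtains b where "\<And>G p s. over G \<Longrightarrow> p \<in> verts G \<Longrightarrow> b \<le> length s \<Longrightarrow> depth (rho G (Inv p s)) \<noteq> 0"
proof -
  obtain b where b: "\<And>X s t. X \<in> \<X> \<Longrightarrow> s \<in> lists {(pl, pm), (pr, pm)} \<Longrightarrow> t \<in> lists {(pl, pm), (pr, pm)} \<Longrightarrow>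
    b \<le> length s \<Longrightarrow> R (im_at mm pm pl pr X s) (vertex (im_at mm pm pl pr X s) t) =
      vertex (F (im_at mm pm pl pr X s)) t"
    using IM unfolding IMCGD_def im_quiescent_def by meson
  show thesis
  proof (rule that[of b])
    fix G :: "(nat, 's, 'd, 'p) graph" and p :: nat and s :: "bool list"
    assume G: "over G" "p \<in> verts G" and s: "b \<le> length s"
    have gr: "is_graph G" "is_graph (att G)" "is_graph (att (nxt G))" "is_graph (nxt G)"
      using G over_nxt graph_over_graph is_graph_att by blast+
    \<comment> \<open>\<open>?w\<close> is the descent from the root of the tree to address
      \<open>s\<close>, and \<open>?t\<close> a single step to the left child.\<close>
    let ?w = "map (\<lambda>c. (dir c, pm)) (rev s)" and ?t = "[(pl, pm)]"
    have w: "?w \<in> lists {(pl, pm), (pr, pm)}" by (auto simp: dir_def)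
    have vs: "Vis p \<in> verts (att G)" "Inv p s \<in> verts (att G)" "Inv p (False # s) \<in> verts (att G)"
      using G(2) by (simp_all add: verts_att)
    have "vertex (pgm_of (att G, Vis p)) (down s) = cls (att G) (Vis p) (Inv p s)"
      by (rule vertex_pgm_of[OF gr(2) vs(1) walk_down[OF gr(1) G(2)]])
    then have at: "im_at mm pm pl pr (pgm_of (G, p)) ?w = pgm_of (att G, Inv p s)"
      using repoint_pgm_of[OF gr(2) vs(1,2)] by (simp add: im_at_def embed_pgm_of[OF G] down_def)
    have "walk (att G) (Inv p s) [(dir c, pm)] (Inv p (c # s))" for c
      unfolding walk_single[OF gr(2)] using G(2) by (simp add: att_adj[OF gr(1)])
    from this[of False] have "vertex (pgm_of (att G, Inv p s)) ?t = cls (att G) (Inv p s) (Inv p (False # s))"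
      using vertex_pgm_of[OF gr(2) vs(2)] by (simp add: dir_bool)
    then have "vertex (pgm_of (att (nxt G), rho G (Inv p s))) ?t =
      cls (att (nxt G)) (rho G (Inv p s)) (rho G (Inv p (False # s)))"
      using b[OF pgm_of_in_pgms[OF G] w, of ?t] s
      unfolding at F_att[OF G(1) vs(2)] by (simp add: R_att[OF G(1) vs(2,3)])
    then have "vertex (pgm_of (att (nxt G), rho G (Inv p s))) ?t \<noteq> {}"
      using cls_ne[OF gr(3)] rho_verts[OF G(1)] vs by simp
    then obtain z where "walk (att (nxt G)) (rho G (Inv p s)) ?t z"
      unfolding vertex_def ex_walk_pgm_of[OF gr(3) rho_verts[OF G(1) vs(2)]] by blast
    then have e: "{(rho G (Inv p s), pl), (z, pm)} \<in> edges (att (nxt G))"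
      unfolding walk_single[OF gr(3)] .
    show "depth (rho G (Inv p s)) \<noteq> 0"
    proof
      assume "depth (rho G (Inv p s)) = 0"
      then obtain v where v: "rho G (Inv p s) = Vis v" by (cases "rho G (Inv p s)") auto
      have "pl \<noteq> pm" "pl \<notin> \<pi>" using ports by auto
      then show False using e over_ports(1)[OF over_nxt[OF G(1)]]
        unfolding v att_adj[OF gr(4)] by (cases z) auto
    qed
  qed
qed

text \<open>\<open>modulus n M G p\<close> restates continuity with isomorphisms of disks in place of equalities of path
  classes: an isomorphism \<open>f\<close> of disks of radius \<open>n\<close> around visible vertices induces an isomorphism \<open>g\<close>
  of disks of radius \<open>M\<close> around their images, and \<open>rho\<close> intertwines \<open>f\<close> and \<open>g\<close>.\<close>

definition follows where
  "follows M f g G p G' p' \<longleftrightarrow>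
     is_iso g (graph_disk M (att (nxt G)) (rho G (Vis p))) (graph_disk M (att (nxt G')) (rho G' (Vis p'))) \<and>
     g (rho G (Vis p)) = rho G' (Vis p') \<and>
     (\<forall>v\<in>verts (att G). rho G v \<in> ball (att (nxt G)) (rho G (Vis p)) (M + 1) \<longrightarrow>
       f v \<in> verts (att G') \<and> rho G' (f v) = g (rho G v)) \<and>
     (\<forall>v'\<in>verts (att G'). rho G' v' \<in> ball (att (nxt G')) (rho G' (Vis p')) (M + 1) \<longrightarrow>
       (\<exists>v\<in>verts (att G). rho G v \<in> ball (att (nxt G)) (rho G (Vis p)) (M + 1) \<and> v' = f v))"

definition modulus where
  "modulus n M G p \<longleftrightarrow>
     (\<forall>v\<in>verts (att G). rho G v \<in> ball (att (nxt G)) (rho G (Vis p)) (M + 1) \<longrightarrow>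
       v \<in> ball (att G) (Vis p) (n + 1)) \<and>
     (\<forall>G' p' f. over G' \<longrightarrow> p' \<in> verts G' \<longrightarrow>
       is_iso f (graph_disk n (att G) (Vis p)) (graph_disk n (att G') (Vis p')) \<longrightarrow>
       f (Vis p) = Vis p' \<longrightarrow> (\<exists>g. follows M f g G p G' p'))"

text \<open>\<open>n\<close> is the radius that continuity of \<open>F\<close> gives for
  \<open>M\<close>. Equality of disks yields \<open>g\<close>, and equality of the restrictions of
  \<open>R\<close> yields the two matching conditions.\<close>

lemma continuous_att:
  assumes "over G" "p \<in> verts G"
  shows "\<exists>n. modulus n M G p"
proof -
  let ?X = "pgm_of (att G, Vis p)" and ?y = "rho G (Vis p)"
  have gr: "is_graph (att G)" "is_graph (att (nxt G))"
    using assms(1) over_nxt is_graph_att by blast+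
  have p: "Vis p \<in> verts (att G)" using assms(2) by (simp add: verts_att)
  have y: "?y \<in> verts (att (nxt G))" by (rule rho_verts[OF assms(1) p])
  have "continuous_dyn \<Y> F R" using IM by (simp add: IMCGD_def CGD_def)
  moreover have X: "?X \<in> \<Y>" using impgms_iff assms(1) p by blast
  ultimately obtain n where n: "\<And>u. u \<in> dom_restr F R M ?X \<Longrightarrow> in_disk n ?X u \<noteq> {}"
    "\<And>Z. Z \<in> disk_reps \<Y> n ?X \<Longrightarrow> disk M (F ?X) = disk M (F Z) \<and> restr F R M n ?X = restr F R M n Z"
    unfolding continuous_dyn_def by meson
  note rr = restr_rep[where F = F and R = R and \<rho> = "rho G",
      OF gr(1) p gr(2) y F_att[OF assms(1) p] R_att_all[OF assms(1) p]]
  have dom: "v \<in> ball (att G) (Vis p) (n + 1)"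
    if "v \<in> verts (att G)" "rho G v \<in> ball (att (nxt G)) ?y (M + 1)" for v
  proof -
    have "cls (att G) (Vis p) v \<in> dom_restr F R M ?X" unfolding rr(1) using that by blast
    from n(1)[OF this] show ?thesis
      unfolding in_disk_pgm_of[OF gr(1) p] cls_graph_disk_ne[OF gr(1) p] .
  qed
  have "\<exists>g. follows M f g G p G' p'"
    if G': "over G'" "p' \<in> verts G'"
      and f: "is_iso f (graph_disk n (att G) (Vis p)) (graph_disk n (att G') (Vis p'))" "f (Vis p) = Vis p'"
    for G' :: "(nat, 's, 'd, 'p) graph" and p' f
  proof -
    let ?Z = "pgm_of (att G', Vis p')" and ?y' = "rho G' (Vis p')"
    have gr': "is_graph (att G')" "is_graph (att (nxt G'))"
      using G'(1) over_nxt is_graph_att by blast+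
    have p': "Vis p' \<in> verts (att G')" using G'(2) by (simp add: verts_att)
    have y': "?y' \<in> verts (att (nxt G'))" by (rule rho_verts[OF G'(1) p'])
    note rr' = restr_rep[where F = F and R = R and \<rho> = "rho G'",
        OF gr'(1) p' gr'(2) y' F_att[OF G'(1) p'] R_att_all[OF G'(1) p']]
    have "disk n ?Z = disk n ?X" using disk_eqI[OF gr(1) p gr'(1) p' f] by simp
    moreover have "?Z \<in> \<Y>" using impgms_iff G'(1) p' by blast
    \<comment> \<open>No disk lies in \<open>\<Y>\<close>, so continuity covers every
      \<open>G'\<close> with the same disk.\<close>
    ultimately have "?Z \<in> disk_reps \<Y> n ?X"
      unfolding disk_reps_def using disk_notin_impgms[OF fin(3) assms(1) p] by simp
    from n(2)[OF this] have dk: "disk M (pgm_of (att (nxt G), ?y)) = disk M (pgm_of (att (nxt G'), ?y'))"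
      and rs: "restr F R M n ?X = restr F R M n ?Z"
      unfolding F_att[OF assms(1) p] F_att[OF G'(1) p'] by blast+
    obtain g where g: "is_iso g (graph_disk M (att (nxt G)) ?y) (graph_disk M (att (nxt G')) ?y')" "g ?y = ?y'"
      using disk_eqD[OF gr(2) y gr'(2) y' dk] .
    let ?D = "graph_disk n (att G) (Vis p)" and ?D' = "graph_disk n (att G') (Vis p')"
      and ?B = "graph_disk M (att (nxt G)) ?y" and ?B' = "graph_disk M (att (nxt G')) ?y'"
    have gd: "is_graph ?D" "is_graph ?D'" "is_graph ?B" "is_graph ?B'"
      by (intro is_graph_disk gr gr' p p' y y')+
    have self: "Vis p \<in> verts ?D" "?y \<in> verts ?B" using ball_self p y by simp_all
    \<comment> \<open>Restrictions of \<open>R\<close> are sets of pairs of path classes; equal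
      pairs designate vertices corresponding under \<open>f\<close> and under
      \<open>g\<close>.\<close>
    have match: "v' = f v" "rho G' v' = g (rho G v)"
      if v: "v \<in> verts (att G)" "rho G v \<in> ball (att (nxt G)) ?y (M + 1)"
        and e: "cls ?D' (Vis p') v' = cls ?D (Vis p) v" "cls ?B' ?y' (rho G' v') = cls ?B ?y (rho G v)"
      for v v'
    proof -
      have "v \<in> verts ?D" using dom[OF v] by simp
      then show "v' = f v" using is_iso_clsD[OF gd(1,2) f(1) self(1)] e(1) f(2) by simp
      have "rho G v \<in> verts ?B" using v(2) by simp
      then show "rho G' v' = g (rho G v)" using is_iso_clsD[OF gd(3,4) g(1) self(2)] e(2) g(2) by simp
    qed
    let ?S = "{v \<in> verts (att G). rho G v \<in> ball (att (nxt G)) ?y (M + 1)}"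
    let ?S' = "{v \<in> verts (att G'). rho G' v \<in> ball (att (nxt G')) ?y' (M + 1)}"
    have im: "(\<lambda>v. (cls ?D (Vis p) v, cls ?B ?y (rho G v))) ` ?S =
      (\<lambda>v. (cls ?D' (Vis p') v, cls ?B' ?y' (rho G' v))) ` ?S'"
      using rs unfolding rr(2) rr'(2) .
    have 1: "f v \<in> verts (att G') \<and> rho G' (f v) = g (rho G v)" if v: "v \<in> ?S" for v
    proof -
      have "(cls ?D (Vis p) v, cls ?B ?y (rho G v)) \<in> (\<lambda>v. (cls ?D' (Vis p') v, cls ?B' ?y' (rho G' v))) ` ?S'"
        unfolding im[symmetric] using v by (rule imageI)
      then obtain v' where v': "v' \<in> ?S'" "cls ?D' (Vis p') v' = cls ?D (Vis p) v"
        "cls ?B' ?y' (rho G' v') = cls ?B ?y (rho G v)" by auto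
      with match[of v v'] v show ?thesis by auto
    qed
    have 2: "\<exists>v\<in>?S. v' = f v" if v': "v' \<in> ?S'" for v'
    proof -
      have "(cls ?D' (Vis p') v', cls ?B' ?y' (rho G' v')) \<in> (\<lambda>v. (cls ?D (Vis p) v, cls ?B ?y (rho G v))) ` ?S"
        unfolding im using v' by (rule imageI)
      then obtain v where v: "v \<in> ?S" "cls ?D' (Vis p') v' = cls ?D (Vis p) v"
        "cls ?B' ?y' (rho G' v') = cls ?B ?y (rho G v)" by auto
      with match[of v v'] show ?thesis by auto
    qed
    have "follows M f g G p G' p'"
      unfolding follows_def using g 1 2 by blast
    then show ?thesis by blast
  qed
  with dom show ?thesis unfolding modulus_def by blast
qed

text \<open>The isomorphism extends along the trees of the truncated graphs, whose disks are those
  of the full ones by \<open>graph_disk_att_disk\<close>.\<close>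

lemma disk_att_iso:
  assumes "over G" "p \<in> verts G" "over G'" "p' \<in> verts G'"
    and "is_iso f (graph_disk n G p) (graph_disk n G' p')" "f p = p'"
  shows "is_iso (map_xv f) (graph_disk n (att G) (Vis p)) (graph_disk n (att G') (Vis p'))"
proof -
  have D: "over (graph_disk n G p)" "over (graph_disk n G' p')"
    by (intro graph_over_disk assms(1-4))+
  have "is_iso (map_xv f) (graph_disk n (att (graph_disk n G p)) (Vis p))
    (graph_disk n (att (graph_disk n G' p')) (map_xv f (Vis p)))"
    by (rule is_iso_graph_disk[OF is_graph_att[OF D(1)] is_graph_att[OF D(2)]
          is_iso_att[OF graph_over_graph[OF D(1)] assms(5)]])
      (use ball_self[OF assms(2)] in \<open>simp add: verts_att\<close>)
  then show ?thesis
    using graph_disk_att_disk[OF assms(1,2)] graph_disk_att_disk[OF assms(3,4)] assms(6) by simp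
qed

text \<open>Compactness turns the pointwise continuity of the dynamics into a uniform bound on how far the
  vertices near a visible vertex get separated, and on how deep a visible vertex may sink.\<close>

lemma uniform_bound:
  obtains K where
    "\<And>G p. over G \<Longrightarrow> p \<in> verts G \<Longrightarrow> depth (rho G (Vis p)) \<le> K"
    "\<And>G p s. over G \<Longrightarrow> p \<in> verts G \<Longrightarrow> length s \<le> b \<Longrightarrow>
      rho G (Inv p s) \<in> ball (att (nxt G)) (rho G (Vis p)) K"
proof -
  \<comment> \<open>All representatives of \<open>X\<close> are included, because \<open>rho\<close>
    is chosen for each of them separately.\<close>
  define Q where "Q k X \<longleftrightarrow> (\<forall>(G :: (nat, 's, 'd, 'p) graph) p. over G \<longrightarrow> p \<in> verts G \<longrightarrow> X = pgm_of (G, p) \<longrightarrow>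
    depth (rho G (Vis p)) \<le> k \<and>
    (\<forall>s. length s \<le> b \<longrightarrow> rho G (Inv p s) \<in> ball (att (nxt G)) (rho G (Vis p)) k))" for k X
  have "\<exists>k. \<forall>Z\<in>\<X>. Q k Z"
  proof (rule pgms_compact[OF fin])
    show "Q k' Z" if "Q k Z" "k \<le> k'" for k k' Z
      unfolding Q_def
    proof (intro allI impI conjI)
      fix G :: "(nat, 's, 'd, 'p) graph" and p assume G: "over G" "p \<in> verts G" "Z = pgm_of (G, p)"
      then have q: "depth (rho G (Vis p)) \<le> k"
        "\<And>s. length s \<le> b \<Longrightarrow> rho G (Inv p s) \<in> ball (att (nxt G)) (rho G (Vis p)) k"
        using that(1) unfolding Q_def by blast+
      show "depth (rho G (Vis p)) \<le> k'" using q(1) that(2) by simp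
      fix s :: "bool list" assume "length s \<le> b"
      from q(2)[OF this] show "rho G (Inv p s) \<in> ball (att (nxt G)) (rho G (Vis p)) k'"
        using ball_mono[OF that(2), of "att (nxt G)" "rho G (Vis p)"] by blast
    qed
    fix X assume "X \<in> \<X>"
    then obtain G :: "(nat, 's, 'd, 'p) graph" and p where
    G: "over G" "p \<in> verts G" "X = pgm_of (G, p)" by (auto simp: pgms_def)
    let ?y = "rho G (Vis p)"
    have gr: "is_graph G" "is_graph (att (nxt G))"
      using G over_nxt graph_over_graph is_graph_att by blast+
    have p: "Vis p \<in> verts (att G)" "Inv p s \<in> verts (att G)" for s using G(2) by (simp_all add: verts_att)
    have y: "?y \<in> verts (att (nxt G))" by (rule rho_verts[OF G(1) p(1)])
    \<comment> \<open>For a single graph a bound exists by connectivity, as only finitely many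
      addresses have length at most \<open>b\<close>.\<close>
    have "\<exists>k. \<forall>s\<in>S. rho G (Inv p s) \<in> ball (att (nxt G)) ?y k" if "finite S" for S
      using that
    proof induction
      case (insert s S)
      then obtain k where k: "\<forall>s\<in>S. rho G (Inv p s) \<in> ball (att (nxt G)) ?y k" by blast
      obtain w where w: "walk (att (nxt G)) ?y w (rho G (Inv p s))"
        using walk_connected[OF gr(2) y rho_verts[OF G(1) p(2)]] by blast
      then have "rho G (Inv p s) \<in> ball (att (nxt G)) ?y (length w)" by (auto simp: ball_def)
      then have "\<forall>s\<in>insert s S. rho G (Inv p s) \<in> ball (att (nxt G)) ?y (max k (length w))"
        using k ball_mono[of k "max k (length w)" "att (nxt G)" ?y]
          ball_mono[of "length w" "max k (length w)" "att (nxt G)" ?y] by auto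
      then show ?case by blast
    qed simp
    moreover have "finite {s :: bool list. length s \<le> b}"
      using finite_lists_length_le[of "UNIV :: bool set" b] by simp
    ultimately obtain k where k: "\<And>s. length s \<le> b \<Longrightarrow> rho G (Inv p s) \<in> ball (att (nxt G)) ?y k"
      by blast
    \<comment> \<open>The part \<open>k\<close> places the images of the tree vertices inside the
      disk, and \<open>depth ?y\<close> lets \<open>disk_iso_root\<close> climb from the centre to
      its carrier, so that the depth is transferred too.\<close>
    define M where "M = k + depth ?y"
    obtain n where n: "modulus n M G p" using continuous_att[OF G(1,2)] by blast
    have "Q M Z" if Z: "disk n Z = disk n X" for Z
      unfolding Q_def
    proof (intro allI impI)
      fix G' :: "(nat, 's, 'd, 'p) graph" and p' assume G': "over G'" "p' \<in> verts G'" "Z = pgm_of (G', p')"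
      let ?y' = "rho G' (Vis p')"
      have gr': "is_graph G'" "is_graph (att (nxt G'))"
        using G' over_nxt graph_over_graph is_graph_att by blast+
      have y': "?y' \<in> verts (att (nxt G'))"
        by (rule rho_verts[OF G'(1)]) (use G'(2) in \<open>simp add: verts_att\<close>)
      obtain f where f: "is_iso f (graph_disk n G p) (graph_disk n G' p')" "f p = p'"
        using disk_eqD[OF gr(1) G(2) gr'(1) G'(2)] Z[symmetric] unfolding G(3) G'(3) by blast
      have "map_xv f (Vis p) = Vis p'" using f(2) by simp
      then obtain g where "follows M (map_xv f) g G p G' p'"
        using n disk_att_iso[OF G(1,2) G'(1,2) f] G'(1,2) unfolding modulus_def by blast
      then have g: "is_iso g (graph_disk M (att (nxt G)) ?y) (graph_disk M (att (nxt G')) ?y')"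
        "g ?y = ?y'" "\<And>v. v \<in> verts (att G) \<Longrightarrow> rho G v \<in> ball (att (nxt G)) ?y (M + 1) \<Longrightarrow>
          rho G' (map_xv f v) = g (rho G v)"
        by (simp_all add: follows_def)
      have gy: "g ?y \<in> verts (att (nxt G'))" "is_iso g (graph_disk M (att (nxt G)) ?y) (graph_disk M (att (nxt G')) (g ?y))"
        using y' g by simp_all
      have "g ?y = map_xv (\<lambda>_. root (g ?y)) ?y"
        by (rule disk_iso_root(2)[OF over_nxt[OF G(1)] over_nxt[OF G'(1)] y gy(2,1) ball_self[OF y, of 0]])
          (simp add: M_def)
      then have "depth ?y' = depth ?y" using g(2) by (metis depth_map_xv)
      moreover have "rho G' (Inv p' s) \<in> ball (att (nxt G')) ?y' M" if s: "length s \<le> b" for s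
      proof -
        have 1: "rho G (Inv p s) \<in> ball (att (nxt G)) ?y M"
          using k[OF s] ball_mono[of k M "att (nxt G)" ?y] by (auto simp: M_def)
        then have 2: "rho G (Inv p s) \<in> ball (att (nxt G)) ?y (M + 1)"
          using ball_mono[of M "M + 1" "att (nxt G)" ?y] by auto
        have "rho G' (Inv p' s) = g (rho G (Inv p s))" using g(3)[OF p(2) 2] f(2) by simp
        then show ?thesis
          using disk_iso_mem_ball[OF gr(2) gr'(2) y gy 2, of M] 1 g(2) by simp
      qed
      ultimately show "depth ?y' \<le> M \<and> (\<forall>s. length s \<le> b \<longrightarrow> rho G' (Inv p' s) \<in> ball (att (nxt G')) ?y' M)"
        by (simp add: M_def)
    qed
    then show "\<exists>n k. \<forall>Z\<in>\<X>. disk n Z = disk n X \<longrightarrow> Q k Z" by blast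
  qed
  then obtain K where K: "\<And>Z. Z \<in> \<X> \<Longrightarrow> Q K Z" by blast
  have "depth (rho G (Vis p)) \<le> K \<and>
      (\<forall>s. length s \<le> b \<longrightarrow> rho G (Inv p s) \<in> ball (att (nxt G)) (rho G (Vis p)) K)"
    if "over G" "p \<in> verts G" for G p
    using K[OF pgm_of_in_pgms[OF that]] that unfolding Q_def by blast
  then show thesis using that[of K] by blast
qed

section \<open>The induced dynamics is a CGD\<close>

lemma vis_dynamics: "dynamics \<X> vis_F vis_R"
  unfolding dynamics_def
proof (intro conjI ballI funcsetI)
  fix X assume "X \<in> \<X>"
  then obtain G :: "(nat, 's, 'd, 'p) graph" and p where
    G: "over G" "p \<in> verts G" "X = pgm_of (G, p)" by (auto simp: pgms_def)
  note r = vis_rho_verts[OF G(1)]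
  have N: "is_graph (nxt G)" using over_nxt[OF G(1)] graph_over_graph by blast
  show "vis_F X \<in> \<X>"
    unfolding G(3) vis_F[OF G(1,2)] by (rule pgm_of_in_pgms[OF over_nxt[OF G(1)] r[OF G(2)]])
  show "vis_R X u \<in> V (vis_F X)" if "u \<in> V X" for u
    using that r vis_R[OF G(1,2)]
    unfolding G(3) vis_F[OF G(1,2)] V_pgm_of[OF N r[OF G(2)]] V_pgm_of[OF graph_over_graph[OF G(1)] G(2)]
    by auto
qed

text \<open>A single vertex map \<open>vis_rho G\<close> serves all pointers of \<open>G\<close>, so
  changing the pointer changes nothing else.\<close>

lemma vis_shift_invariant: "shift_invariant \<X> vis_F vis_R"
  unfolding shift_invariant_def
proof (intro ballI)
  fix X u assume "X \<in> \<X>" and u: "u \<in> V X"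
  then obtain G :: "(nat, 's, 'd, 'p) graph" and p where
    G: "over G" "p \<in> verts G" "X = pgm_of (G, p)" by (auto simp: pgms_def)
  note r = vis_rho_verts[OF G(1)]
  have gr: "is_graph G" "is_graph (nxt G)" using G(1) over_nxt graph_over_graph by blast+
  obtain a where a: "a \<in> verts G" "u = cls G p a" using u unfolding G(3) V_pgm_of[OF gr(1) G(2)] by blast
  have rp: "repoint X u = pgm_of (G, a)" unfolding G(3) a(2) by (rule repoint_pgm_of[OF gr(1) G(2) a(1)])
  have Ru: "vis_R X u = cls (nxt G) (vis_rho G p) (vis_rho G a)"
    unfolding G(3) a(2) by (rule vis_R[OF G(1,2) a(1)])
  show "vis_F (repoint X u) = repoint (vis_F X) (vis_R X u) \<and>
    (\<forall>v\<in>V (repoint X u). vis_R X (vcat X u v) = vcat (vis_F X) (vis_R X u) (vis_R (repoint X u) v))"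
  proof (intro conjI ballI)
    show "vis_F (repoint X u) = repoint (vis_F X) (vis_R X u)"
      unfolding rp Ru unfolding G(3) vis_F[OF G(1,2)] vis_F[OF G(1) a(1)]
      by (rule repoint_pgm_of[OF gr(2) r[OF G(2)] r[OF a(1)], symmetric])
    fix v assume "v \<in> V (repoint X u)"
    then obtain c where c: "c \<in> verts G" "v = cls G a c"
      unfolding rp V_pgm_of[OF gr(1) a(1)] by blast
    have "vcat X u v = cls G p c"
      unfolding G(3) a(2) c(2)
      by (rule vcat_pgm_of[OF gr(1) G(2) a(1) c(1) order_refl cls_ne[OF gr(1) a(1) c(1)]])
    moreover have "vcat (vis_F X) (vis_R X u) (vis_R (repoint X u) v) = cls (nxt G) (vis_rho G p) (vis_rho G c)"
      unfolding Ru rp c(2) unfolding vis_R[OF G(1) a(1) c(1)] G(3) vis_F[OF G(1,2)]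
      by (rule vcat_pgm_of[OF gr(2) r[OF G(2)] r[OF a(1)] r[OF c(1)] order_refl
            cls_ne[OF gr(2) r[OF a(1)] r[OF c(1)]]])
    ultimately show "vis_R X (vcat X u v) = vcat (vis_F X) (vis_R X u) (vis_R (repoint X u) v)"
      using vis_R[OF G(1,2) c(1)] G(3) by simp
  qed
qed

text \<open>A visible vertex of the image comes from a vertex of depth less than \<open>b\<close>, by quiescence.\<close>

lemma vis_bounded: "bounded_dyn \<X> vis_F vis_R"
proof -
  obtain b where b: "\<And>G p s. over G \<Longrightarrow> p \<in> verts G \<Longrightarrow> b \<le> length s \<Longrightarrow> depth (rho G (Inv p s)) \<noteq> 0"
    using quiescent by blast
  obtain K where K: "\<And>G p s. over G \<Longrightarrow> p \<in> verts G \<Longrightarrow> length s \<le> b \<Longrightarrow>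
      rho G (Inv p s) \<in> ball (att (nxt G)) (rho G (Vis p)) K"
    using uniform_bound[of b] by metis
  show ?thesis
    unfolding bounded_dyn_def
  proof (intro exI[of _ K] ballI)
    fix X w' assume "X \<in> \<X>" and w': "w' \<in> V (vis_F X)"
    then obtain G :: "(nat, 's, 'd, 'p) graph" and p where
    G: "over G" "p \<in> verts G" "X = pgm_of (G, p)" by (auto simp: pgms_def)
    note r = vis_rho_verts[OF G(1)]
    have gr: "is_graph G" "is_graph (nxt G)" "is_graph (att (nxt G))"
      using G(1) over_nxt graph_over_graph is_graph_att by blast+
    have FX: "vis_F X = pgm_of (nxt G, vis_rho G p)" unfolding G(3) by (rule vis_F[OF G(1,2)])
    obtain z where z: "z \<in> verts (nxt G)" "w' = cls (nxt G) (vis_rho G p) z"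
      using w' unfolding FX V_pgm_of[OF gr(2) r[OF G(2)]] by blast
    have "Vis z \<in> verts (att (nxt G))" using z(1) by (simp add: verts_att)
    then obtain x where x: "x \<in> verts (att G)" "rho G x = Vis z"
      using rho_bij[OF G(1)] unfolding bij_betw_def by force
    have a: "root x \<in> verts G" using x(1) by (simp add: verts_att)
    have "Vis z \<in> ball (att (nxt G)) (rho G (Vis (root x))) K"
    proof (cases x)
      case (Vis v)
      then show ?thesis using x ball_self[OF rho_verts[OF G(1) x(1)]] by simp
    next
      case (Inv v s)
      have "\<not> b \<le> length s" using b[OF G(1), of v s] Inv x a by auto
      then show ?thesis using K[OF G(1), of v s] Inv x a by simp
    qed
    from ball_att_project[OF gr(2) this] have "z \<in> ball (nxt G) (vis_rho G (root x)) K"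
      by (simp add: vis_rho_def)
    \<comment> \<open>The vertices of \<open>disk K\<close> reach distance \<open>K + 1\<close>, so
      a point at distance \<open>K\<close> is inside.\<close>
    then have zb: "z \<in> ball (nxt G) (vis_rho G (root x)) (K + 1)"
      using ball_mono[of K "K + 1" "nxt G" "vis_rho G (root x)"] by auto
    let ?a = "vis_rho G (root x)"
    let ?u = "cls (nxt G) (vis_rho G p) ?a" and ?v = "cls (graph_disk K (nxt G) ?a) ?a z"
    have u: "?u \<in> vis_R X ` V X"
      using vis_R[OF G(1,2) a] a unfolding G(3) V_pgm_of[OF gr(1) G(2)] by (metis imageI)
    have "repoint (vis_F X) ?u = pgm_of (nxt G, ?a)"
      unfolding FX by (rule repoint_pgm_of[OF gr(2) r[OF G(2)] r[OF a]])
    then have "disk K (repoint (vis_F X) ?u) = pgm_of (graph_disk K (nxt G) ?a, ?a)"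
      using disk_pgm_of[OF gr(2) r[OF a]] by simp
    then have v: "?v \<in> V (disk K (repoint (vis_F X) ?u))"
      using V_pgm_of[OF is_graph_disk[OF gr(2) r[OF a]], of ?a] ball_self[OF r[OF a]] zb by simp
    have sub: "?v \<subseteq> cls (nxt G) ?a z" using walk_graph_diskD[OF gr(2)] by (auto simp: cls_def)
    have ne: "?v \<noteq> {}" using cls_graph_disk_ne[OF gr(2) r[OF a]] zb by blast
    have "w' = vcat (vis_F X) ?u ?v"
      unfolding FX z(2) by (rule vcat_pgm_of[OF gr(2) r[OF G(2)] r[OF a] z(1) sub ne, symmetric])
    with u v show "\<exists>u'\<in>vis_R X ` V X. \<exists>v'\<in>V (disk K (repoint (vis_F X) u')). w' = vcat (vis_F X) u' v'"
      by blast
  qed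
qed

text \<open>The only graph to compare with is the truncation \<open>?D\<close>. Its image agrees
  with that of \<open>G\<close> on a disk of radius \<open>M\<close> with invisible matter, and
  \<open>M\<close> is large enough for this disk to contain the visible disk of radius
  \<open>m\<close> and all relevant images together with their carriers.\<close>

lemma vis_continuous: "continuous_dyn \<X> vis_F vis_R"
  unfolding continuous_dyn_def
proof (intro ballI allI)
  fix X m assume "X \<in> \<X>"
  then obtain G :: "(nat, 's, 'd, 'p) graph" and p where
    G: "over G" "p \<in> verts G" "X = pgm_of (G, p)" by (auto simp: pgms_def)
  obtain K where K: "\<And>G p. over G \<Longrightarrow> p \<in> verts G \<Longrightarrow> depth (rho G (Vis p)) \<le> K"
    using uniform_bound[of 0] by metis
  \<comment> \<open>By \<open>near\<close>, the relevant images are within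
    \<open>2 * K + m + 1\<close> of the centre; the third \<open>K\<close> lets
    \<open>disk_iso_root\<close> climb from there to the carrier.\<close>
  define M where "M = 3 * K + m + 1"
  let ?y = "rho G (Vis p)"
  obtain n where n: "modulus n M G p" using continuous_att[OF G(1,2)] by blast
  then have dom: "v \<in> ball (att G) (Vis p) (n + 1)"
    if "v \<in> verts (att G)" "rho G v \<in> ball (att (nxt G)) ?y (M + 1)" for v
    using that by (simp add: modulus_def)
  \<comment> \<open>At most \<open>K\<close> steps up from the image of the pointer,
    \<open>m + 1\<close> across, and at most \<open>K\<close> down. Uniformity of \<open>K\<close>
    matters here: the bound is used for \<open>G\<close> and for its truncation.\<close>
  have near: "rho G (Vis v) \<in> ball (att (nxt G)) (rho G (Vis p)) (2 * K + m + 1)"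
    if G: "over G" "p \<in> verts G" and v: "v \<in> verts G" "vis_rho G v \<in> ball (nxt G) (vis_rho G p) (m + 1)" for G p v
  proof -
    have gr: "is_graph (nxt G)" "is_graph (att (nxt G))"
      using G(1) over_nxt graph_over_graph is_graph_att by blast+
    have vs: "rho G (Vis p) \<in> verts (att (nxt G))" "rho G (Vis v) \<in> verts (att (nxt G))"
      using rho_verts[OF G(1)] G(2) v(1) by (simp_all add: verts_att)
    have "Vis (vis_rho G p) \<in> ball (att (nxt G)) (rho G (Vis p)) (depth (rho G (Vis p)))"
      using root_in_ball[OF gr(1) vs(1)] by (simp add: vis_rho_def)
    from ball_trans[OF gr(2) this ball_att_Vis[OF gr(1) v(2)]]
    have "Vis (vis_rho G v) \<in> ball (att (nxt G)) (rho G (Vis p)) (depth (rho G (Vis p)) + (m + 1))" .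
    moreover have "rho G (Vis v) \<in> ball (att (nxt G)) (Vis (vis_rho G v)) (depth (rho G (Vis v)))"
      using ball_sym[OF gr(2) root_in_ball[OF gr(1) vs(2)]] by (simp add: vis_rho_def)
    ultimately have "rho G (Vis v) \<in> ball (att (nxt G)) (rho G (Vis p))
        (depth (rho G (Vis p)) + (m + 1) + depth (rho G (Vis v)))"
      by (rule ball_trans[OF gr(2)])
    moreover have "depth (rho G (Vis p)) + (m + 1) + depth (rho G (Vis v)) \<le> 2 * K + m + 1"
      using K[OF G] K[OF G(1) v(1)] by simp
    ultimately show ?thesis by (rule subsetD[OF ball_mono, rotated])
  qed
  have MM: "2 * K + m + 1 \<le> M + 1" by (simp add: M_def)
  let ?D = "graph_disk n G p" and ?y' = "rho (graph_disk n G p) (Vis p)"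
  have D: "over ?D" "p \<in> verts ?D"
    using graph_over_disk[OF G(1,2)] ball_self[OF G(2)] by simp_all
  have gr: "is_graph G" "is_graph (nxt G)" "is_graph (att (nxt G))" "is_graph ?D" "is_graph (nxt ?D)"
    "is_graph (att (nxt ?D))"
    using G(1) D(1) over_nxt graph_over_graph is_graph_att by blast+
  have DX: "disk n X = pgm_of (?D, p)" unfolding G(3) by (rule disk_pgm_of[OF gr(1) G(2)])
  then have reps: "disk_reps \<X> n X = {pgm_of (?D, p)}"
    using pgm_of_in_pgms[OF D] by (simp add: disk_reps_def)
  have y: "?y \<in> verts (att (nxt G))" "?y' \<in> verts (att (nxt ?D))"
    using rho_verts[OF G(1)] rho_verts[OF D(1)] G(2) D(2) by (simp_all add: verts_att)
  have r: "vis_rho G p \<in> verts (nxt G)" "vis_rho ?D p \<in> verts (nxt ?D)"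
    using vis_rho_verts G D by blast+
  note rr = restr_rep[where F = vis_F and R = vis_R and \<rho> = "vis_rho G", OF gr(1) G(2) gr(2) r(1) vis_F[OF G(1,2)] vis_R_all[OF G(1,2)]]
  note rr' = restr_rep[where F = vis_F and R = vis_R and \<rho> = "vis_rho (graph_disk n G p)", OF gr(4) D(2) gr(5) r(2) vis_F[OF D] vis_R_all[OF D]]
  \<comment> \<open>The two disks are literally equal, so \<open>modulus\<close> applies with the
    identity and \<open>rho\<close> is compared at the very same vertices.\<close>
  have "is_iso id (graph_disk n (att G) (Vis p)) (graph_disk n (att ?D) (Vis p))"
    using is_iso_id graph_disk_att_disk[OF G(1,2)] by metis
  then obtain g where "follows M id g G p ?D p"
    using n D unfolding modulus_def by (metis id_apply)
  then have g: "is_iso g (graph_disk M (att (nxt G)) ?y) (graph_disk M (att (nxt ?D)) ?y')" "g ?y = ?y'"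
    and fwd: "\<And>v. v \<in> verts (att G) \<Longrightarrow> rho G v \<in> ball (att (nxt G)) ?y (M + 1) \<Longrightarrow>
      v \<in> verts (att ?D) \<and> rho ?D v = g (rho G v)"
    and bwd: "\<And>v. v \<in> verts (att ?D) \<Longrightarrow> rho ?D v \<in> ball (att (nxt ?D)) ?y' (M + 1) \<Longrightarrow>
      v \<in> verts (att G) \<and> rho G v \<in> ball (att (nxt G)) ?y (M + 1)"
    unfolding follows_def by (simp_all only: id_apply) blast+
  have gy: "g ?y \<in> verts (att (nxt ?D))"
    "is_iso g (graph_disk M (att (nxt G)) ?y) (graph_disk M (att (nxt ?D)) (g ?y))"
    using y(2) g by simp_all
  note di = over_nxt[OF G(1)] over_nxt[OF D(1)] y(1) gy(2,1)
  have dy: "depth ?y + m + 1 \<le> M" using K[OF G(1,2)] by (simp add: M_def)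
  let ?h = "root \<circ> g \<circ> Vis"
  have h: "is_iso ?h (graph_disk m (nxt G) (vis_rho G p)) (graph_disk m (nxt ?D) (vis_rho ?D p))"
    using disk_iso_visible[OF di dy] g(2) by (simp add: vis_rho_def)
  have hp: "?h (vis_rho G p) = vis_rho ?D p"
    using disk_iso_root(1)[OF di ball_self[OF y(1), of 0]] dy g(2) by (simp add: vis_rho_def)
  \<comment> \<open>Passing to the carrier commutes with \<open>g\<close>, as both the image and its
    carrier lie within the reach of \<open>disk_iso_root\<close>.\<close>
  have gv: "g (Vis (vis_rho G v)) = Vis (vis_rho ?D v)"
    if v: "v \<in> verts G" "rho G (Vis v) \<in> ball (att (nxt G)) ?y (2 * K + m + 1)" for v
  proof -
    have "rho G (Vis v) \<in> ball (att (nxt G)) ?y (M + 1)" by (rule subsetD[OF ball_mono[OF MM] v(2)])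
    then have "rho ?D (Vis v) = g (rho G (Vis v))" using fwd[of "Vis v"] v(1) by (simp add: verts_att)
    moreover have "2 * K + m + 1 + depth (rho G (Vis v)) \<le> M" using K[OF G(1) v(1)] by (simp add: M_def)
    ultimately show ?thesis
      using disk_iso_root(1)[OF di v(2)] by (simp add: vis_rho_def)
  qed
  let ?S = "{v \<in> verts G. vis_rho G v \<in> ball (nxt G) (vis_rho G p) (m + 1)}"
  let ?S' = "{v \<in> verts ?D. vis_rho ?D v \<in> ball (nxt ?D) (vis_rho ?D p) (m + 1)}"
  have hS: "v \<in> ?S' \<and> ?h (vis_rho G v) = vis_rho ?D v" if v: "v \<in> ?S" for v
  proof -
    have nr: "rho G (Vis v) \<in> ball (att (nxt G)) ?y (2 * K + m + 1)" using near[OF G(1,2)] v by blast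
    have hv: "?h (vis_rho G v) = vis_rho ?D v" using gv[OF _ nr] v by simp
    have "Vis v \<in> verts (att ?D)"
      using fwd[of "Vis v"] nr ball_mono[OF MM, of "att (nxt G)" ?y] v by (auto simp: verts_att)
    then have "v \<in> verts ?D" by (simp add: verts_att del: verts_graph_disk)
    moreover have "vis_rho ?D v \<in> ball (nxt ?D) (vis_rho ?D p) (m + 1)"
      using is_iso_verts[OF h] v hv by (metis (no_types, lifting) imageI mem_Collect_eq verts_graph_disk)
    ultimately show ?thesis using hv by blast
  qed
  \<comment> \<open>Closeness is known only in the truncation. \<open>bwd\<close> brings
    \<open>v\<close> back to \<open>G\<close>, surjectivity of \<open>h\<close> gives a vertex
    \<open>z\<close> of the visible ball with the same image under \<open>g\<close> as the carrier
    of the image of \<open>v\<close>, and injectivity of \<open>g\<close> on the disk identifies the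
    two.\<close>
  have "?S' \<subseteq> ?S"
  proof
    fix v assume v: "v \<in> ?S'"
    have nr': "rho ?D (Vis v) \<in> ball (att (nxt ?D)) ?y' (2 * K + m + 1)" using near[OF D] v by blast
    have "rho ?D (Vis v) \<in> ball (att (nxt ?D)) ?y' (M + 1)" by (rule subsetD[OF ball_mono[OF MM] nr'])
    from bwd[OF _ this] v have vG: "v \<in> verts G" "rho G (Vis v) \<in> ball (att (nxt G)) ?y (M + 1)"
      by (auto simp: verts_att)
    then have "rho ?D (Vis v) = g (rho G (Vis v))" using fwd[of "Vis v"] by (simp add: verts_att)
    then have nr: "rho G (Vis v) \<in> ball (att (nxt G)) ?y (2 * K + m + 1)"
      using disk_iso_mem_ball[OF gr(3,6) y(1) gy vG(2) MM] nr' g(2) by simp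
    obtain z where z: "z \<in> ball (nxt G) (vis_rho G p) (m + 1)" "?h z = vis_rho ?D v"
      using is_iso_verts[OF h] v by auto
    have z': "z \<in> ball (nxt G) (root ?y) (m + 1)" using z(1) by (simp add: vis_rho_def)
    have gz: "g (Vis z) = g (Vis (vis_rho G v))"
      using disk_iso_ball(1)[OF di z'] dy gv[OF vG(1) nr] z(2) by simp
    have "Vis z \<in> ball (att (nxt G)) ?y M"
      using Vis_ball_subset[OF over_nxt[OF G(1)] y(1), of "m + 1" M] dy z' by auto
    then have zM: "Vis z \<in> ball (att (nxt G)) ?y (M + 1)"
      using ball_mono[of M "M + 1" "att (nxt G)" ?y] by auto
    have "Vis (root (rho G (Vis v))) \<in> ball (att (nxt G)) ?y (2 * K + m + 1 + depth (rho G (Vis v)))"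
      by (rule ball_trans[OF gr(3) nr root_in_ball[OF gr(2) rho_verts[OF G(1)]]])
        (use vG in \<open>simp add: verts_att\<close>)
    moreover have "2 * K + m + 1 + depth (rho G (Vis v)) \<le> M + 1"
      using K[OF G(1) vG(1)] by (simp add: M_def)
    ultimately have "Vis (vis_rho G v) \<in> ball (att (nxt G)) ?y (M + 1)"
      unfolding vis_rho_def by (rule subsetD[OF ball_mono, rotated])
    with zM gz have "z = vis_rho G v" using is_iso_inj[OF g(1)] by (auto dest: inj_onD)
    with z(1) vG(1) show "v \<in> ?S" by blast
  qed
  with hS have S: "?S' = ?S" by blast
  have rs: "restr vis_F vis_R m n X = restr vis_F vis_R m n (pgm_of (?D, p))"
    unfolding G(3) rr(2) rr'(2) S
  proof (rule image_cong[OF refl])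
    fix v assume v: "v \<in> ?S"
    have "cls (graph_disk m (nxt ?D) (?h (vis_rho G p))) (?h (vis_rho G p)) (?h (vis_rho G v)) =
      cls (graph_disk m (nxt G) (vis_rho G p)) (vis_rho G p) (vis_rho G v)"
      by (rule is_iso_cls[OF is_graph_disk[OF gr(2) r(1)]])
        (use v h hp is_graph_disk[OF gr(5) r(2)] ball_self[OF r(1)] in \<open>simp_all del: comp_apply\<close>)
    then have "cls (graph_disk m (nxt ?D) (vis_rho ?D p)) (vis_rho ?D p) (vis_rho ?D v) =
      cls (graph_disk m (nxt G) (vis_rho G p)) (vis_rho G p) (vis_rho G v)"
      using hp hS[OF v] by (simp del: comp_apply)
    moreover have "graph_disk n ?D p = ?D" by (rule graph_disk_graph_disk[OF gr(1) G(2) order_refl])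
    ultimately show "(cls ?D p v, cls (graph_disk m (nxt G) (vis_rho G p)) (vis_rho G p) (vis_rho G v)) =
      (cls (graph_disk n ?D p) p v, cls (graph_disk m (nxt ?D) (vis_rho ?D p)) (vis_rho ?D p) (vis_rho ?D v))"
      by simp
  qed
  have dk: "disk m (vis_F X) = disk m (vis_F (pgm_of (?D, p)))"
    unfolding G(3) vis_F[OF G(1,2)] vis_F[OF D] by (rule disk_eqI[OF gr(2) r(1) gr(5) r(2) h hp])
  have "in_disk n X u \<noteq> {}" if u: "u \<in> dom_restr vis_F vis_R m X" for u
  proof -
    obtain v where v: "v \<in> ?S" "u = cls G p v" using u unfolding G(3) rr(1) by blast
    have "rho G (Vis v) \<in> ball (att (nxt G)) ?y (M + 1)"
      using near[OF G(1,2)] v(1) by (intro subsetD[OF ball_mono[OF MM]]) blast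
    then have "Vis v \<in> ball (att G) (Vis p) (n + 1)" using dom v(1) by (simp add: verts_att)
    from ball_att_project[OF gr(1) this] have "v \<in> ball G p (n + 1)" by simp
    then show ?thesis
      unfolding G(3) v(2) in_disk_pgm_of[OF gr(1) G(2)] cls_graph_disk_ne[OF gr(1) G(2)] .
  qed
  with rs dk reps show "\<exists>n. (\<forall>u\<in>dom_restr vis_F vis_R m X. in_disk n X u \<noteq> {}) \<and>
    (\<forall>Z\<in>disk_reps \<X> n X. disk m (vis_F X) = disk m (vis_F Z) \<and>
      restr vis_F vis_R m n X = restr vis_F vis_R m n Z)"
    by (intro exI[of _ n]) simp
qed

lemma vis_CGD: "CGD \<X> vis_F vis_R"
  unfolding CGD_def using vis_dynamics vis_continuous vis_shift_invariant vis_bounded by blast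

section \<open>The anonymous dynamics and its invertibility\<close>

definition anon_F :: "('s, 'd, 'p) anon \<Rightarrow> ('s, 'd, 'p) anon" where
  "anon_F a = forget_pointer (vis_F (SOME X. X \<in> \<X> \<and> forget_pointer X = a))"

text \<open>Whichever pointed graph is picked, its underlying graph is isomorphic to
  \<open>G\<close>, and \<open>nxt_iso\<close> carries this over to the images.\<close>

lemma anon_F:
  assumes "over G"
  shows "anon_F (anon_of G) = anon_of (nxt G)"
proof -
  have gr: "is_graph G" using assms graph_over_graph by blast
  obtain p where p: "p \<in> verts G" using gr by (auto simp: is_graph_def)
  let ?X = "SOME X. X \<in> \<X> \<and> forget_pointer X = anon_of G"
  have "?X \<in> \<X> \<and> forget_pointer ?X = anon_of G"
    by (rule someI[of _ "pgm_of (G, p)"]) (use pgm_of_in_pgms[OF assms p] in \<open>simp add: forget_pgm_of\<close>)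
  then obtain G0 :: "(nat, 's, 'd, 'p) graph" and p0 where G0: "over G0" "p0 \<in> verts G0" "?X = pgm_of (G0, p0)" "anon_of G0 = anon_of G"
    by (auto simp: pgms_def forget_pgm_of)
  obtain f where f: "is_iso f G0 G" using anon_of_eqD[OF graph_over_graph[OF G0(1)] gr G0(4)] .
  obtain h where "is_iso h (nxt G0) (nxt G)" using nxt_iso[OF G0(1) assms f] by blast
  then have "anon_of (nxt G0) = anon_of (nxt G)"
    using anon_of_eqI over_nxt G0(1) assms graph_over_graph by blast
  then show ?thesis by (simp add: anon_F_def G0(3) vis_F[OF G0(1,2)] forget_pgm_of)
qed

lemma anon_F_ACGD: "ACGD \<Sigma> \<Delta> \<pi> anon_F"
  unfolding ACGD_def
proof (intro conjI exI[of _ vis_F] exI[of _ vis_R] ballI vis_CGD)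
  show "anon_F \<in> anons \<Sigma> \<Delta> \<pi> \<rightarrow> anons \<Sigma> \<Delta> \<pi>"
    using anon_F anon_of_in_anons[OF over_nxt] by (auto simp: anons_def)
  fix X assume "X \<in> \<X>"
  then obtain G :: "(nat, 's, 'd, 'p) graph" and p where
    G: "over G" "p \<in> verts G" "X = pgm_of (G, p)" by (auto simp: pgms_def)
  then show "anon_F (forget_pointer X) = forget_pointer (vis_F X)"
    by (simp add: forget_pgm_of anon_F vis_F)
qed

lemma anon_F_alpha: "Y \<in> \<Y> \<Longrightarrow> anon_F (alpha mm Y) = alpha mm (F Y)"
  by (auto simp: impgms_iff alpha_pgm_of_att anon_F F_att over_nxt)

lemma anon_F_inj:
  assumes F: "inj_on F \<Y>" and G: "over G" "over G'" "anon_of (nxt G) = anon_of (nxt G')"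
  shows "anon_of G = anon_of G'"
proof -
  have gr: "is_graph G" "is_graph G'" "is_graph (nxt G)" "is_graph (nxt G')" "is_graph (att (nxt G))" "is_graph (att (nxt G'))"
    using G over_nxt graph_over_graph is_graph_att by blast+
  obtain h where h: "is_iso h (nxt G) (nxt G')" using anon_of_eqD[OF gr(3,4) G(3)] .
  note h' = is_iso_att[OF gr(3) h]
  obtain p where p: "p \<in> verts G" using gr(1) by (auto simp: is_graph_def)
  then have u: "Vis p \<in> verts (att G)" by (simp add: verts_att)
  let ?y = "rho G (Vis p)"
  have y: "?y \<in> verts (att (nxt G))" by (rule rho_verts[OF G(1) u])
  then have "map_xv h ?y \<in> verts (att (nxt G'))" using is_iso_verts[OF h'] by blast
  \<comment> \<open>\<open>u'\<close> may be invisible, so the comparison takes place in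
    \<open>\<Y>\<close>; an isomorphism of the graphs with trees still restricts to the visible
    graphs.\<close>
  then obtain u' where u': "u' \<in> verts (att G')" "rho G' u' = map_xv h ?y"
    using rho_bij[OF G(2)] unfolding bij_betw_def by force
  have "F (pgm_of (att G, Vis p)) = F (pgm_of (att G', u'))"
    unfolding F_att[OF G(1) u] F_att[OF G(2) u'(1)] u'(2) by (rule pgm_of_eqI[OF gr(5,6) h' y])
  moreover have "pgm_of (att G, Vis p) \<in> \<Y>" "pgm_of (att G', u') \<in> \<Y>"
    using impgms_iff G(1,2) u u'(1) by blast+
  ultimately have "pgm_of (att G, Vis p) = pgm_of (att G', u')" using F by (auto dest: inj_onD)
  then obtain f where "is_iso f G G'" using pgm_of_att_eqD[OF G(1,2) u u'(1)] by metis
  then show ?thesis by (rule anon_of_eqI[OF gr(1,2)])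
qed

text \<open>For surjectivity, a preimage under \<open>F\<close> of \<open>H\<close> with its trees
  is sent by \<open>alpha\<close> to a preimage of the anonymous graph of \<open>H\<close>.\<close>

lemma anon_F_bij:
  assumes "bij_betw F \<Y> \<Y>"
  shows "bij_betw anon_F (anons \<Sigma> \<Delta> \<pi>) (anons \<Sigma> \<Delta> \<pi>)"
  unfolding bij_betw_def
proof
  have F: "inj_on F \<Y>" "F ` \<Y> = \<Y>" using assms by (simp_all add: bij_betw_def)
  show "inj_on anon_F (anons \<Sigma> \<Delta> \<pi>)"
  proof (rule inj_onI)
    fix a a' assume "a \<in> anons \<Sigma> \<Delta> \<pi>" "a' \<in> anons \<Sigma> \<Delta> \<pi>" and e: "anon_F a = anon_F a'"
    then obtain G G' :: "(nat, 's, 'd, 'p) graph" where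
      G: "over G" "a = anon_of G" "over G'" "a' = anon_of G'" unfolding anons_def by blast
    have "anon_of (nxt G) = anon_of (nxt G')"
      using e unfolding G(2,4) anon_F[OF G(1)] anon_F[OF G(3)] .
    from anon_F_inj[OF F(1) G(1,3) this] show "a = a'" unfolding G(2,4) .
  qed
  show "anon_F ` anons \<Sigma> \<Delta> \<pi> = anons \<Sigma> \<Delta> \<pi>"
  proof
    show "anon_F ` anons \<Sigma> \<Delta> \<pi> \<subseteq> anons \<Sigma> \<Delta> \<pi>"
      using anon_F_ACGD by (auto simp: ACGD_def)
    show "anons \<Sigma> \<Delta> \<pi> \<subseteq> anon_F ` anons \<Sigma> \<Delta> \<pi>"
    proof
      fix a assume "a \<in> anons \<Sigma> \<Delta> \<pi>"
      then obtain H :: "(nat, 's, 'd, 'p) graph" where H: "over H" "a = anon_of H" by (auto simp: anons_def)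
      obtain p where p: "p \<in> verts H" using graph_over_graph[OF H(1)] by (auto simp: is_graph_def)
      then have "Vis p \<in> verts (att H)" by (simp add: verts_att)
      then have "pgm_of (att H, Vis p) \<in> F ` \<Y>"
        unfolding F(2) using impgms_iff H(1) by blast
      then obtain Y where Y: "Y \<in> \<Y>" "F Y = pgm_of (att H, Vis p)" by force
      then have "anon_F (alpha mm Y) = a" using anon_F_alpha H by (simp add: alpha_pgm_of_att)
      moreover have "alpha mm Y \<in> anons \<Sigma> \<Delta> \<pi>"
        using Y(1) anon_of_in_anons by (auto simp: impgms_iff alpha_pgm_of_att)
      ultimately show "a \<in> anon_F ` anons \<Sigma> \<Delta> \<pi>" by blast
    qed
  qed
qed

end

theorem theorem7:
  fixes \<Sigma> :: "'s set" and \<Delta> :: "'d set" and \<pi> :: "'p set"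
    and mm :: 's and pm pl pr :: 'p
    and F :: "('s, 'd, 'p) pgm \<Rightarrow> ('s, 'd, 'p) pgm"
    and R :: "('s, 'd, 'p) pgm \<Rightarrow> 'p word set \<Rightarrow> 'p word set"
  assumes "finite \<Sigma>" and "finite \<Delta>" and "finite \<pi>"
    and "mm \<notin> \<Sigma>" and "pm \<notin> \<pi>" and "pl \<notin> \<pi>" and "pr \<notin> \<pi>" and "distinct [pm, pl, pr]"
    and "IMCGD \<Sigma> \<Delta> \<pi> mm pm pl pr F R"
  shows "\<exists>Ft. ACGD \<Sigma> \<Delta> \<pi> Ft
            \<and> (\<forall>Y\<in>impgms \<Sigma> \<Delta> \<pi> mm pm pl pr. Ft (alpha mm Y) = alpha mm (F Y))
            \<and> (invertible_IMCGD \<Sigma> \<Delta> \<pi> mm pm pl pr F R \<longrightarrow> invertible_ACGD \<Sigma> \<Delta> \<pi> Ft)"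
proof -
  interpret imcgd \<Sigma> \<Delta> \<pi> mm pm pl pr F R
    by unfold_locales (use assms in auto)
  show ?thesis
    using anon_F_ACGD anon_F_alpha anon_F_bij
    unfolding invertible_IMCGD_def invertible_ACGD_def by blast
qed

end
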